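(* Let $K$ be a number field, $\mathfrak{p}$ a non-archimedean prime of $K$, $D_\mathfrak{p}$ a finite-dimensional central division algebra over the completion $K_\mathfrak{p}$, $n\ge 1$, and let $\mathcal{O}\subset M_n(D_\mathfrak{p})$ be a tiled $R_\mathfrak{p}$-order, where $R_\mathfrak{p}$ is the valuation ring of $K_\mathfrak{p}$. Then $\mathcal{O}$ has finite elasticity, i.e. $\rho(\mathcal{O}^\bullet)<\infty$, if and only if $\mathcal{O}$ is hereditary.
   Context: $\Delta_\mathfrak{p}$ denotes the unique maximal $R_\mathfrak{p}$-order of $D_\mathfrak{p}$. An $R_\mathfrak{p}$-order in $M_n(D_\mathfrak{p})$ is a subring, finitely generated as an $R_\mathfrak{p}$-module, that spans $M_n(D_\mathfrak{p})$ over $K_\mathfrak{p}$. It is tiled if it contains a conjugate of the ring of diagonal matrices $\mathrm{Diag}(\Delta_\mathfrak{p},\dots,\Delta_\mathfrak{p})$, and hereditary if each of its right ideals is projective. $\mathcal{O}^\bullet$ is the multiplicative monoid of cancellative elements (non-zero-divisors) of $\mathcal{O}$; it is atomic. In a cancellative monoid $T$ with unit group $T^\times$, an atom is a non-invertible $a$ such that $a=bc$ implies $b\in T^\times$ or $c\in T^\times$; $L(a)$ is the set of $k\ge 0$ such that $a=\epsilon u_1\cdots u_k$ with $\epsilon\in T^\times$ and atoms $u_i$; $\rho(a)=\sup L(a)/\min L(a)$ for $a\in T\setminus T^\times$, $\rho(a)=1$ for $a\in T^\times$; the elasticity is $\rho(T)=\sup_{a\in T}\rho(a)$. *)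

theory Defs
  imports "HOL-Analysis.Analysis" "HOL-Algebra.Algebra"
begin

definition type_ring :: "'a::ring_1 ring" where
  "type_ring =
     \<lparr>carrier = UNIV, monoid.mult = (*), one = 1, ring.zero = 0, add = (+)\<rparr>"

section \<open>Number fields, primes and completions\<close>

definition number_field :: "'k::field_char_0 itself \<Rightarrow> bool" where
  "number_field _ \<longleftrightarrow>
     (\<exists>B. finite_dimensional_vector_space (\<lambda>(q::rat) (x::'k). of_rat q * x) B)"

text \<open>A non-archimedean prime is an equivalence class of nontrivial non-archimedean absolute
  values; it is given here by a representative. The completion, its valuation ring, and all
  notions derived from them do not depend on the representative.\<close>

definition nonarch_absolute_value :: "('k::field \<Rightarrow> real) \<Rightarrow> bool" where
  "nonarch_absolute_value v \<longleftrightarrow>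
     (\<forall>x. 0 \<le> v x) \<and> (\<forall>x. v x = 0 \<longleftrightarrow> x = 0) \<and>
     (\<forall>x y. v (x * y) = v x * v y) \<and>
     (\<forall>x y. v (x + y) \<le> max (v x) (v y)) \<and>
     (\<exists>x. x \<noteq> 0 \<and> v x \<noteq> 1)"

text \<open>The field \<open>'f\<close> with absolute value \<open>w\<close> and embedding \<open>j\<close> is a completion of \<open>'k\<close>
  with respect to \<open>v\<close>; this determines \<open>('f, w, j)\<close> up to unique isomorphism.\<close>

definition is_completion ::
  "('k::field \<Rightarrow> real) \<Rightarrow> ('k \<Rightarrow> 'f::field) \<Rightarrow> ('f \<Rightarrow> real) \<Rightarrow> bool" where
  "is_completion v j w \<longleftrightarrow>
     nonarch_absolute_value w \<and>
     j \<in> ring_hom type_ring type_ring \<and>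
     (\<forall>x. w (j x) = v x) \<and>
     Metric_space.mcomplete UNIV (\<lambda>x y. w (x - y)) \<and>
     (\<forall>x. \<forall>\<epsilon>>0. \<exists>a. w (x - j a) < \<epsilon>)"

definition valuation_ring :: "('f::field \<Rightarrow> real) \<Rightarrow> 'f set" where
  "valuation_ring w = {x. w x \<le> 1}"

section \<open>Central division algebras and matrix rings\<close>

definition central_division_algebra :: "('f::field \<Rightarrow> 'd::division_ring) \<Rightarrow> bool" where
  "central_division_algebra \<iota> \<longleftrightarrow>
     \<iota> \<in> ring_hom type_ring type_ring \<and>
     range \<iota> = {z. \<forall>x. z * x = x * z} \<and>
     (\<exists>B. finite_dimensional_vector_space (\<lambda>c x. \<iota> c * x) B)"

text \<open>The multiplication \<open>(*)\<close> of the type \<open>'d ^ 'n ^ 'n\<close> is componentwise, so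
  \<^const>\<open>type_ring\<close> is not the matrix ring.\<close>

definition matrix_ring :: "('d::ring_1 ^ 'n ^ 'n) ring" where
  "matrix_ring =
     \<lparr>carrier = UNIV, monoid.mult = (**), one = mat 1, ring.zero = 0, add = (+)\<rparr>"

lemma ring_matrix_ring: "ring (matrix_ring :: ('d::ring_1 ^ 'n ^ 'n) ring)"
proof (rule ringI)
  show "abelian_group (matrix_ring :: ('d ^ 'n ^ 'n) ring)"
  proof (rule abelian_groupI)
    show "\<exists>y\<in>carrier matrix_ring. y \<oplus>\<^bsub>matrix_ring\<^esub> x = \<zero>\<^bsub>matrix_ring\<^esub>" for x :: "'d ^ 'n ^ 'n"
      by (rule bexI[of _ "- x"]) (simp_all add: matrix_ring_def)
  qed (simp_all add: matrix_ring_def ac_simps)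
  show "Group.monoid (matrix_ring :: ('d ^ 'n ^ 'n) ring)"
    by (rule monoidI) (simp_all add: matrix_ring_def matrix_mul_assoc)
qed (simp_all add: matrix_ring_def matrix_add_ldistrib,
    simp add: matrix_matrix_mult_def vec_eq_iff distrib_right sum.distrib)

definition scalar_matrix :: "('f \<Rightarrow> 'd::ring_1) \<Rightarrow> 'f \<Rightarrow> 'd ^ 'n ^ 'n" where
  "scalar_matrix \<iota> c = mat (\<iota> c)"

section \<open>Orders\<close>

text \<open>\<open>sc\<close> is the structure map of \<open>A\<close> as an algebra over the field \<open>'f\<close>.\<close>

definition linear_span ::
  "'f set \<Rightarrow> ('f \<Rightarrow> 'a) \<Rightarrow> ('a, 'm) ring_scheme \<Rightarrow> 'a set \<Rightarrow> 'a set" where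
  "linear_span C sc A S =
     {\<Oplus>\<^bsub>A\<^esub>s\<in>T. sc (c s) \<otimes>\<^bsub>A\<^esub> s | T c. finite T \<and> T \<subseteq> S \<and> (\<forall>s\<in>T. c s \<in> C)}"

definition is_order ::
  "'f::field set \<Rightarrow> ('f \<Rightarrow> 'a) \<Rightarrow> ('a, 'm) ring_scheme \<Rightarrow> 'a set \<Rightarrow> bool" where
  "is_order C sc A \<O> \<longleftrightarrow>
     subring \<O> A \<and>
     (\<exists>S. finite S \<and> S \<subseteq> \<O> \<and> \<O> = linear_span C sc A S) \<and>
     linear_span UNIV sc A \<O> = carrier A"

definition is_maximal_order ::
  "'f::field set \<Rightarrow> ('f \<Rightarrow> 'a) \<Rightarrow> ('a, 'm) ring_scheme \<Rightarrow> 'a set \<Rightarrow> bool" where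
  "is_maximal_order C sc A \<O> \<longleftrightarrow>
     is_order C sc A \<O> \<and> (\<forall>\<O>'. is_order C sc A \<O>' \<and> \<O> \<subseteq> \<O>' \<longrightarrow> \<O>' = \<O>)"

definition the_maximal_order :: "('f::field \<Rightarrow> real) \<Rightarrow> ('f \<Rightarrow> 'd::division_ring) \<Rightarrow> 'd set" where
  "the_maximal_order w \<iota> =
     (THE \<Delta>. is_maximal_order (valuation_ring w) \<iota> type_ring \<Delta>)"

definition diagonal_matrices :: "'d::ring_1 set \<Rightarrow> ('d ^ 'n ^ 'n) set" where
  "diagonal_matrices \<Delta> =
     {Y. (\<forall>i. Y $ i $ i \<in> \<Delta>) \<and> (\<forall>i j. i \<noteq> j \<longrightarrow> Y $ i $ j = 0)}"

definition is_tiled_order ::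
  "('f::field \<Rightarrow> real) \<Rightarrow> ('f \<Rightarrow> 'd::division_ring) \<Rightarrow> ('d ^ 'n ^ 'n) set \<Rightarrow> bool" where
  "is_tiled_order w \<iota> \<O> \<longleftrightarrow>
     is_order (valuation_ring w) (scalar_matrix \<iota>) matrix_ring \<O> \<and>
     (\<exists>U V :: 'd ^ 'n ^ 'n. U ** V = mat 1 \<and> V ** U = mat 1 \<and>
        (\<lambda>Y. U ** Y ** V) ` diagonal_matrices (the_maximal_order w \<iota>) \<subseteq> \<O>)"

section \<open>Right modules and hereditary rings\<close>

text \<open>Library modules are modules over commutative rings. Below, \<open>r \<odot>\<^bsub>M\<^esub> x\<close> stands for the
  right action \<open>x r\<close>, so that associativity reads \<open>x (a b) = (x a) b\<close>.\<close>

locale right_module = R?: ring R + M?: abelian_group M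
  for R :: "('r, 'x) ring_scheme" (structure) and M :: "('r, 'm, 'y) module_scheme" (structure) +
  assumes rsmult_closed:
      "\<lbrakk>a \<in> carrier R; x \<in> carrier M\<rbrakk> \<Longrightarrow> a \<odot>\<^bsub>M\<^esub> x \<in> carrier M"
    and rsmult_distr_scalar:
      "\<lbrakk>a \<in> carrier R; b \<in> carrier R; x \<in> carrier M\<rbrakk> \<Longrightarrow>
        (a \<oplus> b) \<odot>\<^bsub>M\<^esub> x = a \<odot>\<^bsub>M\<^esub> x \<oplus>\<^bsub>M\<^esub> b \<odot>\<^bsub>M\<^esub> x"
    and rsmult_distr_vector:
      "\<lbrakk>a \<in> carrier R; x \<in> carrier M; y \<in> carrier M\<rbrakk> \<Longrightarrow>
        a \<odot>\<^bsub>M\<^esub> (x \<oplus>\<^bsub>M\<^esub> y) = a \<odot>\<^bsub>M\<^esub> x \<oplus>\<^bsub>M\<^esub> a \<odot>\<^bsub>M\<^esub> y"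
    and rsmult_assoc:
      "\<lbrakk>a \<in> carrier R; b \<in> carrier R; x \<in> carrier M\<rbrakk> \<Longrightarrow>
        (a \<otimes> b) \<odot>\<^bsub>M\<^esub> x = b \<odot>\<^bsub>M\<^esub> (a \<odot>\<^bsub>M\<^esub> x)"
    and rsmult_one: "x \<in> carrier M \<Longrightarrow> \<one> \<odot>\<^bsub>M\<^esub> x = x"

definition right_module_hom ::
  "('r, 'x) ring_scheme \<Rightarrow> ('r, 'm, 'y) module_scheme \<Rightarrow> ('r, 'n, 'z) module_scheme
    \<Rightarrow> ('m \<Rightarrow> 'n) set" where
  "right_module_hom R M N =
     {f \<in> carrier M \<rightarrow> carrier N.
        (\<forall>x\<in>carrier M. \<forall>y\<in>carrier M. f (x \<oplus>\<^bsub>M\<^esub> y) = f x \<oplus>\<^bsub>N\<^esub> f y) \<and>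
        (\<forall>a\<in>carrier R. \<forall>x\<in>carrier M. f (a \<odot>\<^bsub>M\<^esub> x) = a \<odot>\<^bsub>N\<^esub> f x)}"

text \<open>The lifting property. A definition can only quantify over modules whose elements lie in a
  fixed type; \<open>'p \<Rightarrow> 'r\<close> has room for the free module on the elements of \<open>P\<close>, which is enough:
  by lemma \<open>projective_lifting\<close> below, the lifting property then holds for modules over all types.\<close>

definition right_projective ::
  "('r, 'x) ring_scheme \<Rightarrow> ('r, 'p, 'y) module_scheme \<Rightarrow> bool" where
  "right_projective R P \<longleftrightarrow>
     right_module R P \<and>
     (\<forall>(M :: ('r, 'p \<Rightarrow> 'r) module) (N :: ('r, 'p \<Rightarrow> 'r) module) g f.
        right_module R M \<and> right_module R N \<and>
        g \<in> right_module_hom R M N \<and> g ` carrier M = carrier N \<and>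
        f \<in> right_module_hom R P N \<longrightarrow>
        (\<exists>h\<in>right_module_hom R P M. \<forall>x\<in>carrier P. g (h x) = f x))"

lemma (in right_module) rsmult_zero_left:
  assumes "x \<in> carrier M" shows "\<zero> \<odot>\<^bsub>M\<^esub> x = \<zero>\<^bsub>M\<^esub>"
proof -
  have "\<zero> \<odot>\<^bsub>M\<^esub> x \<oplus>\<^bsub>M\<^esub> \<zero> \<odot>\<^bsub>M\<^esub> x = \<zero> \<odot>\<^bsub>M\<^esub> x"
    using rsmult_distr_scalar[of \<zero> \<zero> x] assms by simp
  then show ?thesis
    using rsmult_closed[of \<zero> x] assms by (metis M.add.l_cancel_one' R.zero_closed)
qed

lemma right_module_hom_zero:
  assumes "right_module R M" "right_module R N" "f \<in> right_module_hom R M N"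
  shows "f \<zero>\<^bsub>M\<^esub> = \<zero>\<^bsub>N\<^esub>"
proof -
  interpret M: right_module R M by fact
  interpret N: right_module R N by fact
  have "f \<zero>\<^bsub>M\<^esub> \<in> carrier N" "f (\<zero>\<^bsub>M\<^esub> \<oplus>\<^bsub>M\<^esub> \<zero>\<^bsub>M\<^esub>) = f \<zero>\<^bsub>M\<^esub> \<oplus>\<^bsub>N\<^esub> f \<zero>\<^bsub>M\<^esub>"
    using assms(3) M.M.zero_closed unfolding right_module_hom_def by blast+
  then show ?thesis by (simp add: N.M.add.l_cancel_one')
qed

lemma right_module_hom_finsum:
  assumes "right_module R M" "right_module R N" "f \<in> right_module_hom R M N"
    and "finite A" "u \<in> A \<rightarrow> carrier M"
  shows "f (finsum M u A) = finsum N (\<lambda>a. f (u a)) A"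
proof -
  interpret M: right_module R M by fact
  interpret N: right_module R N by fact
  have cl: "f x \<in> carrier N" if "x \<in> carrier M" for x
    using assms(3) that by (auto simp: right_module_hom_def)
  have ad: "f (x \<oplus>\<^bsub>M\<^esub> y) = f x \<oplus>\<^bsub>N\<^esub> f y" if "x \<in> carrier M" "y \<in> carrier M" for x y
    using assms(3) that by (auto simp: right_module_hom_def)
  from assms(4,5) show ?thesis
  proof (induction A rule: finite_induct)
    case empty
    show ?case using right_module_hom_zero[OF assms(1-3)] by simp
  next
    case (insert a A)
    then have "finsum M u A \<in> carrier M" by (intro M.M.finsum_closed) auto
    moreover have "f (finsum M u A) = finsum N (\<lambda>a. f (u a)) A" using insert by auto
    moreover have "finsum M u (insert a A) = u a \<oplus>\<^bsub>M\<^esub> finsum M u A"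
      using insert by (intro M.M.finsum_insert) auto
    moreover have "finsum N (\<lambda>a. f (u a)) (insert a A) = f (u a) \<oplus>\<^bsub>N\<^esub> finsum N (\<lambda>a. f (u a)) A"
      using insert cl by (intro N.M.finsum_insert) (auto simp: Pi_iff)
    ultimately show ?case using ad insert.prems by simp
  qed
qed

definition free_right_module :: "('r, 'x) ring_scheme \<Rightarrow> 'p set \<Rightarrow> ('r, 'p \<Rightarrow> 'r) module" where
  "free_right_module R B =
     \<lparr>carrier = {t. (\<forall>x. t x \<in> carrier R) \<and> {x. t x \<noteq> \<zero>\<^bsub>R\<^esub>} \<subseteq> B \<and> finite {x. t x \<noteq> \<zero>\<^bsub>R\<^esub>}},
      monoid.mult = undefined, one = undefined,
      ring.zero = (\<lambda>x. \<zero>\<^bsub>R\<^esub>), add = (\<lambda>s t x. s x \<oplus>\<^bsub>R\<^esub> t x),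
      smult = (\<lambda>a t x. t x \<otimes>\<^bsub>R\<^esub> a)\<rparr>"

lemma free_right_module:
  fixes R :: "('r, 'x) ring_scheme" (structure) and B :: "'p set"
  assumes "ring R"
  shows "right_module R (free_right_module R B)"
proof -
  interpret ring R by fact
  let ?F = "free_right_module R B"
  have fin_add: "finite {x. s x \<oplus> t x \<noteq> \<zero>}"
    if "finite {x. s x \<noteq> \<zero>}" "finite {x. t x \<noteq> \<zero>}" for s t :: "'p \<Rightarrow> 'r"
    by (rule finite_subset[OF _ finite_UnI[OF that]]) auto
  have "abelian_group ?F"
  proof (rule abelian_groupI)
    fix t assume t: "t \<in> carrier ?F"
    then have *: "{x. \<ominus> t x \<noteq> \<zero>} = {x. t x \<noteq> \<zero>}"
      by (auto simp: free_right_module_def)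
    show "\<exists>s\<in>carrier ?F. s \<oplus>\<^bsub>?F\<^esub> t = \<zero>\<^bsub>?F\<^esub>"
      by (rule bexI[of _ "\<lambda>x. \<ominus> t x"])
        (use t * in \<open>auto simp: free_right_module_def l_neg\<close>)
  next
    fix s t assume "s \<in> carrier ?F" "t \<in> carrier ?F"
    moreover have "{x. s x \<oplus> t x \<noteq> \<zero>} \<subseteq> {x. s x \<noteq> \<zero>} \<union> {x. t x \<noteq> \<zero>}"
      by auto
    ultimately show "s \<oplus>\<^bsub>?F\<^esub> t \<in> carrier ?F"
      using fin_add[of s t] unfolding free_right_module_def by auto
  qed (auto simp: free_right_module_def a_ac)
  then show ?thesis
  proof (rule right_module.intro[OF assms _ right_module_axioms.intro])
    fix a t assume at: "a \<in> carrier R" "t \<in> carrier ?F"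
    then have "\<And>x. t x \<in> carrier R" "{x. t x \<noteq> \<zero>} \<subseteq> B" "finite {x. t x \<noteq> \<zero>}"
      by (auto simp: free_right_module_def)
    moreover have "{x. t x \<otimes> a \<noteq> \<zero>} \<subseteq> {x. t x \<noteq> \<zero>}" using at(1) by auto
    ultimately have "(\<forall>x. t x \<otimes> a \<in> carrier R) \<and> {x. t x \<otimes> a \<noteq> \<zero>} \<subseteq> B \<and> finite {x. t x \<otimes> a \<noteq> \<zero>}"
      using at(1) finite_subset subset_trans by (meson m_closed)
    then show "a \<odot>\<^bsub>?F\<^esub> t \<in> carrier ?F" by (simp add: free_right_module_def)
  qed (simp_all add: free_right_module_def r_distr l_distr m_assoc)
qed

text \<open>The linear map from the free module with basis \<open>B\<close> that extends \<open>u\<close> on the basis.\<close>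

definition free_extension ::
  "('r, 'x) ring_scheme \<Rightarrow> ('r, 'm, 'y) module_scheme \<Rightarrow> ('p \<Rightarrow> 'm) \<Rightarrow> ('p \<Rightarrow> 'r) \<Rightarrow> 'm" where
  "free_extension R M u t = (\<Oplus>\<^bsub>M\<^esub>x\<in>{x. t x \<noteq> \<zero>\<^bsub>R\<^esub>}. t x \<odot>\<^bsub>M\<^esub> u x)"

lemma free_extension_superset:
  assumes "right_module R M" "t \<in> carrier (free_right_module R B)" "u \<in> B \<rightarrow> carrier M"
    and "finite T" "{x. t x \<noteq> \<zero>\<^bsub>R\<^esub>} \<subseteq> T" "T \<subseteq> B"
  shows "free_extension R M u t = (\<Oplus>\<^bsub>M\<^esub>x\<in>T. t x \<odot>\<^bsub>M\<^esub> u x)"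
proof -
  interpret M: right_module R M by fact
  have t: "t x \<in> carrier R" for x using assms(2) by (auto simp: free_right_module_def)
  have "u x \<in> carrier M" if "x \<in> T" for x using assms(3,6) that by auto
  then show ?thesis unfolding free_extension_def
    by (intro M.M.add.finprod_mono_neutral_cong_left)
       (use assms(4,5) t in \<open>auto simp: M.rsmult_zero_left intro: M.rsmult_closed\<close>)
qed

lemma free_extension_hom:
  assumes "right_module R M" "u \<in> B \<rightarrow> carrier M"
  shows "free_extension R M u \<in> right_module_hom R (free_right_module R B) M"
proof -
  interpret M: right_module R M by fact
  let ?F = "free_right_module R B"
  interpret F: right_module R ?F by (rule free_right_module) (rule M.R.ring_axioms)
  have tc: "t x \<in> carrier R" if "t \<in> carrier ?F" for t x
    using that by (auto simp: free_right_module_def)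
  have ucl: "u x \<in> carrier M" if "x \<in> B" for x using assms that by auto
  have supp: "finite {x. t x \<noteq> \<zero>\<^bsub>R\<^esub>}" "{x. t x \<noteq> \<zero>\<^bsub>R\<^esub>} \<subseteq> B" if "t \<in> carrier ?F" for t
    using that by (auto simp: free_right_module_def)
  have closed: "free_extension R M u t \<in> carrier M" if "t \<in> carrier ?F" for t
    unfolding free_extension_def
    by (intro M.M.finsum_closed) (use supp[OF that] tc[OF that] ucl M.rsmult_closed in auto)
  have add: "free_extension R M u (s \<oplus>\<^bsub>?F\<^esub> t) = free_extension R M u s \<oplus>\<^bsub>M\<^esub> free_extension R M u t"
    if s: "s \<in> carrier ?F" and t: "t \<in> carrier ?F" for s t
  proof -
    let ?T = "{x. s x \<noteq> \<zero>\<^bsub>R\<^esub>} \<union> {x. t x \<noteq> \<zero>\<^bsub>R\<^esub>}"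
    have T: "finite ?T" "?T \<subseteq> B" using supp[OF s] supp[OF t] by auto
    have st: "(s \<oplus>\<^bsub>?F\<^esub> t) x = s x \<oplus>\<^bsub>R\<^esub> t x" for x by (simp add: free_right_module_def)
    have "free_extension R M u (s \<oplus>\<^bsub>?F\<^esub> t) = (\<Oplus>\<^bsub>M\<^esub>x\<in>?T. (s \<oplus>\<^bsub>?F\<^esub> t) x \<odot>\<^bsub>M\<^esub> u x)"
      by (rule free_extension_superset[where B = B])
        (use assms T s t st in \<open>auto simp: F.M.a_closed\<close>)
    also have "\<dots> = (\<Oplus>\<^bsub>M\<^esub>x\<in>?T. s x \<odot>\<^bsub>M\<^esub> u x \<oplus>\<^bsub>M\<^esub> t x \<odot>\<^bsub>M\<^esub> u x)"
      by (intro M.M.finsum_cong' refl)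
        (use T tc[OF s] tc[OF t] ucl st in
          \<open>auto simp: M.rsmult_distr_scalar M.rsmult_closed subset_iff\<close>)
    also have "\<dots> = (\<Oplus>\<^bsub>M\<^esub>x\<in>?T. s x \<odot>\<^bsub>M\<^esub> u x) \<oplus>\<^bsub>M\<^esub> (\<Oplus>\<^bsub>M\<^esub>x\<in>?T. t x \<odot>\<^bsub>M\<^esub> u x)"
      by (rule M.M.finsum_addf)
        (use T(2) tc[OF s] tc[OF t] ucl in \<open>auto simp: M.rsmult_closed subset_iff\<close>)
    also have "(\<Oplus>\<^bsub>M\<^esub>x\<in>?T. s x \<odot>\<^bsub>M\<^esub> u x) = free_extension R M u s"
      by (rule free_extension_superset[where B = B, symmetric]) (use assms T s in auto)
    also have "(\<Oplus>\<^bsub>M\<^esub>x\<in>?T. t x \<odot>\<^bsub>M\<^esub> u x) = free_extension R M u t"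
      by (rule free_extension_superset[where B = B, symmetric]) (use assms T t in auto)
    finally show ?thesis .
  qed
  have smult: "free_extension R M u (a \<odot>\<^bsub>?F\<^esub> t) = a \<odot>\<^bsub>M\<^esub> free_extension R M u t"
    if t: "t \<in> carrier ?F" and a: "a \<in> carrier R" for a t
  proof -
    let ?T = "{x. t x \<noteq> \<zero>\<^bsub>R\<^esub>}"
    have hom: "(\<lambda>m. a \<odot>\<^bsub>M\<^esub> m) \<in> carrier M \<rightarrow> carrier M"
      using a by (auto simp: M.rsmult_closed)
    have at: "(a \<odot>\<^bsub>?F\<^esub> t) x = t x \<otimes>\<^bsub>R\<^esub> a" for x by (simp add: free_right_module_def)
    have "free_extension R M u (a \<odot>\<^bsub>?F\<^esub> t) = (\<Oplus>\<^bsub>M\<^esub>x\<in>?T. (a \<odot>\<^bsub>?F\<^esub> t) x \<odot>\<^bsub>M\<^esub> u x)"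
      by (rule free_extension_superset[where B = B])
        (use assms supp[OF t] F.rsmult_closed[OF a t] at a in auto)
    also have "\<dots> = (\<Oplus>\<^bsub>M\<^esub>x\<in>?T. a \<odot>\<^bsub>M\<^esub> (t x \<odot>\<^bsub>M\<^esub> u x))"
      by (intro M.M.finsum_cong' refl)
        (use supp[OF t] tc[OF t] ucl at a in \<open>auto simp: M.rsmult_assoc M.rsmult_closed subset_iff\<close>)
    also have "\<dots> = a \<odot>\<^bsub>M\<^esub> (\<Oplus>\<^bsub>M\<^esub>x\<in>?T. t x \<odot>\<^bsub>M\<^esub> u x)"
    proof -
      have "(\<Oplus>\<^bsub>M\<^esub>x\<in>A. a \<odot>\<^bsub>M\<^esub> (t x \<odot>\<^bsub>M\<^esub> u x)) = a \<odot>\<^bsub>M\<^esub> (\<Oplus>\<^bsub>M\<^esub>x\<in>A. t x \<odot>\<^bsub>M\<^esub> u x)"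
        if "finite A" "A \<subseteq> B" for A
        using that
      proof (induction A rule: finite_induct)
        case empty
        have "a \<odot>\<^bsub>M\<^esub> \<zero>\<^bsub>M\<^esub> \<oplus>\<^bsub>M\<^esub> a \<odot>\<^bsub>M\<^esub> \<zero>\<^bsub>M\<^esub> = a \<odot>\<^bsub>M\<^esub> \<zero>\<^bsub>M\<^esub>"
          using M.rsmult_distr_vector[OF a, of "\<zero>\<^bsub>M\<^esub>" "\<zero>\<^bsub>M\<^esub>"] by simp
        then show ?case using M.rsmult_closed[OF a M.M.zero_closed]
          by (simp add: M.M.add.l_cancel_one')
      next
        case (insert y A)
        have c: "t x \<odot>\<^bsub>M\<^esub> u x \<in> carrier M" if "x \<in> insert y A" for x
          using that insert.prems tc[OF t] ucl by (auto intro!: M.rsmult_closed)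
        have "(\<Oplus>\<^bsub>M\<^esub>x\<in>A. t x \<odot>\<^bsub>M\<^esub> u x) \<in> carrier M"
          by (intro M.M.finsum_closed) (use c in auto)
        then show ?case using insert c a
          by (simp add: M.rsmult_distr_vector M.rsmult_closed Pi_iff)
      qed
      then show ?thesis using supp[OF t] by blast
    qed
    finally show ?thesis by (simp add: free_extension_def)
  qed
  show ?thesis unfolding right_module_hom_def using closed add smult by blast
qed

lemma right_projective_splits:
  fixes R :: "('r, 'x) ring_scheme" and P :: "('r, 'p, 'y) module_scheme"
  assumes "right_projective R P"
  obtains s where "s \<in> right_module_hom R P (free_right_module R (carrier P))"
    and "\<And>x. x \<in> carrier P \<Longrightarrow> free_extension R P (\<lambda>x. x) (s x) = x"
proof -
  interpret P: right_module R P using assms by (simp add: right_projective_def)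
  let ?F = "free_right_module R (carrier P)"
  interpret F: right_module R ?F by (rule free_right_module) (rule P.R.ring_axioms)
  define \<delta> :: "'p \<Rightarrow> 'p \<Rightarrow> 'r" where "\<delta> x = (\<lambda>y. if y = x then \<one>\<^bsub>R\<^esub> else \<zero>\<^bsub>R\<^esub>)" for x
  have \<delta>F: "\<delta> x \<in> carrier ?F" if "x \<in> carrier P" for x
    using that by (auto simp: \<delta>_def free_right_module_def)
  have \<delta>_ext: "free_extension R P (\<lambda>x. x) (\<delta> x) = x" if "x \<in> carrier P" for x
  proof -
    have "free_extension R P (\<lambda>x. x) (\<delta> x) = (\<Oplus>\<^bsub>P\<^esub>y\<in>{x}. \<delta> x y \<odot>\<^bsub>P\<^esub> y)"
      by (rule free_extension_superset[where B = "carrier P"])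
        (use that \<delta>F P.right_module_axioms in \<open>auto simp: \<delta>_def\<close>)
    then show ?thesis using that by (simp add: \<delta>_def P.rsmult_one)
  qed
  define p where "p t = free_extension R P (\<lambda>x. x) t" for t
  have p\<delta>: "p (\<delta> x) = x" if "x \<in> carrier P" for x using \<delta>_ext[OF that] by (simp add: p_def)
  have p: "p \<in> right_module_hom R ?F P"
    using free_extension_hom[OF P.right_module_axioms, of "\<lambda>x. x" "carrier P"]
    by (simp add: p_def[abs_def])
  \<comment> \<open>a copy of \<open>P\<close> with elements in \<open>'p \<Rightarrow> 'r\<close>\<close>
  define N :: "('r, 'p \<Rightarrow> 'r) module" where
    "N = \<lparr>carrier = \<delta> ` carrier P, monoid.mult = undefined, one = undefined,
       ring.zero = \<delta> \<zero>\<^bsub>P\<^esub>, add = (\<lambda>s t. \<delta> (p s \<oplus>\<^bsub>P\<^esub> p t)), smult = (\<lambda>a t. \<delta> (a \<odot>\<^bsub>P\<^esub> p t))\<rparr>"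
  have "abelian_group N"
  proof (rule abelian_groupI)
    fix t assume "t \<in> carrier N"
    then obtain x where x: "x \<in> carrier P" "t = \<delta> x" by (auto simp: N_def)
    then show "\<exists>s\<in>carrier N. s \<oplus>\<^bsub>N\<^esub> t = \<zero>\<^bsub>N\<^esub>"
      by (intro bexI[of _ "\<delta> (\<ominus>\<^bsub>P\<^esub> x)"]) (auto simp: N_def p\<delta> P.M.l_neg)
  qed (auto simp: N_def p\<delta> P.M.a_ac)
  then have N: "right_module R N"
    by (intro right_module.intro P.R.ring_axioms right_module_axioms.intro)
      (auto simp: N_def p\<delta> P.rsmult_closed P.rsmult_distr_scalar P.rsmult_distr_vector
        P.rsmult_assoc P.rsmult_one)
  have pF: "p t \<in> carrier P" if "t \<in> carrier ?F" for t
    using p that by (auto simp: right_module_hom_def)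
  have g: "(\<lambda>t. \<delta> (p t)) \<in> right_module_hom R ?F N"
    using p pF by (auto simp: right_module_hom_def N_def p\<delta>)
  have surj: "(\<lambda>t. \<delta> (p t)) ` carrier ?F = carrier N"
  proof
    show "(\<lambda>t. \<delta> (p t)) ` carrier ?F \<subseteq> carrier N" using pF by (auto simp: N_def)
    show "carrier N \<subseteq> (\<lambda>t. \<delta> (p t)) ` carrier ?F"
    proof
      fix t assume "t \<in> carrier N"
      then obtain x where x: "x \<in> carrier P" "t = \<delta> x" by (auto simp: N_def)
      then have "t = \<delta> (p (\<delta> x))" by (simp add: p\<delta>)
      with x \<delta>F show "t \<in> (\<lambda>t. \<delta> (p t)) ` carrier ?F" by blast
    qed
  qed
  have f: "\<delta> \<in> right_module_hom R P N"
    by (auto simp: right_module_hom_def N_def p\<delta>)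
  obtain s where s: "s \<in> right_module_hom R P ?F" and eq: "\<forall>x\<in>carrier P. \<delta> (p (s x)) = \<delta> x"
    using assms F.right_module_axioms N g surj f unfolding right_projective_def by meson
  show ?thesis
  proof (rule that[OF s])
    fix x assume x: "x \<in> carrier P"
    then have "s x \<in> carrier ?F" using s by (auto simp: right_module_hom_def)
    then have "p (s x) \<in> carrier P" by (rule pF)
    then have "p (s x) = x" using eq x p\<delta> by metis
    then show "free_extension R P (\<lambda>x. x) (s x) = x" by (simp add: p_def)
  qed
qed

lemma projective_lifting:
  fixes R :: "('r, 'x) ring_scheme" and P :: "('r, 'p, 'y) module_scheme"
    and M :: "('r, 'm, 'z) module_scheme" and N :: "('r, 'n, 'w) module_scheme"
  assumes P: "right_projective R P" and M: "right_module R M" and N: "right_module R N"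
    and g: "g \<in> right_module_hom R M N" "g ` carrier M = carrier N"
    and f: "f \<in> right_module_hom R P N"
  shows "\<exists>h\<in>right_module_hom R P M. \<forall>x\<in>carrier P. g (h x) = f x"
proof -
  interpret P: right_module R P using P by (simp add: right_projective_def)
  interpret M: right_module R M by fact
  interpret N: right_module R N by fact
  let ?F = "free_right_module R (carrier P)"
  obtain s where s: "s \<in> right_module_hom R P ?F"
    and sid: "\<And>x. x \<in> carrier P \<Longrightarrow> free_extension R P (\<lambda>x. x) (s x) = x"
    using right_projective_splits[OF P] by blast
  have "\<forall>x\<in>carrier P. \<exists>m\<in>carrier M. g m = f x"
  proof
    fix x assume "x \<in> carrier P"
    then have "f x \<in> g ` carrier M" using f g(2) by (auto simp: right_module_hom_def)
    then show "\<exists>m\<in>carrier M. g m = f x" by auto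
  qed
  then obtain u where u: "\<And>x. x \<in> carrier P \<Longrightarrow> u x \<in> carrier M"
    and gu: "\<And>x. x \<in> carrier P \<Longrightarrow> g (u x) = f x" by metis
  have e: "free_extension R M u \<in> right_module_hom R ?F M"
    by (rule free_extension_hom[OF M]) (use u in auto)
  have h: "(\<lambda>x. free_extension R M u (s x)) \<in> right_module_hom R P M"
    using s e by (auto simp: right_module_hom_def Pi_iff)
  have "g (free_extension R M u (s x)) = f x" if x: "x \<in> carrier P" for x
  proof -
    let ?T = "{y. s x y \<noteq> \<zero>\<^bsub>R\<^esub>}"
    have "s x \<in> carrier ?F" using s x by (auto simp: right_module_hom_def)
    then have T: "finite ?T" "?T \<subseteq> carrier P" "\<And>y. s x y \<in> carrier R"
      by (auto simp: free_right_module_def)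
    have "g (free_extension R M u (s x)) = (\<Oplus>\<^bsub>N\<^esub>y\<in>?T. g (s x y \<odot>\<^bsub>M\<^esub> u y))"
      unfolding free_extension_def
      by (rule right_module_hom_finsum[OF M N g(1)]) (use T u in \<open>auto intro!: M.rsmult_closed\<close>)
    also have "\<dots> = (\<Oplus>\<^bsub>N\<^esub>y\<in>?T. f (s x y \<odot>\<^bsub>P\<^esub> y))"
    proof (intro N.M.finsum_cong' refl)
      show "(\<lambda>y. f (s x y \<odot>\<^bsub>P\<^esub> y)) \<in> ?T \<rightarrow> carrier N"
        using f T by (auto simp: right_module_hom_def Pi_iff intro!: P.rsmult_closed)
      fix y assume "y \<in> ?T"
      then have "y \<in> carrier P" using T by auto
      then show "g (s x y \<odot>\<^bsub>M\<^esub> u y) = f (s x y \<odot>\<^bsub>P\<^esub> y)"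
        using g(1) f T(3) u gu by (simp add: right_module_hom_def)
    qed
    also have "\<dots> = f (\<Oplus>\<^bsub>P\<^esub>y\<in>?T. s x y \<odot>\<^bsub>P\<^esub> y)"
      by (rule right_module_hom_finsum[OF P.right_module_axioms N f, symmetric])
        (use T in \<open>auto intro!: P.rsmult_closed\<close>)
    also have "\<dots> = f x" using sid[OF x] by (simp add: free_extension_def)
    finally show ?thesis .
  qed
  then show ?thesis by (intro bexI[OF _ h]) simp
qed

definition right_ideal :: "'a set \<Rightarrow> ('a, 'm) ring_scheme \<Rightarrow> bool" where
  "right_ideal I R \<longleftrightarrow>
     additive_subgroup I R \<and> (\<forall>x\<in>I. \<forall>a\<in>carrier R. x \<otimes>\<^bsub>R\<^esub> a \<in> I)"

definition right_ideal_module :: "('a, 'm) ring_scheme \<Rightarrow> 'a set \<Rightarrow> ('a, 'a) module" where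
  "right_ideal_module R I =
     \<lparr>carrier = I, monoid.mult = (\<otimes>\<^bsub>R\<^esub>), one = \<one>\<^bsub>R\<^esub>, ring.zero = \<zero>\<^bsub>R\<^esub>, add = (\<oplus>\<^bsub>R\<^esub>),
      smult = (\<lambda>a x. x \<otimes>\<^bsub>R\<^esub> a)\<rparr>"

definition right_hereditary :: "('a, 'm) ring_scheme \<Rightarrow> bool" where
  "right_hereditary R \<longleftrightarrow>
     (\<forall>I. right_ideal I R \<longrightarrow> right_projective R (right_ideal_module R I))"

section \<open>Factorizations and elasticity\<close>

definition cancellative_monoid :: "('a, 'm) ring_scheme \<Rightarrow> 'a monoid" where
  "cancellative_monoid R =
     \<lparr>carrier = {a \<in> carrier R. \<forall>b\<in>carrier R. \<forall>c\<in>carrier R.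
         (a \<otimes>\<^bsub>R\<^esub> b = a \<otimes>\<^bsub>R\<^esub> c \<longrightarrow> b = c) \<and> (b \<otimes>\<^bsub>R\<^esub> a = c \<otimes>\<^bsub>R\<^esub> a \<longrightarrow> b = c)},
      monoid.mult = (\<otimes>\<^bsub>R\<^esub>), one = \<one>\<^bsub>R\<^esub>\<rparr>"

definition atoms :: "('a, 'm) monoid_scheme \<Rightarrow> 'a set" where
  "atoms T = {a \<in> carrier T. a \<notin> Units T \<and>
     (\<forall>b\<in>carrier T. \<forall>c\<in>carrier T. a = b \<otimes>\<^bsub>T\<^esub> c \<longrightarrow> b \<in> Units T \<or> c \<in> Units T)}"

definition length_set :: "('a, 'm) monoid_scheme \<Rightarrow> 'a \<Rightarrow> nat set" where
  "length_set T a = {k. \<exists>\<epsilon>\<in>Units T. \<exists>us. length us = k \<and> set us \<subseteq> atoms T \<and>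
     a = \<epsilon> \<otimes>\<^bsub>T\<^esub> foldr (\<otimes>\<^bsub>T\<^esub>) us \<one>\<^bsub>T\<^esub>}"

text \<open>If \<open>T\<close> is atomic and \<open>a\<close> is not a unit, then \<open>length_set T a\<close> is a nonempty set of
  positive integers, so that the quotient below is not degenerate.\<close>

definition element_elasticity :: "('a, 'm) monoid_scheme \<Rightarrow> 'a \<Rightarrow> ennreal" where
  "element_elasticity T a =
     (if a \<in> Units T then 1
      else (SUP k\<in>length_set T a. of_nat k) / of_nat (Inf (length_set T a)))"

definition elasticity :: "('a, 'm) monoid_scheme \<Rightarrow> ennreal" where
  "elasticity T = (SUP a\<in>carrier T. element_elasticity T a)"

end

theory Submission
  imports Defs
begin

text \<open>In coordinates in which it contains the diagonal matrices, a tiled order consists of the matrices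
  whose \<open>(i, j)\<close> entry has valuation at least \<open>lam i j\<close>, and it is hereditary if and only if
  \<open>lam i j + lam j i \<le> 1\<close> for all \<open>i \<noteq> j\<close>. In that case a bound on the lengths of chains of principal
  right ideals bounds the elasticity. If instead \<open>lam i j + lam j i \<ge> 2\<close>, then a matrix that is the
  identity outside the rows and columns \<open>i\<close> and \<open>j\<close>, with off-diagonal entries of least possible
  valuation and with both diagonal entries non-units there, is an atom. The matrix with \<open>\<pi>\<^sup>N\<close> at
  \<open>(i, i)\<close> and \<open>(j, j)\<close> is a product of two such atoms, but also of at least \<open>N\<close> atoms.\<close>

section \<open>Discrete valuations\<close>

text \<open>The exponents \<open>lam\<close> presuppose a valuation on the division algebra whose
  valuation ring is the unique maximal order. It is obtained from compactness: a bounded subring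
  that is maximal under inclusion is local with principal radical, and a generator of the radical is
  the uniformizer. The threshold 1 comes from rounding. If all sums \<open>lam i j + lam j i\<close>
  are at most 1, membership in the order is nonnegativity of a weight that is additive on products,
  so an entry of least weight divides the others and can serve as pivot. Applied to the inverse of
  an atom, this bounds its denominators by \<pi>. A product of k atoms thus has an inverse with
  denominators at most \<pi>^k, and for matrices of size n any other factorization of it has length
  at most n^2 k. In the other case the obstacle is that the factors of a block matrix need not be
  block matrices. A unit of the order inserted between two factors makes both of them the identity
  outside the block.\<close>

locale discrete_valuation =
  fixes val :: "'d::division_ring \<Rightarrow> int" and \<pi> :: 'd
  assumes val_mult: "x \<noteq> 0 \<Longrightarrow> y \<noteq> 0 \<Longrightarrow> val (x * y) = val x + val y"
    and val_add: "x \<noteq> 0 \<Longrightarrow> y \<noteq> 0 \<Longrightarrow> x + y \<noteq> 0 \<Longrightarrow> min (val x) (val y) \<le> val (x + y)"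
    and \<pi>_nonzero [simp]: "\<pi> \<noteq> 0" and val_\<pi> [simp]: "val \<pi> = 1"
begin

lemma val_1 [simp]: "val 1 = 0"
  using val_mult[of 1 1] by simp

lemma val_inverse: "x \<noteq> 0 \<Longrightarrow> val (inverse x) = - val x"
  using val_mult[of x "inverse x"] by simp

lemma val_minus [simp]: "val (- x) = val x"
proof (cases "x = 0")
  case False
  have "val (-1) + val (-1) = 0" using val_mult[of "-1" "-1"] by simp
  then show ?thesis using val_mult[of "-1" x] False by simp
qed simp

lemma val_power: "x \<noteq> 0 \<Longrightarrow> val (x ^ n) = int n * val x"
  by (induction n) (auto simp: val_mult algebra_simps)

lemma val_powi [simp]: "val (\<pi> powi k) = k"
  by (simp add: power_int_def val_power val_inverse)

text \<open>\<open>val 0\<close> is an unspecified integer; \<open>vge k\<close> describes the k-th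
  power of the maximal ideal, a fractional ideal if k is negative, in such a way that 0 always
  belongs to it.\<close>

definition vge :: "int \<Rightarrow> 'd \<Rightarrow> bool" where "vge k x \<longleftrightarrow> x = 0 \<or> k \<le> val x"

lemma vge_0 [simp]: "vge k 0"
  by (simp add: vge_def)

lemma vge_mono: "vge k x \<Longrightarrow> l \<le> k \<Longrightarrow> vge l x"
  by (auto simp: vge_def)

lemma vge_add: "vge k x \<Longrightarrow> vge k y \<Longrightarrow> vge k (x + y)"
  using val_add[of x y] by (cases "x = 0"; cases "y = 0"; cases "x + y = 0") (auto simp: vge_def)

lemma vge_minus [simp]: "vge k (- x) \<longleftrightarrow> vge k x"
  by (simp add: vge_def)

lemma vge_diff: "vge k x \<Longrightarrow> vge k y \<Longrightarrow> vge k (x - y)"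
  using vge_add[of k x "- y"] by simp

lemma vge_mult: "vge k x \<Longrightarrow> vge l y \<Longrightarrow> k + l = m \<Longrightarrow> vge m (x * y)"
  by (auto simp: vge_def val_mult)

lemma vge_sum: "(\<And>i. i \<in> A \<Longrightarrow> vge k (f i)) \<Longrightarrow> vge k (sum f A)"
  by (induction A rule: infinite_finite_induct) (auto intro: vge_add)

lemma vge_1 [simp]: "vge k 1 \<longleftrightarrow> k \<le> 0"
  by (simp add: vge_def)

lemma vge_powi [simp]: "vge k (\<pi> powi l) \<longleftrightarrow> k \<le> l"
  by (simp add: vge_def)

lemma vge_exactD: "vge k x \<Longrightarrow> \<not> vge (k + 1) x \<Longrightarrow> x \<noteq> 0 \<and> val x = k"
  by (auto simp: vge_def)

end

section \<open>Completions of number fields\<close>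

locale nonarch_field =
  fixes v :: "'k::field \<Rightarrow> real"
  assumes nonarch: "nonarch_absolute_value v"
begin

lemma v_nonneg [simp]: "0 \<le> v x"
  and v_eq_0_iff [simp]: "v x = 0 \<longleftrightarrow> x = 0"
  and v_mult: "v (x * y) = v x * v y"
  and v_add: "v (x + y) \<le> max (v x) (v y)"
  using nonarch unfolding nonarch_absolute_value_def by auto

lemma v_0 [simp]: "v 0 = 0" by simp

lemma v_pos [simp]: "0 < v x \<longleftrightarrow> x \<noteq> 0"
  using v_nonneg[of x] v_eq_0_iff[of x] by linarith

lemma v_1 [simp]: "v 1 = 1"
  using v_mult[of 1 1] v_eq_0_iff[of 1] by simp

lemma v_minus [simp]: "v (- x) = v x"
proof -
  have "v (-1) * v (-1) = 1" using v_mult[of "-1" "-1"] by simp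
  then have "(v (-1))\<^sup>2 = 1" by (simp add: power2_eq_square)
  then have "v (-1) = 1" using v_nonneg[of "-1"] by (simp add: power2_eq_1_iff)
  then show ?thesis using v_mult[of "-1" x] by simp
qed

lemma v_minus_commute: "v (x - y) = v (y - x)"
  using v_minus[of "x - y"] by simp

lemma v_diff: "v (x - y) \<le> max (v x) (v y)"
  using v_add[of x "- y"] by simp

lemma v_power: "v (x ^ n) = v x ^ n"
  by (induction n) (auto simp: v_mult)

lemma v_inverse: "v (inverse x) = inverse (v x)"
proof (cases "x = 0")
  case False
  then have "v x * v (inverse x) = 1" by (simp flip: v_mult)
  then show ?thesis using inverse_unique by metis
qed simp

lemma v_divide: "v (x / y) = v x / v y"
  by (simp add: divide_inverse v_mult v_inverse)

lemma v_power_int: "v (x powi n) = v x powi n"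
  by (simp add: power_int_def v_power v_inverse)

lemma v_sum_le:
  assumes "\<And>i. i \<in> A \<Longrightarrow> v (f i) \<le> r" "0 \<le> r"
  shows "v (sum f A) \<le> r"
proof (cases "finite A")
  case True
  then show ?thesis using assms
  proof (induction A rule: finite_induct)
    case (insert a A)
    then have "v (f a) \<le> r" "v (sum f A) \<le> r" by simp_all
    then have "v (f a + sum f A) \<le> r" using v_add[of "f a" "sum f A"] by simp
    then show ?case using insert by simp
  qed simp
qed (use assms in simp)

lemma v_of_nat: "v (of_nat n) \<le> 1"
  using v_sum_le[of "{..<n}" "\<lambda>_. 1" 1] by simp

lemma v_of_int: "v (of_int n) \<le> 1"
  by (cases n rule: int_cases2) (auto simp: v_of_nat)

lemma v_eq_of_close: "v (x - y) < v x \<Longrightarrow> v y = v x"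
  using v_diff[of x "x - y"] v_add[of "x - y" y] by (auto simp: max_def split: if_splits)

text \<open>If the largest absolute value were attained only once, that term would be minus a sum of
  strictly smaller ones, against the ultrametric inequality.\<close>

lemma max_attained_twice:
  assumes "finite I" "sum g I = 0" "i \<in> I" "g i \<noteq> 0"
  obtains a b where "a \<in> I" "b \<in> I" "a \<noteq> b" "g a \<noteq> 0" "v (g a) = v (g b)"
proof -
  obtain a where a: "a \<in> I" "\<And>b. b \<in> I \<Longrightarrow> v (g b) \<le> v (g a)"
  proof -
    have "Max ((\<lambda>i. v (g i)) ` I) \<in> (\<lambda>i. v (g i)) ` I"
      using assms by (intro Max_in) auto
    then obtain a where "a \<in> I" "v (g a) = Max ((\<lambda>i. v (g i)) ` I)" by auto
    then show ?thesis using that assms(1) by (metis Max_ge finite_imageI imageI)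
  qed
  have ga: "g a \<noteq> 0" using a(2)[OF assms(3)] assms(4)
    by (metis v_eq_0_iff v_pos less_le_not_le)
  have "\<exists>b\<in>I. b \<noteq> a \<and> v (g b) = v (g a)"
  proof (rule ccontr)
    assume "\<not> ?thesis"
    then have lt: "v (g b) < v (g a)" if "b \<in> I - {a}" for b
      using that a(2)[of b] by force
    \<comment> \<open>The inserted 0 keeps the maximum defined when \<open>a\<close> is the only
      index, and makes it a nonnegative bound for \<open>v_sum_le\<close>.\<close>
    let ?r = "Max (insert 0 ((\<lambda>b. v (g b)) ` (I - {a})))"
    have fin: "finite (insert 0 ((\<lambda>b. v (g b)) ` (I - {a})))" using assms by simp
    have "v (sum g (I - {a})) \<le> ?r"
      by (rule v_sum_le) (use fin in \<open>auto intro!: Max_ge\<close>)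
    also have "?r < v (g a)"
      by (subst Max_less_iff) (use fin lt ga in auto)
    finally have "v (sum g (I - {a})) < v (g a)" .
    moreover have "g a = - sum g (I - {a})"
      using sum.remove[OF assms(1) a(1), of g] assms(2) by (simp add: eq_neg_iff_add_eq_0)
    ultimately show False by simp
  qed
  then show ?thesis using that a(1) ga by metis
qed

end

text \<open>The bound \<open>d\<close> is the degree of the number field.\<close>

lemma number_field_integer_relation:
  assumes "number_field TYPE('k::field_char_0)"
  obtains d :: nat where "\<And>f :: nat \<Rightarrow> 'k. \<exists>n :: nat \<Rightarrow> int.
    (\<exists>i\<le>d. n i \<noteq> 0) \<and> (\<Sum>i\<le>d. of_int (n i) * f i) = 0"
proof -
  obtain B where "finite_dimensional_vector_space (\<lambda>(q::rat) (x::'k). of_rat q * x) B"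
    using assms unfolding number_field_def ..
  then interpret Q: finite_dimensional_vector_space "\<lambda>(q::rat) (x::'k). of_rat q * x" B .
  show ?thesis
  proof (rule that[of "card B"])
    fix f :: "nat \<Rightarrow> 'k"
    let ?I = "{..card B}"
    have "\<exists>q :: nat \<Rightarrow> rat. (\<exists>i\<in>?I. q i \<noteq> 0) \<and> (\<Sum>i\<in>?I. of_rat (q i) * f i) = 0"
    proof (cases "inj_on f ?I")
      case True
      have "Q.dependent (f ` ?I)"
        using Q.independent_span_bound[OF Q.finite_Basis, of "f ` ?I"] True
        by (auto simp: Q.span_Basis card_image)
      then obtain u where u: "\<exists>x\<in>f ` ?I. u x \<noteq> 0" "(\<Sum>x\<in>f ` ?I. of_rat (u x) * x) = 0"
        using Q.dependent_finite[of "f ` ?I"] by auto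
      then show ?thesis
        by (intro exI[of _ "\<lambda>i. u (f i)"]) (auto simp: sum.reindex[OF True])
    next
      case False
      then obtain a b where ab: "a \<in> ?I" "b \<in> ?I" "a \<noteq> b" "f a = f b"
        unfolding inj_on_def by blast
      \<comment> \<open>A repeated value is itself a relation; it is treated apart because the image
        of \<open>f\<close> may then be too small for the dimension count.\<close>
      let ?q = "(\<lambda>i. 0)(a := 1, b := -1) :: nat \<Rightarrow> rat"
      have "(\<Sum>i\<in>?I. of_rat (?q i) * f i) = (\<Sum>i\<in>{a, b}. of_rat (?q i) * f i)"
        by (rule sum.mono_neutral_right) (use ab in auto)
      also have "\<dots> = 0" using ab by simp
      finally have 0: "(\<Sum>i\<in>?I. of_rat (?q i) * f i) = 0" .
      have "?q b \<noteq> 0" by simp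
      then show ?thesis using 0 ab(2) by (intro exI[of _ ?q] conjI bexI[of _ b])
    qed
    then obtain q :: "nat \<Rightarrow> rat" where q: "\<exists>i\<in>?I. q i \<noteq> 0" "(\<Sum>i\<in>?I. of_rat (q i) * f i) = 0"
      by blast
    \<comment> \<open>Clearing denominators with the product of all of them makes the rational
      relation integral.\<close>
    define D where "D = (\<Prod>i\<in>?I. snd (quotient_of (q i)))"
    have den: "snd (quotient_of (q i)) > 0" for i
      by (simp add: quotient_of_denom_pos')
    then have D: "D > 0" unfolding D_def by (intro prod_pos) auto
    have "\<exists>n::int. of_int n = of_int D * q i" if "i \<in> ?I" for i
    proof -
      have "snd (quotient_of (q i)) dvd D"
        unfolding D_def by (rule dvd_prodI) (use that in auto)
      then obtain c where c: "D = snd (quotient_of (q i)) * c" by (elim dvdE)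
      obtain k m where km: "quotient_of (q i) = (k, m)" by (metis surj_pair)
      have m: "m \<noteq> 0" using den[of i] unfolding km by simp
      have D: "D = m * c" using c unfolding km by simp
      have "of_int (k * c) = of_int D * q i"
        unfolding D quotient_of_div[OF km] using m by simp
      then show ?thesis by blast
    qed
    then obtain n :: "nat \<Rightarrow> int" where n: "\<And>i. i \<in> ?I \<Longrightarrow> of_int (n i) = of_int D * q i"
      by metis
    have "(\<Sum>i\<in>?I. of_int (n i) * f i) = (\<Sum>i\<in>?I. of_int D * (of_rat (q i) * f i))"
    proof (rule sum.cong)
      fix i assume "i \<in> ?I"
      then have "of_rat (of_int (n i)) = of_rat (of_int D * q i)" using n by simp
      then have "(of_int (n i) :: 'k) = of_int D * of_rat (q i)" by (simp add: of_rat_mult)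
      then show "of_int (n i) * f i = of_int D * (of_rat (q i) * f i)" by simp
    qed simp
    also have "\<dots> = 0" using q(2) by (simp flip: sum_distrib_left)
    finally have "(\<Sum>i\<le>card B. of_int (n i) * f i) = 0" .
    moreover have "\<exists>i\<le>card B. n i \<noteq> 0"
    proof -
      obtain i where i: "i \<in> ?I" "q i \<noteq> 0" using q(1) by blast
      then have "(of_int (n i) :: rat) \<noteq> 0" using n[OF i(1)] D by simp
      then show ?thesis using i(1) by auto
    qed
    ultimately show "\<exists>n :: nat \<Rightarrow> int. (\<exists>i\<le>card B. n i \<noteq> 0) \<and> (\<Sum>i\<le>card B. of_int (n i) * f i) = 0"
      by blast
  qed
qed

text \<open>Descent: dividing every coefficient by p gives another relation with a smaller sum of
  absolute values, so in a relation minimizing that sum some coefficient is not divisible by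
  p.\<close>

lemma primitive_integer_relation:
  fixes f :: "nat \<Rightarrow> 'k::field_char_0" and p :: int
  assumes "\<exists>n :: nat \<Rightarrow> int. (\<exists>i\<le>d. n i \<noteq> 0) \<and> (\<Sum>i\<le>d. of_int (n i) * f i) = 0" and "p > 1"
  shows "\<exists>n :: nat \<Rightarrow> int. (\<exists>i\<le>d. \<not> p dvd n i) \<and> (\<Sum>i\<le>d. of_int (n i) * f i) = 0"
proof -
  define P where "P n \<longleftrightarrow> (\<exists>i\<le>d. n i \<noteq> 0) \<and> (\<Sum>i\<le>d. of_int (n i) * f i) = 0" for n :: "nat \<Rightarrow> int"
  define m where "m n = (\<Sum>i\<le>d. nat \<bar>n i\<bar>)" for n :: "nat \<Rightarrow> int"
  have "\<exists>n. P n" using assms(1) by (simp add: P_def)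
  then obtain n where n: "P n" "\<And>n'. P n' \<Longrightarrow> m n \<le> m n'"
    using ex_has_least_nat[of P _ m] by blast
  have "\<exists>i\<le>d. \<not> p dvd n i"
  proof (rule ccontr)
    assume "\<not> ?thesis"
    then have "\<forall>i. \<exists>k. i \<le> d \<longrightarrow> n i = p * k" by (auto elim: dvdE)
    then obtain k where k: "\<And>i. i \<le> d \<Longrightarrow> n i = p * k i" by metis
    obtain i where i: "i \<le> d" "n i \<noteq> 0" using n(1) by (auto simp: P_def)
    have "(\<Sum>i\<le>d. of_int (n i) * f i) = of_int p * (\<Sum>i\<le>d. of_int (k i) * f i)"
      unfolding sum_distrib_left by (rule sum.cong) (simp_all add: k)
    then have "P k" using n(1) assms(2) i k[OF i(1)] by (auto simp: P_def)
    then have "m n \<le> m k" using n(2) by blast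
    moreover have "m k < m n"
      unfolding m_def
    proof (rule sum_strict_mono_ex1)
      have lt: "\<bar>n i\<bar> = p * \<bar>k i\<bar>" if "i \<le> d" for i
        using k[OF that] assms(2) by (simp add: abs_mult)
      have "\<bar>k i\<bar> \<le> \<bar>n i\<bar>" if "i \<le> d" for i
        using lt[OF that] assms(2) by (simp add: mult_le_cancel_right1)
      then show "\<forall>i\<in>{..d}. nat \<bar>k i\<bar> \<le> nat \<bar>n i\<bar>" by (intro ballI nat_mono) simp
      have "0 < \<bar>k i\<bar>" using k[OF i(1)] i(2) by simp
      then have "1 * \<bar>k i\<bar> < p * \<bar>k i\<bar>" using assms(2) by (intro mult_strict_right_mono)
      then have "nat \<bar>k i\<bar> < nat \<bar>n i\<bar>" using lt[OF i(1)] by linarith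
      then show "\<exists>i\<in>{..d}. nat \<bar>k i\<bar> < nat \<bar>n i\<bar>" using i(1) by (intro bexI[of _ i]) auto
    qed simp
    ultimately show False by linarith
  qed
  then show ?thesis using n(1) by (auto simp: P_def)
qed

section \<open>Absolute values on a number field: value group and residue field\<close>

locale number_field_prime = nonarch_field v for v :: "'k::field_char_0 \<Rightarrow> real" +
  assumes number_field: "number_field TYPE('k)"
begin

text \<open>The powers 1, x, ..., x^d satisfy an integer relation, and two of its terms share the
  largest absolute value; comparing them gives the equation. That \<open>d\<close> does not depend
  on x will make the value group discrete.\<close>

lemma value_relation:
  "\<exists>d. \<forall>x. x \<noteq> 0 \<longrightarrow>
    (\<exists>e n n'. 0 < e \<and> e \<le> d \<and> n \<noteq> 0 \<and> n' \<noteq> 0 \<and> v x ^ e * v (of_int n) = v (of_int n'))"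
proof -
  obtain d where d: "\<And>f :: nat \<Rightarrow> 'k. \<exists>n :: nat \<Rightarrow> int.
    (\<exists>i\<le>d. n i \<noteq> 0) \<and> (\<Sum>i\<le>d. of_int (n i) * f i) = 0"
    using number_field_integer_relation[OF number_field] by blast
  show ?thesis
  proof (rule exI[of _ d], intro allI impI)
    fix x :: 'k assume x: "x \<noteq> 0"
    obtain n :: "nat \<Rightarrow> int" and i where n: "i \<le> d" "n i \<noteq> 0" "(\<Sum>i\<le>d. of_int (n i) * x ^ i) = 0"
      using d[of "\<lambda>i. x ^ i"] by blast
    obtain a b where ab: "a \<in> {..d}" "b \<in> {..d}" "a \<noteq> b" "of_int (n a) * x ^ a \<noteq> 0"
      "v (of_int (n a) * x ^ a) = v (of_int (n b) * x ^ b)"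
      by (rule max_attained_twice[of "{..d}" "\<lambda>i. of_int (n i) * x ^ i" i]) (use n x in auto)
    have nb: "n b \<noteq> 0" "n a \<noteq> 0" using ab(4,5) x by (auto simp: v_mult)
    have main: "\<exists>e n n'. 0 < e \<and> e \<le> d \<and> n \<noteq> 0 \<and> n' \<noteq> 0 \<and> v x ^ e * v (of_int n) = v (of_int n')"
      if "a < b" "b \<le> d" "m \<noteq> 0" "m' \<noteq> 0" "v (of_int m) * v x ^ a = v (of_int m') * v x ^ b"
      for a b and m m' :: int
    proof -
      have "v x ^ b = v x ^ a * v x ^ (b - a)" using that(1) by (simp flip: power_add)
      then have "v x ^ a * (v x ^ (b - a) * v (of_int m')) = v x ^ a * v (of_int m)"
        using that(5) by (simp only: ac_simps)
      moreover have "v x ^ a \<noteq> 0" using x by simp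
      ultimately have "v x ^ (b - a) * v (of_int m') = v (of_int m)"
        by (metis mult_left_cancel)
      then show ?thesis using that by (intro exI[of _ "b - a"] exI[of _ m'] exI[of _ m]) auto
    qed
    show "\<exists>e n n'. 0 < e \<and> e \<le> d \<and> n \<noteq> 0 \<and> n' \<noteq> 0 \<and> v x ^ e * v (of_int n) = v (of_int n')"
      using main[of a b "n a" "n b"] main[of b a "n b" "n a"] ab nb
      by (cases "a < b") (auto simp: v_mult v_power)
  qed
qed

lemma residue_char:
  obtains p :: nat where "Factorial_Ring.prime p" "v (of_nat p) < 1"
    "\<And>n :: int. \<not> int p dvd n \<Longrightarrow> v (of_int n) = 1"
    "\<And>n :: int. n \<noteq> 0 \<Longrightarrow> \<exists>k. v (of_int n) = v (of_nat p) ^ k"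
proof -
  have "\<exists>p. Factorial_Ring.prime p \<and> v (of_nat p) < 1"
  proof (rule ccontr)
    assume neg: "\<not> ?thesis"
    have nat1: "v (of_nat n) = 1" if "n > 0" for n
      using that
    proof (induction n rule: less_induct)
      case (less n)
      show ?case
      proof (cases "n = 1")
        case False
        then obtain q where q: "Factorial_Ring.prime q" "q dvd n" using prime_factor_nat by blast
        then obtain m where m: "n = q * m" by blast
        have "v (of_nat q) = 1" using neg q(1) v_of_nat[of q] by (meson linorder_le_less_linear order_antisym)
        moreover have "m < n" "m > 0" using m less.prems prime_gt_1_nat[OF q(1)] by auto
        ultimately show ?thesis using less.IH[of m] m by (simp add: v_mult)
      qed simp
    qed
    have int1: "v (of_int n) = 1" if "n \<noteq> 0" for n
      using that nat1 by (cases n rule: int_cases2) auto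
    obtain d where d: "\<forall>x. x \<noteq> 0 \<longrightarrow>
      (\<exists>e n n'. 0 < e \<and> e \<le> d \<and> n \<noteq> 0 \<and> n' \<noteq> 0 \<and> v x ^ e * v (of_int n) = v (of_int n'))"
      using value_relation ..
    have "v x = 1" if x: "x \<noteq> 0" for x
    proof -
      obtain e n n' where "0 < e" "n \<noteq> 0" "n' \<noteq> 0" "v x ^ e * v (of_int n) = v (of_int n')"
        using d[rule_format, OF x] by blast
      then have "v x ^ e = 1" "0 < e" using int1 by auto
      then show ?thesis using power_eq_imp_eq_base[of "v x" e 1] by simp
    qed
    then show False using nonarch unfolding nonarch_absolute_value_def by blast
  qed
  then obtain p where p: "Factorial_Ring.prime p" "v (of_nat p) < 1" by blast
  have one: "v (of_int n) = 1" if "\<not> int p dvd n" for n :: int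
  proof -
    have "coprime (int p) n" using p that by (simp add: prime_imp_coprime)
    then obtain a b where ab: "a * int p + b * n = 1"
      using bezout_int[of "int p" n] by (metis coprime_iff_gcd_eq_1)
    have "v (of_int (a * int p + b * n)) \<le> max (v (of_int (a * int p))) (v (of_int (b * n)))"
      by (metis of_int_add v_add)
    moreover have "v (of_int (a * int p)) < 1"
      using p(2) v_of_int[of a] by (simp add: v_mult) (metis mult_left_le_one_le v_nonneg le_less_trans)
    ultimately have "1 \<le> v (of_int (b * n))" using ab by simp
    also have "\<dots> \<le> v (of_int n)" using v_of_int[of b] by (simp add: v_mult mult_left_le_one_le)
    finally show ?thesis using v_of_int[of n] by linarith
  qed
  have "\<exists>k. v (of_int n) = v (of_nat p) ^ k" if n0: "n \<noteq> 0" for n :: int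
  proof -
    obtain m where m: "n = int p ^ multiplicity (int p) n * m" "\<not> int p dvd m"
      by (rule multiplicity_decompose'[of n "int p"]) (use n0 p(1) not_prime_unit in auto)
    have "of_int n = (of_nat p :: 'k) ^ multiplicity (int p) n * of_int m"
      by (subst m(1)) simp
    then show ?thesis using one[OF m(2)] by (metis mult.right_neutral v_mult v_power)
  qed
  then show ?thesis using that[OF p one] by blast
qed

text \<open>By \<open>value_relation\<close> some multiple of ln (v x), by a factor e at most d, is
  an integer multiple of ln (v p). The logarithms therefore lie in a lattice, and the value closest
  to 1 from below generates the value group.\<close>

lemma discrete:
  obtains t where "0 < v t" "v t < 1" "\<And>x. x \<noteq> 0 \<Longrightarrow> \<exists>k::int. v x = v t powi k"
proof -
  obtain p where p: "Factorial_Ring.prime p" "v (of_nat p) < 1"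
    and pn: "\<And>n :: int. n \<noteq> 0 \<Longrightarrow> \<exists>k. v (of_int n) = v (of_nat p) ^ k"
    using residue_char by metis
  obtain d where d: "\<forall>x. x \<noteq> 0 \<longrightarrow>
      (\<exists>e n n'. 0 < e \<and> e \<le> d \<and> n \<noteq> 0 \<and> n' \<noteq> 0 \<and> v x ^ e * v (of_int n) = v (of_int n'))"
      using value_relation ..
  let ?p = "of_nat p :: 'k"
  have p0: "?p \<noteq> 0" using p(1) by auto
  \<comment> \<open>\<open>fact d\<close> is divisible by every exponent e between 1 and d.\<close>
  define l where "l = ln (v ?p) / fact d"
  have lneg: "l < 0" using p p0 by (simp add: l_def divide_neg_pos)
  have ex: "\<exists>m::int. ln (v x) = of_int m * l" if x: "x \<noteq> 0" for x
  proof -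
    obtain e n n' where e: "0 < e" "e \<le> d" and n: "n \<noteq> 0" "n' \<noteq> 0"
      and eq: "v x ^ e * v (of_int n) = v (of_int n')" using d[rule_format, OF x] by blast
    obtain k k' where k: "v (of_int n) = v ?p ^ k" "v (of_int n') = v ?p ^ k'"
      using pn n by metis
    have "ln (v x ^ e * v ?p ^ k) = ln (v ?p ^ k')" using eq k by simp
    then have ln: "real e * ln (v x) = (real k' - real k) * ln (v ?p)"
      using x p0 by (simp add: ln_mult ln_realpow algebra_simps)
    have "e dvd fact d" using e by (simp add: dvd_fact)
    then obtain f where f: "fact d = e * f" by blast
    then have f': "(fact d :: real) = real e * real f" by (metis of_nat_fact of_nat_mult)
    then have "f \<noteq> 0" using fact_nonzero[of d, where ?'a = real] by auto
    have "ln (v x) = of_int ((int k' - int k) * int f) * l"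
    proof -
      have "real f * (real e * ln (v x)) = real f * ((real k' - real k) * ln (v ?p))"
        using ln by simp
      then show ?thesis
        unfolding l_def f' using e(1) \<open>f \<noteq> 0\<close> by (simp add: field_simps)
    qed
    then show ?thesis by blast
  qed
  define Q where "Q m \<longleftrightarrow> 0 < m \<and> (\<exists>x. x \<noteq> 0 \<and> ln (v x) = real m * l)" for m :: nat
  have "Q (fact d)" unfolding Q_def using p0 by (auto simp: l_def of_nat_fact intro!: exI[of _ ?p])
  define m where "m = (LEAST m. Q m)"
  have Qm: "Q m" unfolding m_def using \<open>Q (fact d)\<close> by (rule LeastI)
  obtain t where t: "0 < m" "t \<noteq> 0" "ln (v t) = real m * l"
    using Qm unfolding Q_def by blast
  show ?thesis
  proof (rule that[of t])
    show "0 < v t" using t by simp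
    have "ln (v t) < 0" using t lneg by (simp add: mult_pos_neg)
    then show "v t < 1" using t(2) by (metis ln_less_zero_iff v_pos)
    fix x :: 'k assume x: "x \<noteq> 0"
    obtain k where k: "ln (v x) = of_int k * l" using ex[OF x] by blast
    \<comment> \<open>Division with remainder: a nonzero remainder would contradict the minimality
      of \<open>m\<close>.\<close>
    define q where "q = k div int m"
    define r where "r = k mod int m"
    have r: "0 \<le> r" "r < int m" using t(1) by (auto simp: r_def)
    have lnp: "ln (v t powi q) = of_int q * ln (v t)"
      using t(2) by (metis ln_powr powr_real_of_int' v_nonneg v_pos less_le)
    have "ln (v (x / t powi q)) = ln (v x) - ln (v t powi q)"
      using x t(2) by (simp add: v_divide v_power_int ln_div)
    also have "\<dots> = of_int (k - q * int m) * l"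
      by (simp add: k lnp t(3) algebra_simps)
    also have "k - q * int m = r" by (simp add: q_def r_def minus_div_mult_eq_mod)
    finally have lr: "ln (v (x / t powi q)) = real (nat r) * l" using r by simp
    have "\<not> Q (nat r)" using r not_less_Least[of "nat r" Q] by (auto simp: m_def)
    moreover have "x / t powi q \<noteq> 0" using x t(2) by simp
    ultimately have "nat r = 0" using lr unfolding Q_def by (metis gr_zeroI)
    then have "ln (v (x / t powi q)) = 0" using lr by simp
    then have "v (x / t powi q) = 1" using x t(2) by (metis exp_ln exp_zero v_pos \<open>x / t powi q \<noteq> 0\<close>)
    then have "v x = v t powi q" using x t(2) by (simp add: v_divide v_power_int)
    then show "\<exists>k::int. v x = v t powi k" by blast
  qed
qed

text \<open>At most d residues are independent over the prime field, because a primitive integer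
  relation among more than d elements induces a nontrivial relation between their residues. A
  largest independent set therefore spans, and its combinations with coefficients below p represent
  all residues.\<close>

lemma finite_residues:
  obtains T where "finite T" "\<And>x. v x \<le> 1 \<Longrightarrow> \<exists>\<tau>\<in>T. v (x - \<tau>) < 1"
proof -
  obtain p where p: "Factorial_Ring.prime p" "v (of_nat p) < 1"
    and p1: "\<And>n :: int. \<not> int p dvd n \<Longrightarrow> v (of_int n) = 1"
    using residue_char by metis
  obtain d where d: "\<And>f :: nat \<Rightarrow> 'k. \<exists>n :: nat \<Rightarrow> int.
    (\<exists>i\<le>d. n i \<noteq> 0) \<and> (\<Sum>i\<le>d. of_int (n i) * f i) = 0"
    using number_field_integer_relation[OF number_field] by blast
  \<comment> \<open>Independence of the residues over the field with p elements, phrased without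
    constructing the residue field.\<close>
  define indep where "indep W \<longleftrightarrow> finite W \<and> (\<forall>x\<in>W. v x \<le> 1) \<and>
    (\<forall>n :: 'k \<Rightarrow> int. v (\<Sum>x\<in>W. of_int (n x) * x) < 1 \<longrightarrow> (\<forall>x\<in>W. int p dvd n x))" for W
  have bound: "card W \<le> d" if W: "indep W" for W
  proof (rule ccontr)
    assume "\<not> card W \<le> d"
    then obtain Y where Y: "Y \<subseteq> W" "card Y = Suc d" "finite Y"
      using obtain_subset_with_card_n[of "Suc d" W] by (metis not_less_eq_eq)
    then obtain f where f: "bij_betw f {0..<Suc d} Y"
      using ex_bij_betw_nat_finite[of Y] by metis
    have rng: "{0..<Suc d} = {..d}" by auto
    have fin: "inj_on f {..d}" "f ` {..d} = Y" using f unfolding bij_betw_def rng by auto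
    obtain n where n: "\<exists>i\<le>d. \<not> int p dvd n i" "(\<Sum>i\<le>d. of_int (n i) * f i) = 0"
      using primitive_integer_relation[OF d, of "int p" f] p(1)
      by (metis prime_gt_1_nat of_nat_1 of_nat_less_iff)
    let ?n = "\<lambda>x. if x \<in> Y then n (the_inv_into {..d} f x) else 0"
    have "(\<Sum>x\<in>W. of_int (?n x) * x) = (\<Sum>x\<in>Y. of_int (?n x) * x)"
      by (rule sum.mono_neutral_right) (use W Y in \<open>auto simp: indep_def\<close>)
    also have "\<dots> = (\<Sum>i\<le>d. of_int (n i) * f i)"
      unfolding fin(2)[symmetric] sum.reindex[OF fin(1)]
      by (intro sum.cong) (auto simp: the_inv_into_f_f[OF fin(1)])
    also have "\<dots> = 0" by (rule n(2))
    finally have "v (\<Sum>x\<in>W. of_int (?n x) * x) < 1" by simp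
    then have "\<forall>x\<in>W. int p dvd ?n x"
      using W[unfolded indep_def, THEN conjunct2, THEN conjunct2, THEN spec[of _ ?n]] by blast
    moreover obtain i where "i \<le> d" "\<not> int p dvd n i" using n(1) by blast
    moreover have "f i \<in> Y" using fin(2) \<open>i \<le> d\<close> by auto
    ultimately show False using Y(1) the_inv_into_f_f[OF fin(1), of i] by fastforce
  qed
  have "indep {}" by (simp add: indep_def)
  then have "\<exists>W. indep W \<and> (\<forall>Y. indep Y \<longrightarrow> card Y \<le> card W)"
    by (rule ex_has_greatest_nat[of indep "{}" card "Suc d"]) (use bound in \<open>auto simp: less_Suc_eq_le\<close>)
  then obtain W where W: "indep W" and mx: "\<And>Y. indep Y \<Longrightarrow> card Y \<le> card W"
    by blast
  have finX: "finite W" using W by (simp add: indep_def)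
  define T where "T = (\<lambda>n. \<Sum>x\<in>W. of_int (n x) * x) ` (W \<rightarrow>\<^sub>E {0..<int p})"
  show ?thesis
  proof (rule that[of T])
    show "finite T" unfolding T_def using finX by (intro finite_imageI finite_PiE) auto
    fix y :: 'k assume y: "v y \<le> 1"
    have p0: "int p > 0" using p(1) prime_gt_0_nat by simp
    have vp: "v (of_int m) < 1" if "int p dvd m" for m
    proof -
      obtain c where "m = int p * c" using \<open>int p dvd m\<close> by blast
      then show ?thesis using p(2) v_of_int[of c] by (simp add: v_mult)
          (metis mult_left_le mult.commute v_nonneg le_less_trans)
    qed
    have red: "\<exists>\<tau>\<in>T. v ((\<Sum>x\<in>W. of_int (n x) * x) - \<tau>) < 1" for n
    proof
      let ?n = "\<lambda>x\<in>W. n x mod int p"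
      show "(\<Sum>x\<in>W. of_int (?n x) * x) \<in> T" unfolding T_def using p0 by (intro imageI) auto
      have "(\<Sum>x\<in>W. of_int (n x) * x) - (\<Sum>x\<in>W. of_int (?n x) * x) =
        (\<Sum>x\<in>W. of_int (int p) * (of_int (n x div int p) * x))"
        unfolding sum_subtractf[symmetric]
      proof (rule sum.cong)
        fix x assume "x \<in> W"
        have "n x - n x mod int p = int p * (n x div int p)"
          by (simp add: minus_mod_eq_mult_div)
        then have "of_int (n x) - of_int (n x mod int p) = (of_int (int p * (n x div int p)) :: 'k)"
          by (metis of_int_diff)
        then show "of_int (n x) * x - of_int (?n x) * x = of_int (int p) * (of_int (n x div int p) * x)"
          using \<open>x \<in> W\<close> by (simp add: left_diff_distrib[symmetric])
      qed simp
      also have "\<dots> = of_int (int p) * (\<Sum>x\<in>W. of_int (n x div int p) * x)"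
        by (simp add: sum_distrib_left)
      finally have "v ((\<Sum>x\<in>W. of_int (n x) * x) - (\<Sum>x\<in>W. of_int (?n x) * x)) =
        v (of_int (int p)) * v (\<Sum>x\<in>W. of_int (n x div int p) * x)" by (simp add: v_mult)
      also have "\<dots> \<le> v (of_int (int p)) * 1"
      proof (intro mult_left_mono v_sum_le)
        fix x assume "x \<in> W"
        then show "v (of_int (n x div int p) * x) \<le> 1"
          using W v_of_int by (auto simp: indep_def v_mult intro: mult_le_one)
      qed auto
      also have "\<dots> < 1" using p(2) by simp
      finally show "v ((\<Sum>x\<in>W. of_int (n x) * x) - (\<Sum>x\<in>W. of_int (?n x) * x)) < 1" .
    qed
    show "\<exists>\<tau>\<in>T. v (y - \<tau>) < 1"
    proof (cases "y \<in> W")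
      case True
      have "(\<Sum>x\<in>W. of_int (if x = y then 1 else 0) * x) = (\<Sum>x\<in>W. if x = y then x else 0)"
        by (rule sum.cong) auto
      also have "\<dots> = y" using True finX by simp
      finally show ?thesis using red[of "\<lambda>x. if x = y then 1 else 0"] by simp
    next
      case False
      then have "\<not> indep (insert y W)" using mx[of "insert y W"] finX by auto
      then obtain n where n: "v (\<Sum>x\<in>insert y W. of_int (n x) * x) < 1"
        "\<exists>x\<in>insert y W. \<not> int p dvd n x"
        using W y unfolding indep_def by auto
      define s where "s = (\<Sum>x\<in>W. of_int (n x) * x)"
      have sy: "v (of_int (n y) * y + s) < 1" using n(1) False finX by (simp add: s_def)
      have ny: "\<not> int p dvd n y"
      proof
        assume dv: "int p dvd n y"
        have "v (of_int (n y) * y) < 1" using vp[OF dv] y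
          by (simp add: v_mult) (metis mult_left_le v_nonneg le_less_trans)
        then have "v s < 1" using v_diff[of "of_int (n y) * y + s" "of_int (n y) * y"] sy by simp
        then have "\<forall>x\<in>W. int p dvd n x" using W unfolding indep_def s_def by blast
        then show False using n(2) dv by auto
      qed
      then have "coprime (int p) (n y)" using p(1) by (simp add: prime_imp_coprime)
      then obtain a b where ab: "a * int p + b * n y = 1"
        using bezout_int[of "int p" "n y"] by (metis coprime_iff_gcd_eq_1)
      have bs: "(\<Sum>x\<in>W. of_int (- b * n x) * x) = - (of_int b * s)"
        by (simp add: s_def sum_distrib_left mult.assoc sum_negf)
      obtain \<tau> where \<tau>: "\<tau> \<in> T" "v (- (of_int b * s) - \<tau>) < 1"
        using red[of "\<lambda>x. - b * n x"] unfolding bs by blast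
      \<comment> \<open>Modulo p the coefficient of y is inverted by b, which expresses y through
        \<open>W\<close>.\<close>
      have "y = of_int (a * int p + b * n y) * y" using ab by simp
      then have "y - \<tau> = (of_int (a * int p) * y + of_int b * (of_int (n y) * y + s)) +
          (- (of_int b * s) - \<tau>)"
        by (simp add: algebra_simps)
      moreover have "v (of_int (a * int p) * y) < 1"
        using vp[of "a * int p"] y unfolding v_mult
        by (metis dvd_triv_right mult_left_le v_nonneg le_less_trans)
      moreover have "v (of_int b * (of_int (n y) * y + s)) < 1"
        using v_of_int[of b] sy unfolding v_mult
        by (metis mult_left_le mult.commute v_nonneg le_less_trans)
      ultimately have "v (y - \<tau>) < 1" using \<tau>(2)
        by (smt (verit) v_add)
      then show ?thesis using \<tau>(1) by blast
    qed
  qed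
qed

end


text \<open>These are the properties of the completion on which the rest of the proof is based;
  \<open>t\<close> is a uniformizer.\<close>

locale local_field = nonarch_field w for w :: "'f::field \<Rightarrow> real" +
  fixes t :: 'f
  assumes w_t: "0 < w t" "w t < 1"
    and w_powi: "x \<noteq> 0 \<Longrightarrow> \<exists>k::int. w x = w t powi k"
    and finite_residue_field: "\<exists>T. finite T \<and> (\<forall>x. w x \<le> 1 \<longrightarrow> (\<exists>\<tau>\<in>T. w (x - \<tau>) < 1))"
    and complete: "Metric_space.mcomplete UNIV (\<lambda>x y. w (x - y))"
begin

lemma t_nonzero [simp]: "t \<noteq> 0"
  using w_t v_pos by blast

lemma powi_less_iff [simp]: "w t powi m < w t powi n \<longleftrightarrow> n < m"
proof -
  have "w t powi b < w t powi a" if "a < b" for a b :: int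
  proof -
    have "w t powi (b - a) < 1"
      using that w_t power_less_one_iff[of "w t" "nat (b - a)"] by (simp add: power_int_def)
    moreover have "w t powi b = w t powi a * w t powi (b - a)"
      using w_t by (simp flip: power_int_add)
    ultimately show ?thesis using w_t zero_less_power_int[of "w t" a] by simp
  qed
  from this[of n m] this[of m n] show ?thesis by (cases m n rule: linorder_cases) auto
qed

lemma powi_le_iff [simp]: "w t powi m \<le> w t powi n \<longleftrightarrow> n \<le> m"
  by (simp flip: linorder_not_less)

lemma w_less_1: "w x < 1 \<longleftrightarrow> w x \<le> w t"
proof
  assume *: "w x < 1"
  show "w x \<le> w t"
  proof (cases "x = 0")
    case False
    then obtain k :: int where k: "w x = w t powi k" using w_powi by blast
    then have "k > 0" using * powi_less_iff[of k 0] by simp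
    then show ?thesis using k powi_le_iff[of k 1] by simp
  qed (use w_t in simp)
qed (use w_t in simp)

lemma ex_powi_less: "0 < e \<Longrightarrow> \<exists>m::nat. w t ^ m < e"
  using real_arch_pow_inv[OF _ w_t(2)] by blast

text \<open>t-adic digits: a representative modulo t^m is refined by one digit from the residue
  field.\<close>

lemma finite_residues_power: "\<exists>T. finite T \<and> (\<forall>x. w x \<le> 1 \<longrightarrow> (\<exists>\<tau>\<in>T. w (x - \<tau>) \<le> w t ^ m))"
proof (induction m)
  case 0
  show ?case by (rule exI[of _ "{0}"]) simp
next
  case (Suc m)
  then obtain T where T: "finite T" "\<And>x. w x \<le> 1 \<Longrightarrow> \<exists>\<tau>\<in>T. w (x - \<tau>) \<le> w t ^ m" by blast
  obtain T1 where T1: "finite T1" "\<And>x. w x \<le> 1 \<Longrightarrow> \<exists>\<tau>\<in>T1. w (x - \<tau>) < 1"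
    using finite_residue_field by blast
  let ?T = "(\<lambda>(a, b). a + t ^ m * b) ` (T \<times> T1)"
  have "\<exists>\<sigma>\<in>?T. w (x - \<sigma>) \<le> w t ^ Suc m"
    if x: "w x \<le> 1" for x
  proof -
    obtain a where a: "a \<in> T" "w (x - a) \<le> w t ^ m" using T(2)[OF x] by blast
    have "w ((x - a) / t ^ m) \<le> 1" using a(2) w_t by (simp add: v_divide v_power divide_le_eq)
    then obtain b where b: "b \<in> T1" "w ((x - a) / t ^ m - b) \<le> w t"
      using T1(2) w_less_1 by blast
    have eq: "x - (a + t ^ m * b) = t ^ m * ((x - a) / t ^ m - b)" by (simp add: field_simps)
    have "w (x - (a + t ^ m * b)) \<le> w t ^ m * w t"
      unfolding eq v_mult v_power by (rule mult_left_mono) (use b in auto)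
    then have "w (x - (a + t ^ m * b)) \<le> w t ^ Suc m" by (simp only: power_Suc2)
    moreover have "a + t ^ m * b \<in> ?T" by (rule image_eqI[of _ _ "(a, b)"]) (use a b in simp_all)
    ultimately show ?thesis by (rule bexI)
  qed
  moreover have "finite ?T" using T(1) T1(1) by simp
  ultimately show ?case by blast
qed

lemma ex_power_mult_le: "\<exists>m::nat. w t ^ m * C \<le> 1"
proof (cases "C \<le> 0")
  case False
  then obtain m :: nat where "w t ^ m < 1 / C" using ex_powi_less[of "1 / C"] by auto
  then show ?thesis using False by (intro exI[of _ m]) (simp add: field_simps less_imp_le)
next
  case True
  then show ?thesis by (intro exI[of _ 0]) simp
qed

lemma totally_bounded_ball:
  assumes "0 < e"
  shows "\<exists>T. finite T \<and> (\<forall>x. w x \<le> C \<longrightarrow> (\<exists>\<tau>\<in>T. w (x - \<tau>) \<le> e))"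
proof -
  obtain a :: nat where a: "w t ^ a * C \<le> 1" using ex_power_mult_le by blast
  obtain m :: nat where m: "w t ^ m < e * w t ^ a" using ex_powi_less[of "e * w t ^ a"] assms w_t by auto
  obtain T where T: "finite T" "\<And>x. w x \<le> 1 \<Longrightarrow> \<exists>\<tau>\<in>T. w (x - \<tau>) \<le> w t ^ m"
    using finite_residues_power by blast
  have "\<exists>\<sigma>\<in>(\<lambda>\<tau>. \<tau> / t ^ a) ` T. w (x - \<sigma>) \<le> e" if x: "w x \<le> C" for x
  proof -
    have "w (t ^ a * x) \<le> w t ^ a * C"
      using x by (simp add: v_mult v_power mult_left_mono)
    then obtain \<tau> where \<tau>: "\<tau> \<in> T" "w (t ^ a * x - \<tau>) \<le> w t ^ m"
      using T(2)[of "t ^ a * x"] a by auto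
    have eq: "t ^ a * x - \<tau> = t ^ a * (x - \<tau> / t ^ a)" by (simp add: field_simps)
    have "w t ^ a * w (x - \<tau> / t ^ a) \<le> w t ^ m"
      using \<tau>(2) unfolding eq v_mult v_power .
    also have "\<dots> \<le> w t ^ a * e" using m by (simp add: mult.commute)
    finally have "w (x - \<tau> / t ^ a) \<le> e" using w_t by simp
    then show ?thesis using \<tau>(1) by blast
  qed
  then show ?thesis using T(1) by (meson finite_imageI)
qed

end

text \<open>Completing changes neither the value group nor the residue field: by density some
  \<open>j a\<close> is closer to x than w x, and then w x = v a by the ultrametric
  inequality.\<close>

lemma completion_local_field:
  fixes v :: "'k::field_char_0 \<Rightarrow> real" and w :: "'f::field \<Rightarrow> real"
  assumes "number_field TYPE('k)" "nonarch_absolute_value v" "is_completion v j w"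
  shows "\<exists>t. local_field w t"
proof -
  interpret K: number_field_prime v by standard (fact assms)+
  have w: "nonarch_absolute_value w" "\<And>x. w (j x) = v x"
      "Metric_space.mcomplete UNIV (\<lambda>x y. w (x - y))" "\<And>x e. e > 0 \<Longrightarrow> \<exists>a. w (x - j a) < e"
    and j: "\<And>x y. j (x + y) = j x + j y"
    using assms(3) unfolding is_completion_def ring_hom_def type_ring_def by auto
  interpret F: nonarch_field w by standard fact
  have jd: "j (x - y) = j x - j y" for x y
    using j[of "x - y" y] by (simp add: eq_diff_eq)
  obtain t where t: "0 < v t" "v t < 1" "\<And>x. x \<noteq> 0 \<Longrightarrow> \<exists>k::int. v x = v t powi k"
    using K.discrete by blast
  obtain T where T: "finite T" "\<And>x. v x \<le> 1 \<Longrightarrow> \<exists>\<tau>\<in>T. v (x - \<tau>) < 1"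
    using K.finite_residues by blast
  have "local_field w (j t)"
  proof unfold_locales
    show "0 < w (j t)" "w (j t) < 1" using t by (simp_all add: w)
    show "Metric_space.mcomplete UNIV (\<lambda>x y. w (x - y))" by fact
    show "\<exists>k::int. w x = w (j t) powi k" if "x \<noteq> 0" for x
    proof -
      obtain a where "w (x - j a) < w x" 
        using w(4)[of "w x" x] \<open>x \<noteq> 0\<close> by auto
      then have "w x = v a" using F.v_eq_of_close w(2) by metis
      then show ?thesis using t(3)[of a] that w(2) by (metis F.v_eq_0_iff K.v_eq_0_iff)
    qed
    have "\<exists>\<tau>\<in>j ` T. w (x - \<tau>) < 1" if x: "w x \<le> 1" for x
    proof -
      obtain a where a: "w (x - j a) < 1" using w(4)[of 1 x] by auto
      have "w (j a) \<le> 1" using F.v_diff[of x "x - j a"] a x by simp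
      then obtain \<tau> where \<tau>: "\<tau> \<in> T" "w (j (a - \<tau>)) < 1" using T(2)[of a] w(2) by metis
      have eq: "x - j \<tau> = (x - j a) + j (a - \<tau>)" by (simp add: jd)
      have "w (x - j \<tau>) < 1" unfolding eq
        using a \<tau>(2) F.v_add[of "x - j a" "j (a - \<tau>)"] by (meson le_less_trans max_less_iff_conj)
      then show ?thesis using \<tau>(1) by blast
    qed
    then show "\<exists>T. finite T \<and> (\<forall>x. w x \<le> 1 \<longrightarrow> (\<exists>\<tau>\<in>T. w (x - \<tau>) < 1))"
      using T(1) by (meson finite_imageI)
  qed
  then show ?thesis ..
qed

section \<open>Division algebras over local fields\<close>

locale local_division_algebra = local_field w t for w :: "'f::field \<Rightarrow> real" and t +
  fixes \<iota> :: "'f \<Rightarrow> 'd::division_ring" and B :: "'d set"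
  assumes \<iota>_add: "\<iota> (a + b) = \<iota> a + \<iota> b" and \<iota>_mult: "\<iota> (a * b) = \<iota> a * \<iota> b"
    and \<iota>_1 [simp]: "\<iota> 1 = 1" and \<iota>_central: "x * \<iota> c = \<iota> c * x"
    and basis: "finite_dimensional_vector_space (\<lambda>c x. \<iota> c * x) B"
begin

sublocale V: finite_dimensional_vector_space "\<lambda>c x. \<iota> c * x" B
  by (rule basis)

lemma \<iota>_0 [simp]: "\<iota> 0 = 0"
  using \<iota>_add[of 0 0] by simp

lemma \<iota>_inverse: "\<iota> (inverse a) = inverse (\<iota> a)"
proof (cases "a = 0")
  case False
  then have "\<iota> a * \<iota> (inverse a) = 1" by (simp flip: \<iota>_mult)
  then show ?thesis by (simp add: inverse_unique)
qed simp

lemma \<iota>_eq_0_iff [simp]: "\<iota> a = 0 \<longleftrightarrow> a = 0"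
proof
  assume "\<iota> a = 0"
  then have "\<iota> (a * inverse a) = 0" by (simp add: \<iota>_mult)
  then show "a = 0" by (cases "a = 0") auto
qed simp

lemma \<iota>_power: "\<iota> (a ^ n) = \<iota> a ^ n"
  by (induction n) (auto simp: \<iota>_mult)

section \<open>Coordinates and the maximum norm of a division algebra\<close>

definition coord :: "'d \<Rightarrow> 'd \<Rightarrow> 'f" where "coord b x = V.representation B x b"

lemma coord_add: "coord b (x + y) = coord b x + coord b y"
  by (simp add: coord_def V.representation_add[OF V.independent_Basis] V.span_Basis)

lemma coord_scale: "coord b (\<iota> c * x) = c * coord b x"
  by (simp add: coord_def V.representation_scale[OF V.independent_Basis] V.span_Basis)

lemma coord_minus: "coord b (- x) = - coord b x"
  by (simp add: coord_def V.representation_neg[OF V.independent_Basis] V.span_Basis)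

lemma coord_diff: "coord b (x - y) = coord b x - coord b y"
  by (simp add: coord_def V.representation_diff[OF V.independent_Basis] V.span_Basis)

lemma coord_0 [simp]: "coord b 0 = 0"
  using coord_scale[of b 0 0] by simp

lemma coord_sum: "coord b (sum f A) = (\<Sum>i\<in>A. coord b (f i))"
  by (induction A rule: infinite_finite_induct) (auto simp: coord_add)

lemma sum_coord: "(\<Sum>b\<in>B. \<iota> (coord b x) * b) = x"
  unfolding coord_def
  by (rule V.sum_representation_eq[OF V.independent_Basis _ V.finite_Basis]) (auto simp: V.span_Basis)

lemma coord_basis: "b' \<in> B \<Longrightarrow> coord b b' = (if b = b' then 1 else 0)"
  by (auto simp: coord_def V.representation_basis[OF V.independent_Basis])

lemma coord_sum_basis: "b \<in> B \<Longrightarrow> coord b (\<Sum>b\<in>B. \<iota> (c b) * b) = c b"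
proof -
  assume b: "b \<in> B"
  have "coord b (\<Sum>b\<in>B. \<iota> (c b) * b) = (\<Sum>b'\<in>B. if b = b' then c b else 0)"
    unfolding coord_sum coord_scale by (rule sum.cong) (auto simp: coord_basis)
  then show ?thesis using b by (simp add: V.finite_Basis)
qed

lemma B_nonempty: "B \<noteq> {}"
proof
  assume "B = {}"
  then have "(1::'d) = 0" using sum_coord[of 1] by simp
  then show False by simp
qed

text \<open>The maximum norm of the coordinates. It need not be multiplicative;
  \<open>N_mult\<close> and \<open>N_mult_lower\<close> show that it is so up to constants, which
  has to suffice until a valuation is available.\<close>

definition N :: "'d \<Rightarrow> real" where "N x = Max ((\<lambda>b. w (coord b x)) ` B)"

lemma N_le_iff: "N x \<le> r \<longleftrightarrow> (\<forall>b\<in>B. w (coord b x) \<le> r)"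
  unfolding N_def using B_nonempty V.finite_Basis by (subst Max_le_iff) auto

lemma N_attained: "\<exists>b\<in>B. N x = w (coord b x)"
proof -
  have "N x \<in> (\<lambda>b. w (coord b x)) ` B"
    unfolding N_def using B_nonempty V.finite_Basis by (intro Max_in) auto
  then show ?thesis by blast
qed

lemma coord_le_N: "b \<in> B \<Longrightarrow> w (coord b x) \<le> N x"
  using N_le_iff[of x "N x"] by blast

lemma N_nonneg [simp]: "0 \<le> N x"
  using N_attained[of x] by auto

lemma N_eq_0_iff [simp]: "N x = 0 \<longleftrightarrow> x = 0"
proof
  assume "N x = 0"
  then have "coord b x = 0" if "b \<in> B" for b
    using coord_le_N[OF that, of x] v_nonneg[of "coord b x"] by simp
  then show "x = 0" using sum_coord[of x] by simp
next
  assume "x = 0"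
  then show "N x = 0" using N_attained[of x] by auto
qed

lemma N_0 [simp]: "N 0 = 0" by simp

lemma N_pos [simp]: "0 < N x \<longleftrightarrow> x \<noteq> 0"
  using N_nonneg[of x] N_eq_0_iff[of x] by linarith

lemma N_scale: "N (\<iota> c * x) = w c * N x"
proof (rule antisym)
  show "N (\<iota> c * x) \<le> w c * N x"
    unfolding N_le_iff coord_scale v_mult using coord_le_N by (auto intro: mult_left_mono)
  obtain b where "b \<in> B" "N x = w (coord b x)" using N_attained by blast
  then show "w c * N x \<le> N (\<iota> c * x)"
    using coord_le_N[of b "\<iota> c * x"] by (simp add: coord_scale v_mult)
qed

lemma N_minus [simp]: "N (- x) = N x"
  by (simp add: N_def coord_minus)

lemma N_add: "N (x + y) \<le> max (N x) (N y)"
  unfolding N_le_iff coord_add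
proof
  fix b assume "b \<in> B"
  then show "w (coord b x + coord b y) \<le> max (N x) (N y)"
    using v_add[of "coord b x" "coord b y"] coord_le_N[of b x] coord_le_N[of b y] by linarith
qed

lemma N_diff: "N (x - y) \<le> max (N x) (N y)"
  using N_add[of x "- y"] by simp

lemma N_minus_commute: "N (x - y) = N (y - x)"
  using N_minus[of "x - y"] by simp

lemma N_sum_le:
  assumes "\<And>i. i \<in> A \<Longrightarrow> N (f i) \<le> r" "0 \<le> r"
  shows "N (sum f A) \<le> r"
  unfolding N_le_iff coord_sum
proof
  fix b assume b: "b \<in> B"
  show "w (\<Sum>i\<in>A. coord b (f i)) \<le> r"
    by (rule v_sum_le) (use assms coord_le_N[OF b] in \<open>auto intro: order_trans\<close>)
qed

lemma N_powi: "x \<noteq> 0 \<Longrightarrow> \<exists>k::int. N x = w t powi k"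
proof -
  assume x: "x \<noteq> 0"
  obtain b where b: "N x = w (coord b x)" using N_attained by blast
  then have "coord b x \<noteq> 0" using x by (metis N_eq_0_iff v_eq_0_iff)
  then show ?thesis using w_powi b by simp
qed

lemma N_mult: "\<exists>C>0. \<forall>x y. N (x * y) \<le> C * (N x * N y)"
proof (intro exI conjI allI)
  \<comment> \<open>A bound for the norms of all products of basis elements; the summand 1 makes it
    positive.\<close>
  define C where "C = 1 + (\<Sum>(b, b')\<in>B \<times> B. N (b * b'))"
  have nn: "0 \<le> (\<Sum>(b, b')\<in>B \<times> B. N (b * b'))" by (rule sum_nonneg) auto
  then show "0 < C" by (simp add: C_def)
  fix x y
  have CB: "N (b * b') \<le> C" if "b \<in> B" "b' \<in> B" for b b'
  proof -
    have "(\<lambda>(b, b'). N (b * b')) (b, b') \<le> (\<Sum>(b, b')\<in>B \<times> B. N (b * b'))"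
      by (rule member_le_sum) (use that V.finite_Basis in auto)
    then show ?thesis by (simp add: C_def)
  qed
  have "x * y = (\<Sum>b\<in>B. \<iota> (coord b x) * b) * (\<Sum>b'\<in>B. \<iota> (coord b' y) * b')"
    by (simp add: sum_coord)
  also have "\<dots> = (\<Sum>b\<in>B. \<Sum>b'\<in>B. (\<iota> (coord b x) * b) * (\<iota> (coord b' y) * b'))"
    by (rule sum_product)
  also have "\<dots> = (\<Sum>b\<in>B. \<Sum>b'\<in>B. \<iota> (coord b x * coord b' y) * (b * b'))"
  proof (intro sum.cong refl)
    fix b b'
    show "(\<iota> (coord b x) * b) * (\<iota> (coord b' y) * b') = \<iota> (coord b x * coord b' y) * (b * b')"
      unfolding \<iota>_mult by (metis \<iota>_central mult.assoc)
  qed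
  finally have eq: "x * y = (\<Sum>b\<in>B. \<Sum>b'\<in>B. \<iota> (coord b x * coord b' y) * (b * b'))" .
  have C0: "0 \<le> C" using \<open>0 < C\<close> by simp
  show "N (x * y) \<le> C * (N x * N y)"
    unfolding eq
  proof (rule N_sum_le, rule N_sum_le)
    fix b b' assume b: "b \<in> B" "b' \<in> B"
    have "N (\<iota> (coord b x * coord b' y) * (b * b')) = (w (coord b x) * w (coord b' y)) * N (b * b')"
      by (simp add: N_scale v_mult)
    also have "\<dots> \<le> (N x * N y) * C"
      by (intro mult_mono coord_le_N CB b) auto
    finally show "N (\<iota> (coord b x * coord b' y) * (b * b')) \<le> C * (N x * N y)"
      by (simp add: mult.commute)
  qed (use C0 in \<open>simp_all add: mult_nonneg_nonneg\<close>)
qed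

lemma N_totally_bounded:
  assumes "0 < e"
  shows "\<exists>T. finite T \<and> (\<forall>x. N x \<le> C \<longrightarrow> (\<exists>\<tau>\<in>T. N (x - \<tau>) \<le> e))"
proof -
  obtain T where T: "finite T" "\<And>x. w x \<le> C \<Longrightarrow> \<exists>\<tau>\<in>T. w (x - \<tau>) \<le> e"
    using totally_bounded_ball[OF assms] by blast
  let ?T = "(\<lambda>c. \<Sum>b\<in>B. \<iota> (c b) * b) ` (B \<rightarrow>\<^sub>E T)"
  have "\<exists>\<tau>\<in>?T. N (x - \<tau>) \<le> e" if x: "N x \<le> C" for x
  proof -
    have "\<forall>b\<in>B. \<exists>\<tau>\<in>T. w (coord b x - \<tau>) \<le> e"
      using T(2) x by (auto simp: N_le_iff)
    then obtain c where c: "\<And>b. b \<in> B \<Longrightarrow> c b \<in> T" "\<And>b. b \<in> B \<Longrightarrow> w (coord b x - c b) \<le> e"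
      by metis
    let ?c = "restrict c B"
    have "N (x - (\<Sum>b\<in>B. \<iota> (?c b) * b)) \<le> e"
      unfolding N_le_iff coord_diff using c by (simp add: coord_sum_basis)
    moreover have "?c \<in> B \<rightarrow>\<^sub>E T" using c by auto
    ultimately show ?thesis by blast
  qed
  moreover have "finite ?T" using T(1) V.finite_Basis by (intro finite_imageI finite_PiE) auto
  ultimately show ?thesis by blast
qed

section \<open>Compactness and norms of inverses\<close>

sublocale F: Metric_space UNIV "\<lambda>x y. w (x - y)"
proof
  show "w (x - z) \<le> w (x - y) + w (y - z)" for x y z
  proof -
    have "w (x - z) \<le> max (w (x - y)) (w (y - z))" using v_add[of "x - y" "y - z"] by simp
    then show ?thesis using v_nonneg[of "x - y"] v_nonneg[of "y - z"] by linarith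
  qed
qed (auto simp: v_minus_commute)

sublocale D: Metric_space UNIV "\<lambda>x y. N (x - y)"
proof
  show "N (x - z) \<le> N (x - y) + N (y - z)" for x y z
  proof -
    have "N (x - z) \<le> max (N (x - y)) (N (y - z))" using N_add[of "x - y" "y - z"] by simp
    then show ?thesis using N_nonneg[of "x - y"] N_nonneg[of "y - z"] by linarith
  qed
qed (auto simp: N_minus_commute)

text \<open>Total boundedness gives a Cauchy subsequence; its coordinates converge because the field
  is complete, and the limits are the coordinates of \<open>l\<close>.\<close>

lemma unit_ball_sequentially_compact:
  fixes y :: "nat \<Rightarrow> 'd"
  assumes "\<And>n. N (y n) \<le> 1"
  shows "\<exists>r l. strict_mono r \<and> (\<forall>e>0. eventually (\<lambda>n. N (y (r n) - l) < e) sequentially)"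
proof -
  have "D.mtotally_bounded {x. N x \<le> 1}"
    unfolding D.mtotally_bounded_def
  proof (intro allI impI)
    fix e :: real assume e: "0 < e"
    obtain T where T: "finite T" "\<And>x. N x \<le> 1 \<Longrightarrow> \<exists>\<tau>\<in>T. N (x - \<tau>) \<le> min 1 (e / 2)"
      using N_totally_bounded[of "min 1 (e / 2)" 1] e by auto
    have "\<exists>\<tau>\<in>T \<inter> {x. N x \<le> 1}. x \<in> D.mball \<tau> e" if x: "N x \<le> 1" for x
    proof -
      obtain \<tau> where \<tau>: "\<tau> \<in> T" "N (x - \<tau>) \<le> min 1 (e / 2)" using T(2)[OF x] by blast
      then have "N \<tau> \<le> 1" using N_diff[of x "x - \<tau>"] x by auto
      moreover have "N (\<tau> - x) < e" using \<tau>(2) e by (simp add: N_minus_commute)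
      ultimately show ?thesis using \<tau>(1) by (auto simp: D.mball_def)
    qed
    then show "\<exists>K. finite K \<and> K \<subseteq> {x. N x \<le> 1} \<and> {x. N x \<le> 1} \<subseteq> (\<Union>x\<in>K. D.mball x e)"
      using T(1) by (intro exI[of _ "T \<inter> {x. N x \<le> 1}"] conjI subsetI) simp_all
  qed
  moreover have "range y \<subseteq> {x. N x \<le> 1}" using assms by auto
  ultimately obtain r where r: "strict_mono r" "D.MCauchy (y \<circ> r)"
    unfolding D.mtotally_bounded_sequentially by blast
  have "\<exists>l. \<forall>e>0. eventually (\<lambda>n. w (coord b (y (r n)) - l) < e) sequentially" if b: "b \<in> B" for b
  proof -
    have "F.MCauchy (\<lambda>n. coord b (y (r n)))"
      unfolding F.MCauchy_def
    proof (intro conjI allI impI)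
      fix e :: real assume "0 < e"
      then obtain n0 where n0: "\<forall>n n'. n0 \<le> n \<longrightarrow> n0 \<le> n' \<longrightarrow> N (y (r n) - y (r n')) < e"
        using r(2) unfolding D.MCauchy_def comp_def by blast
      show "\<exists>n0. \<forall>n n'. n0 \<le> n \<longrightarrow> n0 \<le> n' \<longrightarrow> w (coord b (y (r n)) - coord b (y (r n'))) < e"
      proof (intro exI allI impI)
        fix n n' assume "n0 \<le> n" "n0 \<le> n'"
        then show "w (coord b (y (r n)) - coord b (y (r n'))) < e"
          using coord_le_N[OF b, of "y (r n) - y (r n')"] n0[rule_format, of n n'] by (simp add: coord_diff)
      qed
    qed simp
    then obtain l where "limitin F.mtopology (\<lambda>n. coord b (y (r n))) l sequentially"
      using complete unfolding F.mcomplete_def by blast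
    then show ?thesis
      unfolding F.limit_metric_sequentially eventually_sequentially by auto
  qed
  then have "\<forall>b\<in>B. \<exists>l. \<forall>e>0. eventually (\<lambda>n. w (coord b (y (r n)) - l) < e) sequentially"
    by simp
  from bchoice[OF this] obtain l where l: "\<forall>b\<in>B. \<forall>e>0.
      eventually (\<lambda>n. w (coord b (y (r n)) - l b) < e) sequentially" ..
  show ?thesis
  proof (rule exI[of _ r], rule exI[of _ "\<Sum>b\<in>B. \<iota> (l b) * b"], intro conjI allI impI r(1))
    fix e :: real assume e: "0 < e"
    have "eventually (\<lambda>n. \<forall>b\<in>B. w (coord b (y (r n)) - l b) < e) sequentially"
      using l e V.finite_Basis by (simp add: eventually_ball_finite)
    then show "eventually (\<lambda>n. N (y (r n) - (\<Sum>b\<in>B. \<iota> (l b) * b)) < e) sequentially"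
    proof (rule eventually_mono)
      fix n assume *: "\<forall>b\<in>B. w (coord b (y (r n)) - l b) < e"
      obtain b where "b \<in> B" "N (y (r n) - (\<Sum>b\<in>B. \<iota> (l b) * b)) =
          w (coord b (y (r n) - (\<Sum>b\<in>B. \<iota> (l b) * b)))"
        using N_attained by blast
      then show "N (y (r n) - (\<Sum>b\<in>B. \<iota> (l b) * b)) < e"
        using * by (simp add: coord_diff coord_sum_basis)
    qed
  qed
qed

text \<open>This is where completeness enters: an unbounded sequence of inverses would have a
  subsequence whose inverses converge to a nonzero limit.\<close>

lemma N_inverse: "\<exists>C>0. \<forall>x. N (inverse x) * N x \<le> C"
proof (rule ccontr)
  assume neg: "\<not> ?thesis"
  have "\<exists>y. N y = 1 \<and> real n < N (inverse y)" for n
  proof -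
    obtain x where x: "real (Suc n) < N (inverse x) * N x"
      using neg by (meson not_le of_nat_0_less_iff zero_less_Suc)
    then have x0: "x \<noteq> 0" by auto
    obtain k :: int where k: "N x = w t powi k" using N_powi[OF x0] by blast
    \<comment> \<open>Dividing by a power of t normalizes x to norm 1, and the inverse of the result
      has norm \<open>N (inverse x) * N x\<close>.\<close>
    let ?c = "t powi k"
    have "N (\<iota> (inverse ?c) * x) = 1"
      using k w_t by (simp add: N_scale v_inverse v_power_int)
    moreover have "inverse (\<iota> (inverse ?c) * x) = \<iota> ?c * inverse x"
      using x0 by (simp add: \<iota>_inverse nonzero_inverse_mult_distrib \<iota>_central[of "inverse x"])
    then have "N (inverse (\<iota> (inverse ?c) * x)) = N (inverse x) * N x"
      by (simp add: N_scale v_power_int k)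
    ultimately show ?thesis using x by (intro exI[of _ "\<iota> (inverse ?c) * x"]) auto
  qed
  then obtain y where y: "\<And>n. N (y n) = 1" "\<And>n. real n < N (inverse (y n))" by metis
  have "\<exists>r l. strict_mono r \<and> (\<forall>e>0. eventually (\<lambda>n. N (y (r n) - l) < e) sequentially)"
    by (rule unit_ball_sequentially_compact) (simp add: y(1))
  then obtain r l where r: "strict_mono r"
    and l: "\<forall>e>0. eventually (\<lambda>n. N (y (r n) - l) < e) sequentially"
    by (elim exE conjE)
  have "l \<noteq> 0"
    using eventually_happens[OF l[rule_format, of 1]] y(1) by auto
  obtain C where C: "C > 0" "\<And>x y. N (x * y) \<le> C * (N x * N y)" using N_mult by blast
  define z where "z = inverse l"
  have z: "z \<noteq> 0" "l * z = 1" using \<open>l \<noteq> 0\<close> by (auto simp: z_def)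
  \<comment> \<open>With this \<open>e\<close> the term \<open>u * d * z\<close> below has norm less
    than \<open>N u\<close>, so that \<open>u = z - u * d * z\<close> forces \<open>N u\<close> to
    be at most \<open>N z\<close>.\<close>
  define e where "e = 1 / (C * C * N z)"
  have "C * C * N z > 0" using C z by simp
  then have e: "e > 0" by (simp add: e_def)
  have "eventually (\<lambda>n. N (inverse (y (r n))) \<le> N z) sequentially"
    using l[rule_format, OF e]
  proof (rule eventually_mono)
    fix n assume n: "N (y (r n) - l) < e"
    define u where "u = inverse (y (r n))"
    define d where "d = y (r n) - l"
    have "y (r n) \<noteq> 0" using y(1)[of "r n"] by auto
    then have uy: "u * y (r n) = 1" "u \<noteq> 0" by (auto simp: u_def)
    have "u * l = 1 - u * d" using uy by (simp add: d_def right_diff_distrib)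
    then have "u * l * z = z - u * d * z" by (simp add: left_diff_distrib)
    then have u: "u = z - u * d * z" using z(2) by (simp add: mult.assoc)
    have "N (u * d * z) \<le> C * (N (u * d) * N z)" by (rule C(2))
    also have "\<dots> \<le> C * ((C * (N u * N d)) * N z)"
      using C by (intro mult_left_mono mult_right_mono) auto
    also have "\<dots> = (C * C * N z) * N d * N u" by (simp add: ac_simps)
    also have "\<dots> < (C * C * N z) * e * N u"
      using n uy(2) \<open>C * C * N z > 0\<close> unfolding d_def
      by (intro mult_strict_right_mono mult_strict_left_mono) auto
    also have "\<dots> = N u" using C(1) z(1) by (simp add: e_def)
    finally have "N (u * d * z) < N u" .
    moreover have "N u \<le> max (N z) (N (u * d * z))" by (subst u) (rule N_diff)
    ultimately show "N (inverse (y (r n))) \<le> N z" by (simp add: u_def)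
  qed
  then obtain n0 where n0: "\<And>n. n \<ge> n0 \<Longrightarrow> N (inverse (y (r n))) \<le> N z"
    by (auto simp: eventually_sequentially)
  define m where "m = max n0 (nat \<lceil>N z\<rceil>)"
  have "N z \<le> real m" by (simp add: m_def) linarith
  also have "\<dots> \<le> real (r m)" using seq_suble[OF r, of m] by simp
  also have "\<dots> < N (inverse (y (r m)))" by (rule y(2))
  also have "\<dots> \<le> N z" by (rule n0) (simp add: m_def)
  finally show False by simp
qed

text \<open>Apply \<open>N_mult\<close> to \<open>y = inverse x * (x * y)\<close> and bound the norm
  of \<open>inverse x\<close> by \<open>N_inverse\<close>.\<close>

lemma N_mult_lower: "\<exists>C>0. \<forall>x y. N x * N y \<le> C * N (x * y)"
proof -
  obtain C where C: "C > 0" "\<And>x y. N (x * y) \<le> C * (N x * N y)" using N_mult by blast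
  obtain C' where C': "C' > 0" "\<And>x. N (inverse x) * N x \<le> C'" using N_inverse by blast
  have "N x * N y \<le> (C * C') * N (x * y)" for x y
  proof (cases "x = 0")
    case False
    then have "N y = N (inverse x * (x * y))" by (simp flip: mult.assoc)
    also have "\<dots> \<le> C * (N (inverse x) * N (x * y))" by (rule C(2))
    finally have "N y \<le> C * (N (inverse x) * N (x * y))" .
    then have "N x * N y \<le> N x * (C * (N (inverse x) * N (x * y)))" by (rule mult_left_mono) simp
    also have "\<dots> = (N (inverse x) * N x) * (C * N (x * y))" by (simp add: ac_simps)
    also have "\<dots> \<le> C' * (C * N (x * y))" using C C' by (intro mult_right_mono) auto
    finally show ?thesis by (simp add: ac_simps)
  qed simp
  then show ?thesis using C(1) C'(1) by (intro exI[of _ "C * C'"]) auto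
qed

end

section \<open>Bounded subrings and a maximal one among them\<close>

context local_division_algebra
begin

text \<open>A topological counterpart of an order: boundedness replaces finite generation over the
  valuation ring, which \<open>finitely_generated\<close> recovers for a maximal such
  subring.\<close>

definition bounded_subring :: "'d set \<Rightarrow> bool" where
  "bounded_subring S \<longleftrightarrow> 1 \<in> S \<and> (\<forall>x\<in>S. \<forall>y\<in>S. x - y \<in> S \<and> x * y \<in> S) \<and>
     (\<forall>c x. w c \<le> 1 \<longrightarrow> x \<in> S \<longrightarrow> \<iota> c * x \<in> S) \<and> (\<exists>C. \<forall>x\<in>S. N x \<le> C)"

lemma bounded_subringI:
  assumes "1 \<in> S" "\<And>x y. x \<in> S \<Longrightarrow> y \<in> S \<Longrightarrow> x - y \<in> S" "\<And>x y. x \<in> S \<Longrightarrow> y \<in> S \<Longrightarrow> x * y \<in> S"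
    and "\<And>c x. w c \<le> 1 \<Longrightarrow> x \<in> S \<Longrightarrow> \<iota> c * x \<in> S" "\<And>x. x \<in> S \<Longrightarrow> N x \<le> C"
  shows "bounded_subring S"
  using assms unfolding bounded_subring_def by blast

text \<open>Squares stay in the subring, so the supremum s of the norm on it satisfies s^2 <= C s.
  The bound is the same for all bounded subrings, which is why enlarging them must come to an
  end.\<close>

lemma bounded_subring_bound: "\<exists>C>0. \<forall>S. bounded_subring S \<longrightarrow> (\<forall>x\<in>S. N x \<le> C)"
proof -
  obtain C where C: "C > 0" "\<And>x y. N x * N y \<le> C * N (x * y)" using N_mult_lower by blast
  have "N x \<le> C" if S: "bounded_subring S" and x: "x \<in> S" for S x
  proof -
    define s where "s = Sup (N ` S)"
    have bdd: "bdd_above (N ` S)" using S by (auto simp: bounded_subring_def bdd_above_def)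
    have le: "N y \<le> s" if "y \<in> S" for y
      unfolding s_def using that bdd by (intro cSup_upper) auto
    have s0: "0 \<le> s" using le[OF x] N_nonneg[of x] by linarith
    have "N y \<le> sqrt (C * s)" if y: "y \<in> S" for y
    proof -
      have "y * y \<in> S" using S y by (auto simp: bounded_subring_def)
      then have "C * N (y * y) \<le> C * s" using le C(1) by (intro mult_left_mono) auto
      then have "(N y)\<^sup>2 \<le> C * s" using C(2)[of y y] by (simp add: power2_eq_square)
      then show ?thesis by (rule real_le_rsqrt)
    qed
    then have "s \<le> sqrt (C * s)" unfolding s_def using x by (intro cSup_least) auto
    then have "s * s \<le> C * s" using s0 C(1)
      by (metis mult_nonneg_nonneg less_imp_le real_sqrt_pow2 power2_eq_square power_mono)
    then have "s \<le> C" using s0 C(1) by (cases "s = 0") auto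
    then show ?thesis using le[OF x] by linarith
  qed
  then show ?thesis using C(1) by blast
qed

text \<open>All bounded subrings containing \<open>S0\<close> contain the ball of radius r and lie
  in the ball of radius C. Such a subring is determined by the members of a finite r-net of the
  large ball to which it comes within distance r, so there are finitely many of them.\<close>

lemma ex_maximal_bounded_subring:
  "\<exists>S r. 0 < r \<and> bounded_subring S \<and> (\<forall>x. N x \<le> r \<longrightarrow> x \<in> S) \<and>
     (\<forall>S'. bounded_subring S' \<longrightarrow> S \<subseteq> S' \<longrightarrow> S' = S)"
proof -
  obtain C1 where C1: "C1 > 0" "\<And>x y. N (x * y) \<le> C1 * (N x * N y)" using N_mult by blast
  obtain C where C: "C > 0" "\<And>S x. bounded_subring S \<Longrightarrow> x \<in> S \<Longrightarrow> N x \<le> C"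
    using bounded_subring_bound by blast
  \<comment> \<open>The elements whose left multiplication preserves the unit ball: a bounded
    subring that contains a ball around 0.\<close>
  define S0 where "S0 = {x. \<forall>y. N y \<le> 1 \<longrightarrow> N (x * y) \<le> 1}"
  define r where "r = 1 / C1"
  have r: "r > 0" using C1 by (simp add: r_def)
  have ball: "x \<in> S0" if "N x \<le> r" for x
  proof -
    have "N (x * y) \<le> 1" if "N y \<le> 1" for y
    proof -
      have "N (x * y) \<le> C1 * (N x * N y)" by (rule C1(2))
      also have "\<dots> \<le> C1 * (r * 1)"
        using \<open>N x \<le> r\<close> that C1(1) r by (intro mult_left_mono mult_mono) auto
      finally show ?thesis using C1(1) by (simp add: r_def)
    qed
    then show ?thesis by (simp add: S0_def)
  qed
  obtain m :: nat where m: "w t ^ m * N 1 \<le> 1" using ex_power_mult_le by blast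
  have S0: "bounded_subring S0"
  proof (rule bounded_subringI[where C = "1 / w t ^ m"])
    fix x assume x: "x \<in> S0"
    have "N (\<iota> (t ^ m) * 1) \<le> 1" unfolding N_scale v_power by (rule m)
    then have "N (x * (\<iota> (t ^ m) * 1)) \<le> 1" using x by (simp add: S0_def)
    then have "N (\<iota> (t ^ m) * x) \<le> 1" by (simp add: \<iota>_central[of x])
    then show "N x \<le> 1 / w t ^ m" using w_t by (simp add: N_scale v_power field_simps)
  next
    fix x y assume xy: "x \<in> S0" "y \<in> S0"
    have "N ((x - y) * z) \<le> 1" if "N z \<le> 1" for z
    proof -
      have "N (x * z - y * z) \<le> max (N (x * z)) (N (y * z))" by (rule N_diff)
      also have "\<dots> \<le> 1" using xy that by (simp add: S0_def)
      finally show ?thesis by (simp add: left_diff_distrib)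
    qed
    then show "x - y \<in> S0" by (simp add: S0_def)
    show "x * y \<in> S0" using xy by (simp add: S0_def mult.assoc)
  next
    fix c x assume "w c \<le> 1" "x \<in> S0"
    then show "\<iota> c * x \<in> S0" by (simp add: S0_def mult.assoc N_scale mult_le_one)
  qed (simp add: S0_def)
  define F where "F = {S. bounded_subring S \<and> S0 \<subseteq> S}"
  obtain T where T: "finite T" "\<And>x. N x \<le> C \<Longrightarrow> \<exists>\<tau>\<in>T. N (x - \<tau>) \<le> r"
    using N_totally_bounded[OF r] by blast
  define f where "f S = {\<tau>\<in>T. \<exists>x\<in>S. N (x - \<tau>) \<le> r}" for S
  have sub: "S1 \<subseteq> S2" if S: "S1 \<in> F" "S2 \<in> F" "f S1 \<subseteq> f S2" for S1 S2
  proof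
    fix x assume x: "x \<in> S1"
    then have "N x \<le> C" using C(2)[of S1 x] S(1) by (simp add: F_def)
    from T(2)[OF this] obtain \<tau> where \<tau>: "\<tau> \<in> T" "N (x - \<tau>) \<le> r" by blast
    have "\<tau> \<in> f S1" using x \<tau> by (auto simp: f_def)
    then obtain y where y: "y \<in> S2" "N (y - \<tau>) \<le> r" using S(3) by (auto simp: f_def)
    have eq: "x - y = (x - \<tau>) - (y - \<tau>)" by simp
    have "N (x - y) \<le> r" unfolding eq using N_diff[of "x - \<tau>" "y - \<tau>"] \<tau>(2) y(2) by linarith
    then have "x - y \<in> S2" using ball S(2) by (auto simp: F_def)
    then have "(x - y) - (0 - y) \<in> S2"
      using y(1) S(2) unfolding F_def bounded_subring_def by (metis (no_types, lifting) cancel_comm_monoid_add_class.diff_cancel mem_Collect_eq)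
    then show "x \<in> S2" by simp
  qed
  have "inj_on f F"
  proof (rule inj_onI)
    fix S1 S2 assume "S1 \<in> F" "S2 \<in> F" "f S1 = f S2"
    then show "S1 = S2" using sub[of S1 S2] sub[of S2 S1] by simp
  qed
  moreover have "f ` F \<subseteq> Pow T" by (auto simp: f_def)
  ultimately have "finite F" using T(1) by (meson finite_Pow_iff inj_on_finite)
  moreover have "S0 \<in> F" using S0 by (simp add: F_def)
  ultimately obtain S where S: "S \<in> F" "\<And>S'. S' \<in> F \<Longrightarrow> S \<subseteq> S' \<Longrightarrow> S = S'"
    using finite_has_maximal[of F] by auto
  show ?thesis
  proof (rule exI[of _ S], rule exI[of _ r], intro conjI allI impI)
    show "0 < r" by (rule r)
    show "bounded_subring S" using S(1) by (simp add: F_def)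
    show "x \<in> S" if "N x \<le> r" for x using ball[OF that] S(1) by (auto simp: F_def)
    show "S' = S" if "bounded_subring S'" "S \<subseteq> S'" for S'
      using S(2)[of S'] that S(1) by (auto simp: F_def)
  qed
qed

end

section \<open>The maximal bounded subring is local with principal radical\<close>

locale maximal_bounded_subring = local_division_algebra w t \<iota> B
  for w :: "'f::field \<Rightarrow> real" and t and \<iota> :: "'f \<Rightarrow> 'd::division_ring" and B +
  fixes \<Lambda> :: "'d set" and r :: real
  assumes r_pos: "0 < r" and \<Lambda>: "bounded_subring \<Lambda>" and ball: "N x \<le> r \<Longrightarrow> x \<in> \<Lambda>"
    and maximal: "bounded_subring S \<Longrightarrow> \<Lambda> \<subseteq> S \<Longrightarrow> S = \<Lambda>"
begin

lemma \<Lambda>_1 [simp]: "1 \<in> \<Lambda>"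
  and \<Lambda>_diff: "x \<in> \<Lambda> \<Longrightarrow> y \<in> \<Lambda> \<Longrightarrow> x - y \<in> \<Lambda>"
  and \<Lambda>_mult: "x \<in> \<Lambda> \<Longrightarrow> y \<in> \<Lambda> \<Longrightarrow> x * y \<in> \<Lambda>"
  and \<Lambda>_scale: "w c \<le> 1 \<Longrightarrow> x \<in> \<Lambda> \<Longrightarrow> \<iota> c * x \<in> \<Lambda>"
  using \<Lambda> unfolding bounded_subring_def by blast+

lemma \<Lambda>_0 [simp]: "0 \<in> \<Lambda>"
  using \<Lambda>_diff[of 1 1] by simp

lemma \<Lambda>_add: "x \<in> \<Lambda> \<Longrightarrow> y \<in> \<Lambda> \<Longrightarrow> x + y \<in> \<Lambda>"
  using \<Lambda>_diff[of x "0 - y"] \<Lambda>_diff[of 0 y] by simp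

lemma \<Lambda>_power: "x \<in> \<Lambda> \<Longrightarrow> x ^ n \<in> \<Lambda>"
  by (induction n) (auto intro: \<Lambda>_mult)

lemma \<Lambda>_sum: "(\<And>i. i \<in> A \<Longrightarrow> f i \<in> \<Lambda>) \<Longrightarrow> sum f A \<in> \<Lambda>"
  by (induction A rule: infinite_finite_induct) (auto intro: \<Lambda>_add)

lemma \<Lambda>_bound: "\<exists>C>0. \<forall>x\<in>\<Lambda>. N x \<le> C"
  using bounded_subring_bound \<Lambda> by blast

lemma t_power_\<Lambda>: "\<exists>m. \<iota> (t ^ m) * x \<in> \<Lambda>"
proof -
  obtain m :: nat where "w t ^ m * (N x / r) \<le> 1" using ex_power_mult_le by blast
  then have "N (\<iota> (t ^ m) * x) \<le> r" using r_pos by (simp add: N_scale v_power field_simps)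
  then show ?thesis using ball by blast
qed

text \<open>Otherwise all powers of 1/t would lie in the bounded set \<Lambda>.\<close>

lemma inverse_t_notin: "\<iota> (inverse t) \<notin> \<Lambda>"
proof
  assume "\<iota> (inverse t) \<in> \<Lambda>"
  then have \<Lambda>k: "\<iota> (inverse t ^ k) * 1 \<in> \<Lambda>" for k using \<Lambda>_power[of "\<iota> (inverse t)" k] by (simp add: \<iota>_power)
  obtain C where C: "C > 0" "\<And>x. x \<in> \<Lambda> \<Longrightarrow> N x \<le> C" using \<Lambda>_bound by blast
  have "N 1 / C > 0" using C(1) by simp
  then obtain k :: nat where k: "w t ^ k < N 1 / C" using ex_powi_less by blast
  have "N (\<iota> (inverse t ^ k) * 1) \<le> C" by (rule C(2)[OF \<Lambda>k])
  then have "inverse (w t ^ k) * N 1 \<le> C"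
    unfolding N_scale by (simp add: v_power v_inverse power_inverse)
  then have "N 1 \<le> C * w t ^ k" using w_t by (simp add: field_simps)
  then show False using k C(1) by (simp add: field_simps)
qed

text \<open>The units of \<Lambda>, its nonunits, and the ideal t \<Lambda>. The nonunits will turn
  out to be an ideal, so that \<Lambda> is local and \<open>J\<close> is its radical.\<close>

definition inv_in :: "'d \<Rightarrow> bool" where "inv_in x \<longleftrightarrow> x \<in> \<Lambda> \<and> x \<noteq> 0 \<and> inverse x \<in> \<Lambda>"
definition J :: "'d set" where "J = {x\<in>\<Lambda>. \<not> inv_in x}"
definition tL :: "'d set" where "tL = {x. \<iota> (inverse t) * x \<in> \<Lambda>}"

lemma tL_t [simp]: "y \<in> \<Lambda> \<Longrightarrow> \<iota> t * y \<in> tL"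
  by (simp add: tL_def flip: mult.assoc \<iota>_mult)

lemma tL_E:
  assumes "x \<in> tL" obtains y where "y \<in> \<Lambda>" "x = \<iota> t * y"
proof (rule that)
  show "\<iota> (inverse t) * x \<in> \<Lambda>" using assms by (simp add: tL_def)
  show "x = \<iota> t * (\<iota> (inverse t) * x)" by (simp flip: mult.assoc \<iota>_mult)
qed

lemma tL_subset: "x \<in> tL \<Longrightarrow> x \<in> \<Lambda>"
  using w_t by (auto elim!: tL_E intro: \<Lambda>_scale)

lemma tL_mult: "x \<in> tL \<Longrightarrow> y \<in> \<Lambda> \<Longrightarrow> x * y \<in> tL"
  by (simp add: tL_def \<Lambda>_mult flip: mult.assoc)

lemma small_tL: "N x \<le> r * w t \<Longrightarrow> x \<in> tL"
  unfolding tL_def using w_t(1)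
  by (intro CollectI ball, subst N_scale, subst v_inverse) (simp add: field_simps)

lemma one_notin_tL: "1 \<notin> tL"
  using inverse_t_notin by (simp add: tL_def)

lemma inv_inI: "x \<in> \<Lambda> \<Longrightarrow> y \<in> \<Lambda> \<Longrightarrow> x * y = 1 \<Longrightarrow> inv_in x"
  unfolding inv_in_def by (metis inverse_unique mult_zero_left zero_neq_one)

text \<open>The inverse u satisfies u = 1 + t y u with y in \<Lambda>. Hence t^(m+1) u in \<Lambda>
  implies t^m u in \<Lambda>, and descending to m = 0 removes all denominators without summing a
  series.\<close>

lemma inv_in_one_minus_tL:
  assumes "x \<in> tL" shows "inv_in (1 - x)"
proof -
  obtain y where y: "y \<in> \<Lambda>" "x = \<iota> t * y" using assms by (rule tL_E)
  have nz: "1 - x \<noteq> 0" using assms one_notin_tL by auto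
  define u where "u = inverse (1 - x)"
  have "(1 - x) * u = 1" using nz by (simp add: u_def)
  then have "u - x * u = 1" by (simp add: left_diff_distrib)
  then have u: "u = 1 + \<iota> t * (y * u)" by (simp add: y(2) mult.assoc eq_diff_eq diff_eq_eq)
  have down: "\<iota> (t ^ m) * u \<in> \<Lambda>" if "\<iota> (t ^ Suc m) * u \<in> \<Lambda>" for m
  proof -
    have "\<iota> (t ^ m) * u = \<iota> (t ^ m) * 1 + \<iota> (t ^ m) * (\<iota> t * (y * u))"
      by (metis u distrib_left)
    also have "\<iota> (t ^ m) * (\<iota> t * (y * u)) = (\<iota> (t ^ Suc m) * y) * u"
      by (simp only: power_Suc2 \<iota>_mult mult.assoc)
    also have "\<dots> = y * (\<iota> (t ^ Suc m) * u)" by (simp only: \<iota>_central[of y, symmetric] mult.assoc)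
    finally have eq: "\<iota> (t ^ m) * u = \<iota> (t ^ m) * 1 + y * (\<iota> (t ^ Suc m) * u)" .
    have "w (t ^ m) \<le> 1" using w_t by (simp add: v_power power_le_one)
    then show ?thesis by (subst eq) (intro \<Lambda>_add \<Lambda>_mult \<Lambda>_scale \<Lambda>_1 that y(1))
  qed
  have all: "u \<in> \<Lambda>" if "\<iota> (t ^ m) * u \<in> \<Lambda>" for m
    using that
  proof (induction m)
    case (Suc m)
    then show ?case using down by blast
  qed simp
  obtain m where "\<iota> (t ^ m) * u \<in> \<Lambda>" using t_power_\<Lambda> by blast
  then have "u \<in> \<Lambda>" by (rule all)
  then show ?thesis using nz \<Lambda>_diff[OF \<Lambda>_1 tL_subset[OF assms]] by (simp add: inv_in_def u_def)
qed

lemma pigeonhole: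
  fixes z :: "nat \<Rightarrow> 'd"
  assumes "\<And>n. z n \<in> \<Lambda>" "0 < e"
  shows "\<exists>a b. a < b \<and> N (z a - z b) \<le> e"
proof -
  obtain C where C: "\<And>x. x \<in> \<Lambda> \<Longrightarrow> N x \<le> C" using \<Lambda>_bound by blast
  obtain T where T: "finite T" "\<And>x. N x \<le> C \<Longrightarrow> \<exists>\<tau>\<in>T. N (x - \<tau>) \<le> e"
    using N_totally_bounded[OF assms(2)] by blast
  have "\<forall>n. \<exists>\<tau>. \<tau> \<in> T \<and> N (z n - \<tau>) \<le> e" using T(2) C assms(1) by blast
  then obtain f where f: "\<And>n. f n \<in> T" "\<And>n. N (z n - f n) \<le> e" by metis
  have "\<not> inj f"
  proof
    assume "inj f"
    moreover have "finite (range f)" using f(1) T(1) by (meson finite_subset image_subsetI)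
    ultimately show False using finite_imageD infinite_UNIV_nat by blast
  qed
  then obtain a b where ab: "a < b" "f a = f b"
    unfolding inj_def by (metis linorder_neqE_nat)
  have eq: "z a - z b = (z a - f a) - (z b - f b)" using ab(2) by simp
  have "N (z a - z b) \<le> e" unfolding eq using N_diff[of "z a - f a" "z b - f b"] f(2)[of a] f(2)[of b]
    by linarith
  then show ?thesis using ab(1) by blast
qed

text \<open>Every element of the maximal subring is invertible or topologically nilpotent.\<close>

lemma power_in_tL_or_inv:
  assumes x: "x \<in> \<Lambda>" "\<not> inv_in x"
  obtains m where "0 < m" "x ^ m \<in> tL"
proof -
  have "\<exists>m>0. x ^ m \<in> tL"
  proof (rule ccontr)
    assume neg: "\<not> ?thesis"
    have notin: "x ^ m \<notin> tL" for m using neg one_notin_tL by (metis gr0I power_0)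
    obtain C where C: "C > 0" "\<And>x y. N x * N y \<le> C * N (x * y)" using N_mult_lower by blast
    define e where "e = r * w t"
    have e: "e > 0" using r_pos w_t by (simp add: e_def)
    \<comment> \<open>Two powers are close while \<open>x ^ a\<close> is not small, so
      \<open>1 - x ^ (b - a)\<close> must be small; the tolerance \<open>e * e / C\<close> is chosen
      to bring it into \<open>tL\<close>.\<close>
    obtain a b where ab: "a < b" "N (x ^ a - x ^ b) \<le> e * e / C"
      using pigeonhole[of "\<lambda>n. x ^ n" "e * e / C"] \<Lambda>_power[OF x(1)] e C(1) by auto
    have big: "e < N (x ^ a)" using notin[of a] small_tL[of "x ^ a"] by (force simp: e_def)
    have eq: "x ^ a * (1 - x ^ (b - a)) = x ^ a - x ^ b"
      using ab(1) by (simp add: right_diff_distrib flip: power_add)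
    have "e * N (1 - x ^ (b - a)) \<le> N (x ^ a) * N (1 - x ^ (b - a))"
      using big by (intro mult_right_mono) auto
    also have "\<dots> \<le> C * N (x ^ a - x ^ b)" using C(2)[of "x ^ a" "1 - x ^ (b - a)"] by (simp add: eq)
    also have "\<dots> \<le> C * (e * e / C)" using ab(2) C(1) by (intro mult_left_mono) auto
    also have "\<dots> = e * e" using C(1) by simp
    finally have "N (1 - x ^ (b - a)) \<le> e" using e by simp
    then have "1 - x ^ (b - a) \<in> tL" unfolding e_def by (rule small_tL)
    then have "inv_in (1 - (1 - x ^ (b - a)))" by (rule inv_in_one_minus_tL)
    then have inv: "inverse (x ^ (b - a)) \<in> \<Lambda>" "x ^ (b - a) \<noteq> 0" by (auto simp: inv_in_def)
    obtain k where k: "b - a = Suc k" using ab(1) by (metis Suc_diff_Suc)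
    have "x * (x ^ k * inverse (x ^ Suc k)) = x ^ Suc k * inverse (x ^ Suc k)"
      by (simp add: mult.assoc)
    also have "\<dots> = 1" using inv(2) by (simp add: k)
    finally show False
      using inv_inI[OF x(1)] \<Lambda>_mult[OF \<Lambda>_power[OF x(1)] inv(1)] x(2) unfolding k by blast
  qed
  then show ?thesis using that by blast
qed

lemma geometric: "(1 - z) * (\<Sum>i<m. z ^ i) = 1 - (z :: 'd) ^ m"
proof (induction m)
  case (Suc m)
  have "(1 - z) * (\<Sum>i<Suc m. z ^ i) = (1 - z) * (\<Sum>i<m. z ^ i) + (1 - z) * z ^ m"
    by (simp add: distrib_left)
  then show ?case unfolding Suc by (simp add: left_diff_distrib)
qed simp

lemma J_subset: "x \<in> J \<Longrightarrow> x \<in> \<Lambda>"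
  by (simp add: J_def)

text \<open>Some power z^m lies in t \<Lambda>, so 1 - z^m is a unit, and it is the product of 1 - z
  and a finite geometric sum.\<close>

lemma inv_in_one_minus_J:
  assumes "z \<in> J" shows "inv_in (1 - z)"
proof -
  have z: "z \<in> \<Lambda>" "\<not> inv_in z" using assms by (auto simp: J_def)
  obtain m where m: "z ^ m \<in> tL" using power_in_tL_or_inv[OF z] by blast
  have inv: "inv_in (1 - z ^ m)" by (rule inv_in_one_minus_tL[OF m])
  show ?thesis
  proof (rule inv_inI)
    show "1 - z \<in> \<Lambda>" by (rule \<Lambda>_diff[OF \<Lambda>_1 z(1)])
    show "(\<Sum>i<m. z ^ i) * inverse (1 - z ^ m) \<in> \<Lambda>"
      by (intro \<Lambda>_mult \<Lambda>_sum \<Lambda>_power z(1)) (use inv in \<open>simp add: inv_in_def\<close>)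
    show "(1 - z) * ((\<Sum>i<m. z ^ i) * inverse (1 - z ^ m)) = 1"
      using inv by (simp add: geometric inv_in_def flip: mult.assoc)
  qed
qed

lemma J_mult_right:
  assumes "x \<in> J" "y \<in> \<Lambda>" shows "x * y \<in> J"
proof -
  have x: "x \<in> \<Lambda>" "\<not> inv_in x" using assms by (auto simp: J_def)
  have "\<not> inv_in (x * y)"
  proof
    assume inv: "inv_in (x * y)"
    have "inv_in x"
    proof (rule inv_inI[OF x(1)])
      show "y * inverse (x * y) \<in> \<Lambda>" using \<Lambda>_mult[OF assms(2)] inv by (simp add: inv_in_def)
      show "x * (y * inverse (x * y)) = 1"
        using inv right_inverse[of "x * y"] unfolding inv_in_def mult.assoc by blast
    qed
    then show False using x(2) by blast
  qed
  then show ?thesis using \<Lambda>_mult[OF x(1) assms(2)] by (simp add: J_def)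
qed

lemma J_mult_left:
  assumes "x \<in> J" "y \<in> \<Lambda>" shows "y * x \<in> J"
proof -
  have x: "x \<in> \<Lambda>" "\<not> inv_in x" using assms by (auto simp: J_def)
  have "\<not> inv_in (y * x)"
  proof
    assume inv: "inv_in (y * x)"
    then have nz: "y \<noteq> 0" "x \<noteq> 0" by (auto simp: inv_in_def)
    have "inverse (y * x) * y = inverse x"
      using nz by (simp add: nonzero_inverse_mult_distrib mult.assoc)
    then have "inverse x \<in> \<Lambda>" using \<Lambda>_mult[of "inverse (y * x)" y] inv assms(2)
      by (simp add: inv_in_def)
    then show False using x nz by (simp add: inv_in_def)
  qed
  then show ?thesis using \<Lambda>_mult[OF assms(2) x(1)] by (simp add: J_def)
qed

lemma J_0 [simp]: "0 \<in> J"
  by (simp add: J_def inv_in_def)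

text \<open>The usual argument for local rings: if x + y had an inverse u in \<Lambda>, then u y = 1
  - u x would be a unit although y is not.\<close>

lemma J_add:
  assumes "x \<in> J" "y \<in> J" shows "x + y \<in> J"
proof (rule ccontr)
  assume "x + y \<notin> J"
  then have inv: "inv_in (x + y)" using assms \<Lambda>_add by (auto simp: J_def)
  define u where "u = inverse (x + y)"
  have u: "u \<in> \<Lambda>" using inv by (simp add: u_def inv_in_def)
  have "u * (x + y) = 1" using inv by (simp add: u_def inv_in_def)
  then have "u * y = 1 - u * x" by (simp add: distrib_left eq_diff_eq add.commute)
  then have "inv_in (u * y)" using inv_in_one_minus_J[OF J_mult_left[OF assms(1) u]] by simp
  then show False using J_mult_left[OF assms(2) u] by (simp add: J_def)
qed

lemma J_minus: "x \<in> J \<Longrightarrow> - x \<in> J"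
  using J_mult_left[of x "-1"] \<Lambda>_diff[of 0 1] by simp

text \<open>An element of \<Lambda> / t \<Lambda> that is nonzero and annihilated by right
  multiplication with \<open>J\<close>. If there were none, one could multiply by elements of
  \<open>J\<close> forever without entering t \<Lambda>. Two of these products, say s and s z with z
  in \<open>J\<close>, are congruent modulo t \<Lambda>, and the unit 1 - z then puts s into t
  \<Lambda>.\<close>

lemma ex_socle: "\<exists>s\<in>\<Lambda>. s \<notin> tL \<and> (\<forall>y\<in>J. s * y \<in> tL)"
proof (rule ccontr)
  assume "\<not> ?thesis"
  then have "\<forall>s. \<exists>y. s \<in> \<Lambda> \<longrightarrow> s \<notin> tL \<longrightarrow> y \<in> J \<and> s * y \<notin> tL" by blast
  then obtain g where g: "\<And>s. s \<in> \<Lambda> \<Longrightarrow> s \<notin> tL \<Longrightarrow> g s \<in> J \<and> s * g s \<notin> tL" by metis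
  define s where "s = rec_nat 1 (\<lambda>_ x. x * g x)"
  have s_0: "s 0 = 1" and s_Suc: "s (Suc n) = s n * g (s n)" for n by (simp_all add: s_def)
  have s: "s n \<in> \<Lambda> \<and> s n \<notin> tL" for n
  proof (induction n)
    case 0
    show ?case using one_notin_tL by (simp add: s_0)
  next
    case (Suc n)
    then show ?case using g[of "s n"] J_subset[of "g (s n)"] by (simp add: s_Suc \<Lambda>_mult)
  qed
  have tail: "\<exists>z\<in>J. s (a + Suc k) = s a * z" for a k
  proof (induction k)
    case 0
    show ?case using g[of "s a"] s[of a] by (auto simp: s_Suc)
  next
    case (Suc k)
    then obtain z where z: "z \<in> J" "s (a + Suc k) = s a * z" by blast
    have "s (a + Suc (Suc k)) = s a * (z * g (s (a + Suc k)))"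
      using s_Suc[of "a + Suc k"] z(2) by (simp add: mult.assoc)
    moreover have "z * g (s (a + Suc k)) \<in> J"
      using z(1) g[of "s (a + Suc k)"] s[of "a + Suc k"] J_subset J_mult_right by blast
    ultimately show ?case by blast
  qed
  have "0 < r * w t" using r_pos w_t by simp
  then obtain a b where ab: "a < b" "N (s a - s b) \<le> r * w t" using pigeonhole[of s] s by blast
  obtain k where "b = a + Suc k" using less_imp_Suc_add[OF ab(1)] by auto
  then obtain z where z: "z \<in> J" "s b = s a * z" using tail by blast
  have "s a * (1 - z) \<in> tL" using small_tL[OF ab(2)] by (simp add: z(2) right_diff_distrib)
  moreover have inv: "inv_in (1 - z)" by (rule inv_in_one_minus_J[OF z(1)])
  ultimately have "s a * (1 - z) * inverse (1 - z) \<in> tL"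
    using tL_mult by (simp add: inv_in_def)
  then have "s a * ((1 - z) * inverse (1 - z)) \<in> tL" by (simp only: mult.assoc)
  moreover have "(1 - z) * inverse (1 - z) = 1" using inv unfolding inv_in_def by (intro right_inverse) blast
  ultimately have "s a \<in> tL" by simp
  then show False using s by blast
qed

text \<open>With s from \<open>ex_socle\<close>, the element x = s / t lies outside \<Lambda> but
  satisfies x J <= \<Lambda> as sets. If x J were contained in \<open>J\<close>, then x would belong
  to the left multiplier ring of \<open>J\<close>, a bounded subring containing \<Lambda> and so
  equal to it. Hence x y is a unit for some y in \<open>J\<close>, and the inverse of x generates
  \<open>J\<close> as a right ideal.\<close>

lemma ex_uniformizer: "\<exists>p\<in>J. p \<noteq> 0 \<and> (\<forall>y\<in>J. inverse p * y \<in> \<Lambda>)"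
proof -
  obtain s where s: "s \<in> \<Lambda>" "s \<notin> tL" "\<And>y. y \<in> J \<Longrightarrow> s * y \<in> tL" using ex_socle by blast
  define x where "x = \<iota> (inverse t) * s"
  have x: "x \<notin> \<Lambda>" using s(2) by (simp add: tL_def x_def)
  have xJ: "x * y \<in> \<Lambda>" if "y \<in> J" for y using s(3)[OF that] by (simp add: tL_def x_def mult.assoc)
  have "\<exists>y\<in>J. x * y \<notin> J"
  proof (rule ccontr)
    assume neg: "\<not> ?thesis"
    let ?S = "{z. \<forall>y\<in>J. z * y \<in> J}"
    obtain C where C: "C > 0" "\<And>x. x \<in> \<Lambda> \<Longrightarrow> N x \<le> C" using \<Lambda>_bound by blast
    have tJ: "\<iota> t \<in> J"
      using w_t inverse_t_notin \<Lambda>_scale[of t 1] by (simp add: J_def inv_in_def \<iota>_inverse)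
    have "bounded_subring ?S"
    proof (rule bounded_subringI[where C = "C / w t"])
      fix z assume "z \<in> ?S"
      then have "z * \<iota> t \<in> \<Lambda>" using tJ J_subset by blast
      then have "N (\<iota> t * z) \<le> C" using C(2) by (simp add: \<iota>_central[of z])
      then show "N z \<le> C / w t" using w_t by (simp add: N_scale field_simps)
    next
      fix z z' assume z: "z \<in> ?S" "z' \<in> ?S"
      show "z - z' \<in> ?S"
      proof (intro CollectI ballI)
        fix y assume "y \<in> J"
        then have "z * y + - (z' * y) \<in> J" using z by (intro J_add J_minus) auto
        then show "(z - z') * y \<in> J" by (simp add: left_diff_distrib)
      qed
      show "z * z' \<in> ?S" using z by (auto simp: mult.assoc)
    next
      fix c z assume "w c \<le> 1" "z \<in> ?S"
      then show "\<iota> c * z \<in> ?S" using J_mult_left[of _ "\<iota> c"] \<Lambda>_scale[of c 1] by (auto simp: mult.assoc)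
    qed simp
    moreover have "\<Lambda> \<subseteq> ?S" using J_mult_left by blast
    ultimately have "?S = \<Lambda>" by (rule maximal)
    then show False using neg x by blast
  qed
  then obtain y where y: "y \<in> J" "inv_in (x * y)" using xJ by (auto simp: J_def)
  have nz: "x \<noteq> 0" "y \<noteq> 0" using y(2) by (auto simp: inv_in_def)
  have "inverse x = y * inverse (x * y)"
    using nz by (simp add: nonzero_inverse_mult_distrib flip: mult.assoc)
  then have "inverse x \<in> J" using J_mult_right[OF y(1)] y(2) by (simp add: inv_in_def)
  then show ?thesis using nz xJ by (intro bexI[of _ "inverse x"]) auto
qed

section \<open>The valuation defined by a generator of the radical\<close>

definition \<pi> :: 'd where "\<pi> = (SOME p. p \<in> J \<and> p \<noteq> 0 \<and> (\<forall>y\<in>J. inverse p * y \<in> \<Lambda>))"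

lemma \<pi>_J: "\<pi> \<in> J" and \<pi>_nz [simp]: "\<pi> \<noteq> 0" and \<pi>_div: "y \<in> J \<Longrightarrow> inverse \<pi> * y \<in> \<Lambda>"
proof -
  have "\<exists>p. p \<in> J \<and> p \<noteq> 0 \<and> (\<forall>y\<in>J. inverse p * y \<in> \<Lambda>)" using ex_uniformizer by blast
  from someI_ex[OF this] show "\<pi> \<in> J" "\<pi> \<noteq> 0" "y \<in> J \<Longrightarrow> inverse \<pi> * y \<in> \<Lambda>"
    by (simp_all add: \<pi>_def)
qed

text \<open>The two-sided ideal \<open>J\<close> is \<pi> \<Lambda>, so conjugation maps \<Lambda>
  into itself. The preimage of \<Lambda> is again a bounded subring, and maximality makes it equal
  to \<Lambda>. Being able to move \<pi> past units is what makes \<open>val\<close>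
  additive.\<close>

lemma conj_\<pi>: "inverse \<pi> * x * \<pi> \<in> \<Lambda> \<longleftrightarrow> x \<in> \<Lambda>"
proof -
  let ?S = "{x. inverse \<pi> * x * \<pi> \<in> \<Lambda>}"
  obtain C where C: "C > 0" "\<And>x. x \<in> \<Lambda> \<Longrightarrow> N x \<le> C" using \<Lambda>_bound by blast
  obtain C1 where C1: "C1 > 0" "\<And>x y. N (x * y) \<le> C1 * (N x * N y)" using N_mult by blast
  have sub: "\<Lambda> \<subseteq> ?S"
    using \<pi>_div[OF J_mult_left[OF \<pi>_J]] by (auto simp: mult.assoc)
  have "bounded_subring ?S"
  proof (rule bounded_subringI[where C = "C1 * (N \<pi> * (C1 * (C * N (inverse \<pi>))))"])
    fix x assume x: "x \<in> ?S"
    have "x = \<pi> * (inverse \<pi> * x * \<pi> * inverse \<pi>)" by (simp add: mult.assoc flip: mult.assoc[of \<pi> "inverse \<pi>"])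
    then have "N x \<le> C1 * (N \<pi> * N (inverse \<pi> * x * \<pi> * inverse \<pi>))" using C1(2) by metis
    also have "\<dots> \<le> C1 * (N \<pi> * (C1 * (N (inverse \<pi> * x * \<pi>) * N (inverse \<pi>))))"
      using C1 by (intro mult_left_mono) auto
    also have "\<dots> \<le> C1 * (N \<pi> * (C1 * (C * N (inverse \<pi>))))"
      using C1(1) C(2) x by (intro mult_left_mono mult_right_mono) auto
    finally show "N x \<le> C1 * (N \<pi> * (C1 * (C * N (inverse \<pi>))))" .
  next
    fix x y assume xy: "x \<in> ?S" "y \<in> ?S"
    then show "x - y \<in> ?S" using \<Lambda>_diff by (simp add: right_diff_distrib left_diff_distrib)
    have "inverse \<pi> * (x * y) * \<pi> = (inverse \<pi> * x * \<pi>) * (inverse \<pi> * y * \<pi>)"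
      by (simp add: mult.assoc flip: mult.assoc[of \<pi> "inverse \<pi>"])
    then show "x * y \<in> ?S" using xy \<Lambda>_mult by simp
  next
    fix c x assume cx: "w c \<le> 1" "x \<in> ?S"
    have "inverse \<pi> * (\<iota> c * x) * \<pi> = \<iota> c * (inverse \<pi> * x * \<pi>)"
      by (simp add: \<iota>_central[of "inverse \<pi>"] flip: mult.assoc)
    then show "\<iota> c * x \<in> ?S" using cx \<Lambda>_scale by simp
  qed simp
  then have "?S = \<Lambda>" using sub by (rule maximal)
  then show ?thesis by blast
qed

lemma conj_power: "inverse (\<pi> ^ n) * x * \<pi> ^ n \<in> \<Lambda> \<longleftrightarrow> x \<in> \<Lambda>"
proof (induction n arbitrary: x)
  case (Suc n)
  have "inverse (\<pi> ^ Suc n) * x * \<pi> ^ Suc n = inverse (\<pi> ^ n) * (inverse \<pi> * x * \<pi>) * \<pi> ^ n"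
    by (simp add: nonzero_inverse_mult_distrib mult.assoc)
  then show ?case using Suc.IH conj_\<pi> by simp
qed simp

lemma conj_powi: "\<pi> powi (- k) * x * \<pi> powi k \<in> \<Lambda> \<longleftrightarrow> x \<in> \<Lambda>"
proof (cases "0 \<le> k")
  case True
  then show ?thesis using conj_power[of "nat k" x] by (simp add: power_int_def power_inverse)
next
  case False
  define n where "n = nat (- k)"
  have k: "\<pi> powi k = inverse (\<pi> ^ n)" "\<pi> powi (- k) = \<pi> ^ n"
    using False by (simp_all add: power_int_def n_def power_inverse)
  have "inverse (\<pi> ^ n) * (\<pi> ^ n * x * inverse (\<pi> ^ n)) * \<pi> ^ n = x"
    by (simp add: mult.assoc) (simp flip: mult.assoc)
  then show ?thesis using conj_power[of n "\<pi> ^ n * x * inverse (\<pi> ^ n)"] k by simp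
qed

lemma \<pi>_power_J: "0 < k \<Longrightarrow> \<pi> powi k \<in> J"
proof -
  assume "0 < k"
  then have "\<pi> powi k = \<pi> * \<pi> ^ (nat k - 1)"
    by (simp add: power_int_def flip: power_Suc)
  then show ?thesis using J_mult_right[OF \<pi>_J \<Lambda>_power[OF J_subset[OF \<pi>_J]]] by simp
qed

lemma \<pi>_power_\<Lambda>: "0 \<le> k \<Longrightarrow> \<pi> powi k \<in> \<Lambda>"
  using J_subset[OF \<pi>_power_J, of k] by (cases "k = 0") simp_all

lemma \<pi>_shift: "\<pi> powi (- k) * x = \<pi> powi (l - k) * (\<pi> powi (- l) * x)"
  by (simp flip: mult.assoc power_int_add)

text \<open>The exponents k with \<pi>^(-k) x in \<Lambda> form a downward closed set that is
  nonempty and bounded above. At the largest one the quotient is a unit, since a nonunit could be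
  divided by \<pi> once more.\<close>

lemma val_exists:
  assumes "x \<noteq> 0" shows "\<exists>!k. inv_in (\<pi> powi (- k) * x)"
proof -
  define Q where "Q k \<longleftrightarrow> \<pi> powi (- k) * x \<in> \<Lambda>" for k
  have mono: "Q k" if "Q l" "k \<le> l" for k l
    unfolding Q_def \<pi>_shift[of k x l]
    by (rule \<Lambda>_mult[OF \<pi>_power_\<Lambda>]) (use that in \<open>simp_all add: Q_def\<close>)
  obtain C where C: "C > 0" "\<And>x. x \<in> \<Lambda> \<Longrightarrow> N x \<le> C" using \<Lambda>_bound by blast
  \<comment> \<open>Some power of \<pi> is divisible by t, which allows powers of \<pi> to be
    estimated by powers of t.\<close>
  have "\<pi> \<in> \<Lambda>" "\<not> inv_in \<pi>" using \<pi>_J by (auto simp: J_def)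
  then obtain m where m: "0 < m" "\<pi> ^ m \<in> tL" by (rule power_in_tL_or_inv)
  obtain y where y: "y \<in> \<Lambda>" "\<pi> ^ m = \<iota> t * y" using m(2) by (rule tL_E)
  have pow: "\<pi> ^ (m * a) = \<iota> (t ^ a) * y ^ a" for a
  proof (induction a)
    case (Suc a)
    have "\<pi> ^ (m * Suc a) = (\<iota> t * y) * (\<iota> (t ^ a) * y ^ a)" using Suc y(2) by (simp only: mult_Suc_right power_add)
    also have "\<dots> = \<iota> t * (y * \<iota> (t ^ a)) * y ^ a" by (simp only: mult.assoc)
    also have "\<dots> = \<iota> t * (\<iota> (t ^ a) * y) * y ^ a" by (simp only: \<iota>_central[of y "t ^ a"])
    finally show ?case by (simp only: \<iota>_mult mult.assoc power_Suc)
  qed simp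
  have "\<exists>k. Q k"
  proof -
    obtain a where a: "\<iota> (t ^ a) * x \<in> \<Lambda>" using t_power_\<Lambda> by blast
    have "\<pi> powi (- (- int (m * a))) * x = y ^ a * (\<iota> (t ^ a) * x)"
      unfolding minus_minus power_int_of_nat pow \<iota>_central[of "y ^ a", symmetric] mult.assoc ..
    also have "\<dots> \<in> \<Lambda>" by (intro \<Lambda>_mult \<Lambda>_power y(1) a)
    finally show ?thesis unfolding Q_def by blast
  qed
  moreover have "\<exists>b. \<forall>k. Q k \<longrightarrow> k < b"
  proof -
    have "N x / C > 0" using assms C(1) by simp
    then obtain a :: nat where a: "w t ^ a < N x / C" using ex_powi_less by blast
    have "\<not> Q (int (m * a))"
    proof
      assume "Q (int (m * a))"
      define z where "z = \<pi> powi (- int (m * a)) * x"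
      have z: "z \<in> \<Lambda>" using \<open>Q (int (m * a))\<close> by (simp add: Q_def z_def)
      have "\<pi> powi int (m * a) * z = x"
        by (simp add: z_def flip: mult.assoc power_int_add)
      then have "N x = N (\<iota> (t ^ a) * (y ^ a * z))"
        unfolding power_int_of_nat pow by (simp add: mult.assoc)
      also have "\<dots> = w t ^ a * N (y ^ a * z)" unfolding N_scale v_power ..
      also have "\<dots> \<le> w t ^ a * C"
        by (intro mult_left_mono C(2) \<Lambda>_mult \<Lambda>_power y(1) z) simp
      finally show False using a C(1) by (simp add: field_simps)
    qed
    then have "k < int (m * a)" if "Q k" for k
      using mono[OF that, of "int (m * a)"] by (metis not_less)
    then show ?thesis by blast
  qed
  ultimately obtain k b where k: "Q k" and b: "\<forall>k. Q k \<longrightarrow> k < b" by blast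
  have "\<not> Q (k + int (nat (b - k)))" using b by auto
  then have "\<exists>n. \<not> Q (k + int n)" ..
  then have ex: "\<not> Q (k + int (LEAST n. \<not> Q (k + int n)))" by (rule LeastI_ex)
  define n where "n = (LEAST n. \<not> Q (k + int n))"
  have n0: "n \<noteq> 0" using ex k unfolding n_def[symmetric] by (intro notI) simp
  have Qn: "Q (k + int (n - 1))"
    using not_less_Least[of "n - 1" "\<lambda>n. \<not> Q (k + int n)"] n0 by (simp add: n_def[symmetric])
  define l where "l = k + int (n - 1)"
  have l: "Q l" "\<not> Q (l + 1)" using Qn ex n0 by (simp_all add: l_def n_def[symmetric] of_nat_diff)
  have "inv_in (\<pi> powi (- l) * x)"
  proof (rule ccontr)
    assume "\<not> ?thesis"
    then have "\<pi> powi (- l) * x \<in> J" using l(1) by (simp add: J_def Q_def)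
    then have "inverse \<pi> * (\<pi> powi (- l) * x) \<in> \<Lambda>" by (rule \<pi>_div)
    then have "Q (l + 1)" unfolding Q_def \<pi>_shift[of "l + 1" x l] by simp
    then show False using l(2) by blast
  qed
  have *: False if "inv_in (\<pi> powi (- i) * x)" "inv_in (\<pi> powi (- j) * x)" "i < j" for i j
  proof -
    have "\<pi> powi (j - i) * (\<pi> powi (- j) * x) \<in> J"
      by (rule J_mult_right[OF \<pi>_power_J]) (use that in \<open>simp_all add: inv_in_def\<close>)
    then show False using that(1) unfolding \<pi>_shift[of i x j] by (simp add: J_def)
  qed
  have "i = l" if "inv_in (\<pi> powi (- i) * x)" for i
    using *[OF that, of l] *[of l i] that \<open>inv_in (\<pi> powi (- l) * x)\<close> by (cases i l rule: linorder_cases) blast+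
  with \<open>inv_in (\<pi> powi (- l) * x)\<close> show ?thesis by (rule ex1I)
qed

definition val :: "'d \<Rightarrow> int" where "val x = (THE k. inv_in (\<pi> powi (- k) * x))"

lemma inv_in_val: "x \<noteq> 0 \<Longrightarrow> inv_in (\<pi> powi (- val x) * x)"
  unfolding val_def using theI'[OF val_exists] .

lemma val_eqI: "x \<noteq> 0 \<Longrightarrow> inv_in (\<pi> powi (- k) * x) \<Longrightarrow> val x = k"
  unfolding val_def by (rule the1_equality[OF val_exists])

lemma powi_\<Lambda>_iff: "x \<noteq> 0 \<Longrightarrow> \<pi> powi (- k) * x \<in> \<Lambda> \<longleftrightarrow> k \<le> val x"
proof
  assume x: "x \<noteq> 0" and k: "\<pi> powi (- k) * x \<in> \<Lambda>"
  show "k \<le> val x"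
  proof (rule ccontr)
    assume "\<not> k \<le> val x"
    then have "0 < k - val x" by linarith
    from J_mult_right[OF \<pi>_power_J[OF this] k] have "\<pi> powi (- val x) * x \<in> J"
      by (subst \<pi>_shift[of "val x" x k])
    then show False using inv_in_val[OF x] unfolding J_def by blast
  qed
next
  assume x: "x \<noteq> 0" and k: "k \<le> val x"
  then have "0 \<le> val x - k" by linarith
  moreover have "\<pi> powi (- val x) * x \<in> \<Lambda>" using inv_in_val[OF x] unfolding inv_in_def by blast
  ultimately show "\<pi> powi (- k) * x \<in> \<Lambda>"
    by (subst \<pi>_shift[of k x "val x"]) (rule \<Lambda>_mult[OF \<pi>_power_\<Lambda>])
qed

lemma inv_in_mult: "inv_in x \<Longrightarrow> inv_in y \<Longrightarrow> inv_in (x * y)"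
  by (simp add: inv_in_def \<Lambda>_mult nonzero_inverse_mult_distrib)

lemma inv_in_conj_powi:
  assumes "inv_in u" shows "inv_in (\<pi> powi (- k) * u * \<pi> powi k)"
proof -
  have eq: "inverse (\<pi> powi (- k) * u * \<pi> powi k) = \<pi> powi (- k) * inverse u * \<pi> powi k"
    using assms by (simp add: inv_in_def nonzero_inverse_mult_distrib mult.assoc power_int_minus)
  show ?thesis using assms unfolding inv_in_def eq conj_powi by simp
qed

text \<open>The power of \<pi> contained in y is moved to the left past the unit part u of x; this
  conjugates u, which remains a unit.\<close>

lemma val_mult:
  assumes "x \<noteq> 0" "y \<noteq> 0" shows "val (x * y) = val x + val y"
proof -
  define u where "u = \<pi> powi (- val x) * x"
  define z where "z = \<pi> powi (- val y) * y"
  have u: "inv_in u" and z: "inv_in z" using inv_in_val assms by (simp_all add: u_def z_def)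
  have yz: "\<pi> powi val y * z = y"
    by (simp add: z_def flip: mult.assoc power_int_add)
  have "- (val x + val y) = - val y + - val x" by simp
  then have "\<pi> powi (- (val x + val y)) = \<pi> powi (- val y) * \<pi> powi (- val x)"
    by (simp only: power_int_add[OF disjI1[OF \<pi>_nz]])
  then have "\<pi> powi (- (val x + val y)) * (x * y) = \<pi> powi (- val y) * (u * y)"
    by (simp only: u_def mult.assoc)
  also have "\<dots> = (\<pi> powi (- val y) * u * \<pi> powi val y) * z"
    by (simp only: mult.assoc yz)
  finally have "inv_in (\<pi> powi (- (val x + val y)) * (x * y))"
    using inv_in_mult[OF inv_in_conj_powi[OF u] z] by simp
  then show ?thesis using assms by (intro val_eqI) simp_all
qed

lemma val_add:
  assumes "x \<noteq> 0" "y \<noteq> 0" "x + y \<noteq> 0" shows "min (val x) (val y) \<le> val (x + y)"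
proof -
  let ?k = "min (val x) (val y)"
  have "\<pi> powi (- ?k) * x + \<pi> powi (- ?k) * y \<in> \<Lambda>"
    by (rule \<Lambda>_add) (simp_all only: powi_\<Lambda>_iff[OF assms(1)] powi_\<Lambda>_iff[OF assms(2)] min.cobounded1 min.cobounded2)
  then have "\<pi> powi (- ?k) * (x + y) \<in> \<Lambda>" by (simp only: distrib_left)
  then show ?thesis by (simp only: powi_\<Lambda>_iff[OF assms(3)])
qed

lemma discrete_valuation: "discrete_valuation val \<pi>"
proof (rule discrete_valuation.intro)
  show "val \<pi> = 1" by (rule val_eqI) (simp_all add: inv_in_def)
qed (simp_all add: val_mult val_add)

lemma in_\<Lambda>_iff: "x \<in> \<Lambda> \<longleftrightarrow> x = 0 \<or> 0 \<le> val x"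
proof (cases "x = 0")
  case False
  have "x \<in> \<Lambda> \<longleftrightarrow> 0 \<le> val x"
    using powi_\<Lambda>_iff[OF False, of 0] unfolding minus_zero power_int_0_right mult_1_left .
  then show ?thesis using False by simp
qed simp

end

section \<open>Identification with the maximal order\<close>

lemma ring_type_ring: "ring (type_ring :: 'a::ring_1 ring)"
proof (rule ringI)
  show "abelian_group (type_ring :: 'a ring)"
  proof (rule abelian_groupI)
    show "\<exists>y\<in>carrier type_ring. y \<oplus>\<^bsub>type_ring\<^esub> x = \<zero>\<^bsub>type_ring\<^esub>" for x :: 'a
      by (rule bexI[of _ "- x"]) (simp_all add: type_ring_def)
  qed (simp_all add: type_ring_def ac_simps)
  show "Group.monoid (type_ring :: 'a ring)"
    by (rule monoidI) (simp_all add: type_ring_def mult.assoc)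
qed (simp_all add: type_ring_def distrib_left distrib_right)

lemma finsum_eq_sum:
  fixes A :: "('a::ab_group_add, 'm) ring_scheme"
  assumes "ring A" "carrier A = UNIV" "add A = (+)" "ring.zero A = 0" "finite T"
  shows "finsum A f T = sum f T"
proof -
  interpret ring A by fact
  show ?thesis using \<open>finite T\<close>
    by (induction T rule: finite_induct) (simp_all add: assms)
qed

lemma subring_iff:
  fixes A :: "('a::ab_group_add, 'm) ring_scheme"
  assumes "ring A" "carrier A = UNIV" "add A = (+)" "ring.zero A = 0"
  shows "subring S A \<longleftrightarrow> \<one>\<^bsub>A\<^esub> \<in> S \<and> (\<forall>x\<in>S. \<forall>y\<in>S. x - y \<in> S \<and> x \<otimes>\<^bsub>A\<^esub> y \<in> S)"
proof -
  interpret ring A by fact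
  have neg: "\<ominus>\<^bsub>A\<^esub> x = - x" for x
    by (rule minus_equality) (simp_all add: assms)
  show ?thesis
  proof
    assume S: "subring S A"
    have "x - y \<in> S" if "x \<in> S" "y \<in> S" for x y
      using subringE(7)[OF S that(1) subringE(5)[OF S that(2)]] by (simp add: neg assms)
    then show "\<one>\<^bsub>A\<^esub> \<in> S \<and> (\<forall>x\<in>S. \<forall>y\<in>S. x - y \<in> S \<and> x \<otimes>\<^bsub>A\<^esub> y \<in> S)"
      using subringE(3,6)[OF S] by blast
  next
    assume *: "\<one>\<^bsub>A\<^esub> \<in> S \<and> (\<forall>x\<in>S. \<forall>y\<in>S. x - y \<in> S \<and> x \<otimes>\<^bsub>A\<^esub> y \<in> S)"
    then have "0 \<in> S" by (metis diff_self)
    then have m: "- x \<in> S" if "x \<in> S" for x using * that by (metis diff_0)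
    show "subring S A"
    proof (rule subringI)
      fix x y assume "x \<in> S" "y \<in> S"
      then show "x \<oplus>\<^bsub>A\<^esub> y \<in> S" using * m[of y] by (metis assms(3) diff_minus_eq_add)
    qed (use * m in \<open>auto simp: neg assms\<close>)
  qed
qed

text \<open>A combination over a subset extends by zero coefficients, so all of them can be indexed
  by the same finite set.\<close>

lemma linear_span_finite:
  fixes A :: "('a::ab_group_add, 'm) ring_scheme"
  assumes A: "ring A" "carrier A = UNIV" "add A = (+)" "ring.zero A = 0"
    and "finite S" "0 \<in> C" "\<And>x. sc 0 \<otimes>\<^bsub>A\<^esub> x = 0"
  shows "linear_span C sc A S = {(\<Sum>s\<in>S. sc (c s) \<otimes>\<^bsub>A\<^esub> s) | c. \<forall>s\<in>S. c s \<in> C}"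
proof (intro equalityI subsetI)
  fix x assume "x \<in> linear_span C sc A S"
  then obtain T c where T: "finite T" "T \<subseteq> S" "\<forall>s\<in>T. c s \<in> C"
    "x = (\<Oplus>\<^bsub>A\<^esub>s\<in>T. sc (c s) \<otimes>\<^bsub>A\<^esub> s)" unfolding linear_span_def by blast
  let ?c = "\<lambda>s. if s \<in> T then c s else 0"
  have "x = (\<Sum>s\<in>T. sc (c s) \<otimes>\<^bsub>A\<^esub> s)" using T(1,4) finsum_eq_sum[OF A] by simp
  also have "\<dots> = (\<Sum>s\<in>S. sc (?c s) \<otimes>\<^bsub>A\<^esub> s)"
    by (rule sum.mono_neutral_cong_left) (use T(2) assms(5,7) in auto)
  finally have "x = (\<Sum>s\<in>S. sc (?c s) \<otimes>\<^bsub>A\<^esub> s)" .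
  moreover have "\<forall>s\<in>S. ?c s \<in> C" using T(3) assms(6) by simp
  ultimately show "x \<in> {(\<Sum>s\<in>S. sc (c s) \<otimes>\<^bsub>A\<^esub> s) | c. \<forall>s\<in>S. c s \<in> C}"
    by (intro CollectI exI[of _ ?c] conjI)
next
  fix x assume "x \<in> {(\<Sum>s\<in>S. sc (c s) \<otimes>\<^bsub>A\<^esub> s) | c. \<forall>s\<in>S. c s \<in> C}"
  then obtain c where c: "x = (\<Sum>s\<in>S. sc (c s) \<otimes>\<^bsub>A\<^esub> s)" "\<forall>s\<in>S. c s \<in> C" by blast
  then have "x = (\<Oplus>\<^bsub>A\<^esub>s\<in>S. sc (c s) \<otimes>\<^bsub>A\<^esub> s)" using finsum_eq_sum[OF A assms(5)] by simp
  then show "x \<in> linear_span C sc A S" unfolding linear_span_def using c(2) assms(5) by blast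
qed

lemma type_ring_simps: "carrier type_ring = UNIV" "add type_ring = (+)" "ring.zero type_ring = 0"
  "monoid.mult type_ring = (*)" "monoid.one type_ring = 1"
  by (simp_all add: type_ring_def)

context maximal_bounded_subring
begin

interpretation val: discrete_valuation val \<pi>
  by (rule discrete_valuation)

lemma linear_span_valuation_ring:
  "finite S \<Longrightarrow> linear_span (valuation_ring w) \<iota> type_ring S =
     {(\<Sum>s\<in>S. \<iota> (c s) * s) | c. \<forall>s\<in>S. w (c s) \<le> 1}"
  using linear_span_finite[OF ring_type_ring type_ring_simps(1,2,3), of S "valuation_ring w" \<iota>]
  by (simp add: type_ring_simps valuation_ring_def)

text \<open>A finite net of \<Lambda> up to t^m leaves remainders whose coordinates are divisible by
  t^m. These are integral combinations of the elements t^m b with b in the basis, which lie in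
  \<Lambda> for suitable m.\<close>

lemma finitely_generated:
  "\<exists>S. finite S \<and> S \<subseteq> \<Lambda> \<and> \<Lambda> = linear_span (valuation_ring w) \<iota> type_ring S"
proof -
  obtain m :: nat where m: "w t ^ m * ((\<Sum>b\<in>B. N b) / r) \<le> 1" using ex_power_mult_le by blast
  have tb: "\<iota> (t ^ m) * b \<in> \<Lambda>" if "b \<in> B" for b
  proof (rule ball)
    have "N b \<le> (\<Sum>b\<in>B. N b)" by (rule member_le_sum) (use that V.finite_Basis in auto)
    then have "w t ^ m * N b \<le> w t ^ m * (\<Sum>b\<in>B. N b)" by (rule mult_left_mono) simp
    also have "\<dots> \<le> r" using m r_pos by (simp add: field_simps)
    finally show "N (\<iota> (t ^ m) * b) \<le> r" by (simp add: N_scale v_power)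
  qed
  obtain C where C: "\<And>x. x \<in> \<Lambda> \<Longrightarrow> N x \<le> C" using \<Lambda>_bound by blast
  have "0 < w t ^ m" using w_t by simp
  then obtain T where T: "finite T" "\<And>x. N x \<le> C \<Longrightarrow> \<exists>\<tau>\<in>T. N (x - \<tau>) \<le> w t ^ m"
    using N_totally_bounded by blast
  define T' where "T' = {\<tau>\<in>T. \<exists>x\<in>\<Lambda>. N (x - \<tau>) \<le> w t ^ m}"
  have "\<forall>\<tau>\<in>T'. \<exists>x\<in>\<Lambda>. N (x - \<tau>) \<le> w t ^ m" by (auto simp: T'_def)
  then obtain g where g: "\<And>\<tau>. \<tau> \<in> T' \<Longrightarrow> g \<tau> \<in> \<Lambda>" "\<And>\<tau>. \<tau> \<in> T' \<Longrightarrow> N (g \<tau> - \<tau>) \<le> w t ^ m"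
    by metis
  let ?B = "(\<lambda>b. \<iota> (t ^ m) * b) ` B"
  define S where "S = g ` T' \<union> ?B"
  have S: "finite S" "S \<subseteq> \<Lambda>" using T(1) V.finite_Basis g(1) tb by (auto simp: S_def T'_def)
  have "\<Lambda> = {(\<Sum>s\<in>S. \<iota> (c s) * s) | c. \<forall>s\<in>S. w (c s) \<le> 1}"
  proof (intro equalityI subsetI)
    fix x assume x: "x \<in> \<Lambda>"
    obtain \<tau> where \<tau>: "\<tau> \<in> T" "N (x - \<tau>) \<le> w t ^ m" using T(2)[OF C[OF x]] by blast
    then have T': "\<tau> \<in> T'" using x by (auto simp: T'_def)
    have eq: "x - g \<tau> = (x - \<tau>) - (g \<tau> - \<tau>)" by simp
    define d where "d = x - g \<tau>"
    have d: "N d \<le> w t ^ m"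
      unfolding d_def eq using N_diff[of "x - \<tau>" "g \<tau> - \<tau>"] \<tau>(2) g(2)[OF T'] by linarith
    \<comment> \<open>Coefficients for the two kinds of generators; they are added, since one
      element may be of both kinds.\<close>
    define c1 where "c1 s = (if s = g \<tau> then 1 else 0 :: 'f)" for s
    define c2 where "c2 s = (if s \<in> ?B then coord (\<iota> (inverse (t ^ m)) * s) d / t ^ m else 0)" for s
    have c2: "w (c2 s) \<le> 1" for s
    proof (cases "s \<in> ?B")
      case True
      then obtain b where b: "b \<in> B" "s = \<iota> (t ^ m) * b" by blast
      have "\<iota> (inverse (t ^ m)) * s = b" by (simp add: b(2) flip: mult.assoc \<iota>_mult)
      then have "w (c2 s) = w (coord b d) / w t ^ m" using True by (simp add: c2_def v_divide v_power)
      also have "\<dots> \<le> 1" using coord_le_N[OF b(1), of d] d w_t by (simp add: divide_le_eq)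
      finally show ?thesis .
    qed (simp add: c2_def)
    have c: "w (c1 s + c2 s) \<le> 1" for s
      using v_add[of "c1 s" "c2 s"] c2[of s] by (auto simp: c1_def split: if_splits)
    have inj: "inj_on (\<lambda>b. \<iota> (t ^ m) * b) B" by (auto simp: inj_on_def)
    have "(\<Sum>s\<in>S. \<iota> (c1 s) * s) = (\<Sum>s\<in>S. if s = g \<tau> then s else 0)"
      by (rule sum.cong) (auto simp: c1_def)
    also have "\<dots> = g \<tau>" using S(1) T' by (simp add: S_def)
    finally have s1: "(\<Sum>s\<in>S. \<iota> (c1 s) * s) = g \<tau>" .
    have "(\<Sum>s\<in>S. \<iota> (c2 s) * s) = (\<Sum>s\<in>?B. \<iota> (c2 s) * s)"
      by (rule sum.mono_neutral_right) (use S(1) in \<open>auto simp: S_def c2_def\<close>)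
    also have "\<dots> = (\<Sum>b\<in>B. \<iota> (c2 (\<iota> (t ^ m) * b)) * (\<iota> (t ^ m) * b))"
      by (simp add: sum.reindex[OF inj])
    also have "\<dots> = (\<Sum>b\<in>B. \<iota> (coord b d) * b)"
    proof (rule sum.cong)
      fix b assume b: "b \<in> B"
      have "\<iota> (inverse (t ^ m)) * (\<iota> (t ^ m) * b) = b" by (simp flip: mult.assoc \<iota>_mult)
      then have "c2 (\<iota> (t ^ m) * b) = coord b d / t ^ m" using b by (simp add: c2_def)
      then show "\<iota> (c2 (\<iota> (t ^ m) * b)) * (\<iota> (t ^ m) * b) = \<iota> (coord b d) * b"
        by (simp flip: mult.assoc \<iota>_mult)
    qed simp
    also have "\<dots> = d" by (rule sum_coord)
    finally have s2: "(\<Sum>s\<in>S. \<iota> (c2 s) * s) = d" .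
    have "x = (\<Sum>s\<in>S. \<iota> (c1 s + c2 s) * s)"
      by (simp add: \<iota>_add distrib_right sum.distrib s1 s2 d_def)
    then show "x \<in> {(\<Sum>s\<in>S. \<iota> (c s) * s) | c. \<forall>s\<in>S. w (c s) \<le> 1}"
      using c by (intro CollectI exI[of _ "\<lambda>s. c1 s + c2 s"] conjI ballI)
  next
    fix x assume "x \<in> {(\<Sum>s\<in>S. \<iota> (c s) * s) | c. \<forall>s\<in>S. w (c s) \<le> 1}"
    then obtain c where c: "x = (\<Sum>s\<in>S. \<iota> (c s) * s)" "\<forall>s\<in>S. w (c s) \<le> 1" by blast
    show "x \<in> \<Lambda>" unfolding c(1) by (rule \<Lambda>_sum, rule \<Lambda>_scale) (use c(2) S(2) in auto)
  qed
  then show ?thesis using S linear_span_valuation_ring[OF S(1)] by (intro exI[of _ S]) simp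
qed

lemma is_order_\<Lambda>: "is_order (valuation_ring w) \<iota> type_ring \<Lambda>"
  unfolding is_order_def
proof (intro conjI finitely_generated)
  show "subring \<Lambda> type_ring"
    by (simp add: subring_iff ring_type_ring type_ring_simps \<Lambda>_diff \<Lambda>_mult)
  have "x \<in> linear_span UNIV \<iota> type_ring \<Lambda>" for x
  proof -
    obtain m where m: "\<iota> (t ^ m) * x \<in> \<Lambda>" using t_power_\<Lambda> by blast
    have "x = \<iota> (inverse (t ^ m)) * (\<iota> (t ^ m) * x)" by (simp flip: mult.assoc \<iota>_mult)
    also have "\<dots> = (\<Oplus>\<^bsub>type_ring\<^esub>s\<in>{\<iota> (t ^ m) * x}. \<iota> (inverse (t ^ m)) \<otimes>\<^bsub>type_ring\<^esub> s)"
      by (simp add: finsum_eq_sum ring_type_ring type_ring_simps)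
    finally have "x = (\<Oplus>\<^bsub>type_ring\<^esub>s\<in>{\<iota> (t ^ m) * x}. \<iota> (inverse (t ^ m)) \<otimes>\<^bsub>type_ring\<^esub> s)" .
    then show ?thesis unfolding linear_span_def using m
      by (intro CollectI exI[of _ "{\<iota> (t ^ m) * x}"] exI[of _ "\<lambda>_. inverse (t ^ m)"]) simp
  qed
  then show "linear_span UNIV \<iota> type_ring \<Lambda> = carrier type_ring" by (auto simp: type_ring_simps)
qed

text \<open>The powers of x stay in the bounded set \<open>S\<close>, so t^m x^k lies in \<Lambda>
  for one m and all k. If x had negative valuation, this would fail for large k.\<close>

lemma order_subset_\<Lambda>:
  assumes "is_order (valuation_ring w) \<iota> type_ring S" shows "S \<subseteq> \<Lambda>"
proof
  fix x assume x: "x \<in> S"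
  obtain G where G: "finite G" "S = linear_span (valuation_ring w) \<iota> type_ring G"
    using assms unfolding is_order_def by blast
  have sub: "1 \<in> S" "\<And>x y. x \<in> S \<Longrightarrow> y \<in> S \<Longrightarrow> x * y \<in> S"
    using assms by (auto simp: is_order_def subring_iff ring_type_ring type_ring_simps)
  have pow: "x ^ k \<in> S" for k by (induction k) (auto intro: sub x)
  define C where "C = (\<Sum>s\<in>G. N s)"
  have bound: "N y \<le> C" if yS: "y \<in> S" for y
  proof -
    obtain c where c: "y = (\<Sum>s\<in>G. \<iota> (c s) * s)" "\<forall>s\<in>G. w (c s) \<le> 1"
      using yS unfolding G(2) linear_span_valuation_ring[OF G(1)] by blast
    show ?thesis unfolding c(1)
    proof (rule N_sum_le)
      fix s assume s: "s \<in> G"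
      have "N (\<iota> (c s) * s) \<le> N s" using c(2) s by (simp add: N_scale mult_left_le_one_le)
      also have "\<dots> \<le> C" unfolding C_def by (rule member_le_sum) (use s G(1) in auto)
      finally show "N (\<iota> (c s) * s) \<le> C" .
    qed (simp add: C_def sum_nonneg)
  qed
  obtain m :: nat where m: "w t ^ m * (C / r) \<le> 1" using ex_power_mult_le by blast
  have in\<Lambda>: "\<iota> (t ^ m) * x ^ k \<in> \<Lambda>" for k
  proof (rule ball)
    have "w t ^ m * N (x ^ k) \<le> w t ^ m * C" by (intro mult_left_mono bound pow) simp
    also have "\<dots> \<le> r" using m r_pos by (simp add: field_simps)
    finally show "N (\<iota> (t ^ m) * x ^ k) \<le> r" by (simp add: N_scale v_power)
  qed
  show "x \<in> \<Lambda>"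
  proof (cases "x = 0")
    case False
    let ?e = "val (\<iota> (t ^ m))"
    have nn: "0 \<le> ?e + int k * val x" for k
    proof -
      have nz: "\<iota> (t ^ m) \<noteq> 0" "x ^ k \<noteq> 0" using False by simp_all
      then have "\<iota> (t ^ m) * x ^ k \<noteq> 0" by simp
      then have "0 \<le> val (\<iota> (t ^ m) * x ^ k)" using in\<Lambda>[of k] unfolding in_\<Lambda>_iff by blast
      then show ?thesis unfolding val.val_mult[OF nz] val.val_power[OF False] .
    qed
    have "0 \<le> val x"
    proof (rule ccontr)
      assume "\<not> 0 \<le> val x"
      then have "int (nat \<bar>?e\<bar> + 1) * val x \<le> int (nat \<bar>?e\<bar> + 1) * (- 1)"
        by (intro mult_left_mono) auto
      then show False using nn[of "nat \<bar>?e\<bar> + 1"] by simp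
    qed
    then show ?thesis by (simp add: in_\<Lambda>_iff)
  qed simp
qed

lemma the_maximal_order_eq: "the_maximal_order w \<iota> = \<Lambda>"
  unfolding the_maximal_order_def
proof (rule the_equality)
  show "is_maximal_order (valuation_ring w) \<iota> type_ring \<Lambda>"
    unfolding is_maximal_order_def using is_order_\<Lambda> order_subset_\<Lambda> by blast
  show "S = \<Lambda>" if "is_maximal_order (valuation_ring w) \<iota> type_ring S" for S
    using that is_order_\<Lambda> order_subset_\<Lambda>[of S] unfolding is_maximal_order_def by blast
qed

lemma val_\<iota>: "c \<noteq> 0 \<Longrightarrow> w c \<le> 1 \<Longrightarrow> 0 \<le> val (\<iota> c)"
  using \<Lambda>_scale[of c 1] by (simp add: in_\<Lambda>_iff)

lemma val_t: "0 < val (\<iota> t)"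
proof -
  have "\<iota> (inverse t) \<noteq> 0" "val (\<iota> (inverse t)) < 0"
    using inverse_t_notin by (auto simp: in_\<Lambda>_iff)
  moreover have "val (\<iota> t) + val (\<iota> (inverse t)) = 0"
    using val.val_mult[of "\<iota> t" "\<iota> (inverse t)"] by (simp add: val.val_1 flip: \<iota>_mult)
  ultimately show ?thesis by linarith
qed

end

text \<open>From here on the maximal order is known through its valuation, and the bounded subring
  behind it is forgotten.\<close>

lemma (in local_division_algebra) ex_valuation:
  "\<exists>val \<pi>. discrete_valuation val \<pi> \<and> the_maximal_order w \<iota> = {x. x = 0 \<or> 0 \<le> val x} \<and>
     0 < val (\<iota> t) \<and> (\<forall>c. c \<noteq> 0 \<longrightarrow> w c \<le> 1 \<longrightarrow> 0 \<le> val (\<iota> c))"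
proof -
  obtain S r where "0 < r" "bounded_subring S" "\<forall>x. N x \<le> r \<longrightarrow> x \<in> S"
     "\<forall>S'. bounded_subring S' \<longrightarrow> S \<subseteq> S' \<longrightarrow> S' = S"
    using ex_maximal_bounded_subring by blast
  then interpret M: maximal_bounded_subring w t \<iota> B S r by unfold_locales auto
  have "the_maximal_order w \<iota> = {x. x = 0 \<or> 0 \<le> M.val x}"
    by (rule Set.set_eqI) (simp only: M.the_maximal_order_eq M.in_\<Lambda>_iff mem_Collect_eq)
  then show ?thesis
    using M.discrete_valuation M.val_t M.val_\<iota> by blast
qed

section \<open>Tiled orders in coordinates\<close>

lemma mm_diff_left: "((A::'a::ring_1^'n^'m) - B) ** C = A ** C - B ** C"
  by (simp add: matrix_matrix_mult_def vec_eq_iff left_diff_distrib sum_subtractf)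

lemma mm_diff_right: "(A::'a::ring_1^'n^'m) ** (B - C) = A ** B - A ** C"
  by (simp add: matrix_matrix_mult_def vec_eq_iff right_diff_distrib sum_subtractf)

lemma mm_add_left: "((A::'a::ring_1^'n^'m) + B) ** C = A ** C + B ** C"
  by (simp add: matrix_matrix_mult_def vec_eq_iff distrib_right sum.distrib)

lemma mm_nth: "(A ** B) $ i $ j = (\<Sum>k\<in>UNIV. A $ i $ k * B $ k $ j)"
  by (simp add: matrix_matrix_mult_def)

lemma mm_zero_left [simp]: "(0::'a::ring_1^'n^'m) ** C = 0"
  by (simp add: matrix_matrix_mult_def vec_eq_iff)

lemma mm_zero_right [simp]: "C ** (0::'a::ring_1^'n^'m) = 0"
  by (simp add: matrix_matrix_mult_def vec_eq_iff)

text \<open>The matrices are written in the coordinates in which the order contains the diagonal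
  matrices over the maximal order of the division ring.\<close>

locale matrix_coordinates =
  fixes U V :: "'d::division_ring ^ 'n ^ 'n"
  assumes UV: "U ** V = mat 1" and VU: "V ** U = mat 1"
begin

definition ent :: "'d ^ 'n ^ 'n \<Rightarrow> 'n \<Rightarrow> 'n \<Rightarrow> 'd" where "ent x i j = (V ** x ** U) $ i $ j"
definition mk :: "('n \<Rightarrow> 'n \<Rightarrow> 'd) \<Rightarrow> 'd ^ 'n ^ 'n" where "mk f = U ** (\<chi> i j. f i j) ** V"

lemma ent_mk [simp]: "ent (mk f) i j = f i j"
proof -
  have "V ** mk f ** U = (V ** U) ** (\<chi> i j. f i j) ** (V ** U)"
    by (simp only: mk_def matrix_mul_assoc)
  then show ?thesis by (simp add: ent_def VU)
qed

lemma ent_eqI: assumes "\<And>i j. ent x i j = ent y i j" shows "x = y"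
proof -
  have "V ** x ** U = V ** y ** U" using assms by (simp add: ent_def vec_eq_iff)
  then have "U ** (V ** x ** U) ** V = U ** (V ** y ** U) ** V" by simp
  moreover have "U ** (V ** z ** U) ** V = z" for z
  proof -
    have "U ** (V ** z ** U) ** V = (U ** V) ** z ** (U ** V)" by (simp only: matrix_mul_assoc)
    then show ?thesis by (simp add: UV)
  qed
  ultimately show ?thesis by simp
qed

lemma ent_mult: "ent (x ** y) i j = (\<Sum>k\<in>UNIV. ent x i k * ent y k j)"
proof -
  have "(V ** x ** U) ** (V ** y ** U) = (V ** x) ** (U ** V) ** (y ** U)"
    by (simp only: matrix_mul_assoc)
  then have "(V ** x ** U) ** (V ** y ** U) = V ** (x ** y) ** U"
    by (simp add: UV matrix_mul_assoc)
  then show ?thesis using mm_nth[of "V ** x ** U" "V ** y ** U" i j] by (simp only: ent_def)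
qed

lemma ent_add [simp]: "ent (x + y) i j = ent x i j + ent y i j"
  by (simp add: ent_def matrix_add_ldistrib mm_add_left)

lemma ent_diff [simp]: "ent (x - y) i j = ent x i j - ent y i j"
  by (simp add: ent_def mm_diff_left mm_diff_right)

lemma ent_0 [simp]: "ent 0 i j = 0"
  by (simp add: ent_def)

lemma ent_sum: "ent (sum f A) i j = (\<Sum>a\<in>A. ent (f a) i j)"
  by (induction A rule: infinite_finite_induct) simp_all

lemma ent_1: "ent (mat 1) i j = (if i = j then 1 else 0)"
proof -
  have "V ** mat 1 ** U = mat 1" by (simp add: VU)
  then show ?thesis unfolding ent_def by (simp add: mat_def)
qed

definition E :: "'n \<Rightarrow> 'n \<Rightarrow> 'd \<Rightarrow> 'd ^ 'n ^ 'n" where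
  "E i j s = mk (\<lambda>a b. if a = i \<and> b = j then s else 0)"

lemma ent_E: "ent (E i j s) a b = (if a = i \<and> b = j then s else 0)"
  by (simp add: E_def)

lemma ent_E_mult: "ent (E i j s ** x) a b = (if a = i then s * ent x j b else 0)"
proof -
  have "ent (E i j s ** x) a b = (\<Sum>k\<in>UNIV. if k = j then (if a = i then s * ent x j b else 0) else 0)"
    unfolding ent_mult by (rule sum.cong) (auto simp: ent_E)
  then show ?thesis by simp
qed

lemma ent_mult_E: "ent (x ** E i j s) a b = (if b = j then ent x a i * s else 0)"
proof -
  have "ent (x ** E i j s) a b = (\<Sum>k\<in>UNIV. if k = i then (if b = j then ent x a i * s else 0) else 0)"
    unfolding ent_mult by (rule sum.cong) (auto simp: ent_E)
  then show ?thesis by simp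
qed

end

section \<open>Dual bases of projective modules\<close>

lemma finsum_smult:
  assumes "right_module R M" "finite A" "u \<in> A \<rightarrow> carrier M" "a \<in> carrier R"
  shows "a \<odot>\<^bsub>M\<^esub> finsum M u A = finsum M (\<lambda>k. a \<odot>\<^bsub>M\<^esub> u k) A"
proof -
  interpret M: right_module R M by fact
  have z: "a \<odot>\<^bsub>M\<^esub> \<zero>\<^bsub>M\<^esub> = \<zero>\<^bsub>M\<^esub>"
  proof -
    have "a \<odot>\<^bsub>M\<^esub> \<zero>\<^bsub>M\<^esub> \<oplus>\<^bsub>M\<^esub> a \<odot>\<^bsub>M\<^esub> \<zero>\<^bsub>M\<^esub> = a \<odot>\<^bsub>M\<^esub> \<zero>\<^bsub>M\<^esub>"
      using M.rsmult_distr_vector[OF assms(4), of "\<zero>\<^bsub>M\<^esub>" "\<zero>\<^bsub>M\<^esub>"] by simp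
    then show ?thesis using M.rsmult_closed[OF assms(4) M.M.zero_closed]
      by (simp add: M.M.add.l_cancel_one')
  qed
  from assms(2,3) show ?thesis
  proof (induction A rule: finite_induct)
    case empty
    then show ?case using z by simp
  next
    case (insert k A)
    then have "u k \<in> carrier M" "finsum M u A \<in> carrier M" "u \<in> A \<rightarrow> carrier M"
      by (auto intro!: M.M.finsum_closed)
    then show ?case using insert assms(4)
      by (simp add: M.rsmult_distr_vector M.rsmult_closed Pi_iff)
  qed
qed

text \<open>The sufficient half of the dual basis lemma: choosing preimages m k of f (y k), a lift
  of f sends x to the sum of the m k with coefficients \<phi> k x.\<close>

lemma right_projective_dual_basis:
  fixes R :: "('r, 'x) ring_scheme" and P :: "('r, 'p, 'y) module_scheme" and L :: nat
  assumes P: "right_module R P"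
    and y: "\<And>k. k < L \<Longrightarrow> y k \<in> carrier P"
    and \<phi>: "\<And>k x. k < L \<Longrightarrow> x \<in> carrier P \<Longrightarrow> \<phi> k x \<in> carrier R"
    and \<phi>_add: "\<And>k x x'. k < L \<Longrightarrow> x \<in> carrier P \<Longrightarrow> x' \<in> carrier P \<Longrightarrow>
      \<phi> k (x \<oplus>\<^bsub>P\<^esub> x') = \<phi> k x \<oplus>\<^bsub>R\<^esub> \<phi> k x'"
    and \<phi>_smult: "\<And>k a x. k < L \<Longrightarrow> a \<in> carrier R \<Longrightarrow> x \<in> carrier P \<Longrightarrow>
      \<phi> k (a \<odot>\<^bsub>P\<^esub> x) = \<phi> k x \<otimes>\<^bsub>R\<^esub> a"
    and expand: "\<And>x. x \<in> carrier P \<Longrightarrow> x = (\<Oplus>\<^bsub>P\<^esub>k\<in>{..<L}. \<phi> k x \<odot>\<^bsub>P\<^esub> y k)"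
  shows "right_projective R P"
  unfolding right_projective_def
proof (intro conjI allI impI P)
  fix M N :: "('r, 'p \<Rightarrow> 'r) module" and g f
  assume as: "right_module R M \<and> right_module R N \<and> g \<in> right_module_hom R M N \<and>
    g ` carrier M = carrier N \<and> f \<in> right_module_hom R P N"
  then have M: "right_module R M" and N: "right_module R N" and g: "g \<in> right_module_hom R M N"
    and gs: "g ` carrier M = carrier N" and f: "f \<in> right_module_hom R P N" by auto
  interpret P: right_module R P by (rule P)
  interpret M: right_module R M by (rule M)
  interpret N: right_module R N by (rule N)
  have "\<exists>m. m \<in> carrier M \<and> g m = f (y k)" if "k < L" for k
  proof -
    have "f (y k) \<in> g ` carrier M" using f y[OF that] gs by (auto simp: right_module_hom_def)
    then show ?thesis by auto
  qed
  then obtain m where m: "\<And>k. k < L \<Longrightarrow> m k \<in> carrier M" "\<And>k. k < L \<Longrightarrow> g (m k) = f (y k)"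
    by metis
  define h where "h x = (\<Oplus>\<^bsub>M\<^esub>k\<in>{..<L}. \<phi> k x \<odot>\<^bsub>M\<^esub> m k)" for x
  have tm: "\<phi> k x \<odot>\<^bsub>M\<^esub> m k \<in> carrier M" if "k < L" "x \<in> carrier P" for k x
    using M.rsmult_closed \<phi> m(1) that by blast
  have hc: "h x \<in> carrier M" if "x \<in> carrier P" for x
    unfolding h_def by (rule M.M.finsum_closed) (use tm that in auto)
  have hadd: "h (x \<oplus>\<^bsub>P\<^esub> x') = h x \<oplus>\<^bsub>M\<^esub> h x'" if x: "x \<in> carrier P" "x' \<in> carrier P" for x x'
  proof -
    have "h (x \<oplus>\<^bsub>P\<^esub> x') = (\<Oplus>\<^bsub>M\<^esub>k\<in>{..<L}. \<phi> k x \<odot>\<^bsub>M\<^esub> m k \<oplus>\<^bsub>M\<^esub> \<phi> k x' \<odot>\<^bsub>M\<^esub> m k)"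
      unfolding h_def
      by (rule M.M.finsum_cong') (use x tm \<phi>_add \<phi> m(1) M.rsmult_distr_scalar in auto)
    also have "\<dots> = h x \<oplus>\<^bsub>M\<^esub> h x'" unfolding h_def
      by (rule M.M.finsum_addf) (use x tm in auto)
    finally show ?thesis .
  qed
  have hsm: "h (a \<odot>\<^bsub>P\<^esub> x) = a \<odot>\<^bsub>M\<^esub> h x" if x: "a \<in> carrier R" "x \<in> carrier P" for a x
  proof -
    have "h (a \<odot>\<^bsub>P\<^esub> x) = (\<Oplus>\<^bsub>M\<^esub>k\<in>{..<L}. a \<odot>\<^bsub>M\<^esub> (\<phi> k x \<odot>\<^bsub>M\<^esub> m k))"
      unfolding h_def
      by (rule M.M.finsum_cong')
        (use x tm \<phi>_smult \<phi> m(1) M.rsmult_assoc M.rsmult_closed in auto)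
    also have "\<dots> = a \<odot>\<^bsub>M\<^esub> h x" unfolding h_def
      by (rule finsum_smult[OF M, symmetric]) (use x tm in auto)
    finally show ?thesis .
  qed
  have "h \<in> right_module_hom R P M"
    using hc hadd hsm by (auto simp: right_module_hom_def)
  moreover have "g (h x) = f x" if x: "x \<in> carrier P" for x
  proof -
    have "g (h x) = (\<Oplus>\<^bsub>N\<^esub>k\<in>{..<L}. g (\<phi> k x \<odot>\<^bsub>M\<^esub> m k))"
      unfolding h_def by (rule right_module_hom_finsum[OF M N g]) (use tm x in auto)
    also have "\<dots> = (\<Oplus>\<^bsub>N\<^esub>k\<in>{..<L}. f (\<phi> k x \<odot>\<^bsub>P\<^esub> y k))"
    proof (rule N.M.finsum_cong')
      show "(\<lambda>k. f (\<phi> k x \<odot>\<^bsub>P\<^esub> y k)) \<in> {..<L} \<rightarrow> carrier N"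
      proof (rule Pi_I)
        fix k assume "k \<in> {..<L}"
        then have "\<phi> k x \<odot>\<^bsub>P\<^esub> y k \<in> carrier P" using P.rsmult_closed \<phi> y x by blast
        then show "f (\<phi> k x \<odot>\<^bsub>P\<^esub> y k) \<in> carrier N"
          using f unfolding right_module_hom_def by blast
      qed
      fix k assume "k \<in> {..<L}"
      then show "g (\<phi> k x \<odot>\<^bsub>M\<^esub> m k) = f (\<phi> k x \<odot>\<^bsub>P\<^esub> y k)"
        using g f m \<phi> y x by (auto simp: right_module_hom_def)
    qed simp
    also have "\<dots> = f (\<Oplus>\<^bsub>P\<^esub>k\<in>{..<L}. \<phi> k x \<odot>\<^bsub>P\<^esub> y k)"
      by (rule right_module_hom_finsum[OF P N f, symmetric])
        (use P.rsmult_closed \<phi> y x in auto)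
    also have "\<dots> = f x" using expand[OF x] by simp
    finally show ?thesis .
  qed
  ultimately show "\<exists>h\<in>right_module_hom R P M. \<forall>x\<in>carrier P. g (h x) = f x" by blast
qed

text \<open>The necessary half, read off from a splitting of the free module on the elements of
  \<open>P\<close>: \<open>\<phi> y\<close> is the coordinate at y, and \<open>D\<close> is the
  support of the coordinates of the given x.\<close>

lemma right_projective_coordinates:
  fixes R :: "('r, 'x) ring_scheme" and P :: "('r, 'p, 'y) module_scheme"
  assumes "right_projective R P" "x \<in> carrier P"
  shows "\<exists>\<phi> D. finite D \<and> D \<subseteq> carrier P \<and> x = (\<Oplus>\<^bsub>P\<^esub>y\<in>D. \<phi> y x \<odot>\<^bsub>P\<^esub> y) \<and>
    (\<forall>y. \<forall>x\<in>carrier P. \<phi> y x \<in> carrier R) \<and>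
    (\<forall>y. \<forall>a\<in>carrier R. \<forall>x\<in>carrier P. \<phi> y (a \<odot>\<^bsub>P\<^esub> x) = \<phi> y x \<otimes>\<^bsub>R\<^esub> a)"
proof -
  obtain s where s: "s \<in> right_module_hom R P (free_right_module R (carrier P))"
    "\<And>x. x \<in> carrier P \<Longrightarrow> free_extension R P (\<lambda>x. x) (s x) = x"
    using right_projective_splits[OF assms(1)] by blast
  have c: "s x \<in> carrier (free_right_module R (carrier P))" if "x \<in> carrier P" for x
    using s(1) that by (auto simp: right_module_hom_def)
  show ?thesis
  proof (rule exI[of _ "\<lambda>y x. s x y"], rule exI[of _ "{y. s x y \<noteq> \<zero>\<^bsub>R\<^esub>}"], intro conjI allI ballI)
    show "finite {y. s x y \<noteq> \<zero>\<^bsub>R\<^esub>}" "{y. s x y \<noteq> \<zero>\<^bsub>R\<^esub>} \<subseteq> carrier P"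
      using c[OF assms(2)] by (auto simp: free_right_module_def)
    show "x = (\<Oplus>\<^bsub>P\<^esub>y\<in>{y. s x y \<noteq> \<zero>\<^bsub>R\<^esub>}. s x y \<odot>\<^bsub>P\<^esub> y)"
      using s(2)[OF assms(2)] by (simp add: free_extension_def)
    show "s x y \<in> carrier R" if "x \<in> carrier P" for x y
      using c[OF that] by (auto simp: free_right_module_def)
    show "s (a \<odot>\<^bsub>P\<^esub> x) y = s x y \<otimes>\<^bsub>R\<^esub> a" if "a \<in> carrier R" "x \<in> carrier P" for a x y
    proof -
      have "s (a \<odot>\<^bsub>P\<^esub> x) = a \<odot>\<^bsub>free_right_module R (carrier P)\<^esub> s x"
        using s(1) that by (auto simp: right_module_hom_def)
      then show ?thesis by (simp add: free_right_module_def)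
    qed
  qed
qed

text \<open>\<open>lam\<close> is the exponent matrix, and its triangle inequality expresses closure
  under multiplication. The central element \<open>z\<close> will be the image of a uniformizer of
  the field; its valuation is the ramification index and may exceed 1.\<close>

locale tiled_order = discrete_valuation val \<pi> + matrix_coordinates U V
  for val :: "'d::division_ring \<Rightarrow> int" and \<pi> :: 'd and U V :: "'d ^ 'n ^ 'n" +
  fixes lam :: "'n \<Rightarrow> 'n \<Rightarrow> int" and z :: 'd
  assumes lam_diag [simp]: "lam i i = 0" and lam_triangle: "lam i k \<le> lam i j + lam j k"
    and z_central: "x * z = z * x" and z_nonzero [simp]: "z \<noteq> 0" and val_z: "1 \<le> val z"
begin

definition \<O> :: "('d ^ 'n ^ 'n) set" where "\<O> = {x. \<forall>i j. vge (lam i j) (ent x i j)}"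

lemma in_\<O>: "x \<in> \<O> \<longleftrightarrow> (\<forall>i j. vge (lam i j) (ent x i j))"
  by (simp add: \<O>_def)

lemma \<O>_diff: "x \<in> \<O> \<Longrightarrow> y \<in> \<O> \<Longrightarrow> x - y \<in> \<O>"
  by (simp add: in_\<O> vge_diff)

lemma \<O>_add: "x \<in> \<O> \<Longrightarrow> y \<in> \<O> \<Longrightarrow> x + y \<in> \<O>"
  by (simp add: in_\<O> vge_add)

text \<open>The shift by \<open>h\<close> measures the denominators of inverses.\<close>

definition shifted :: "int \<Rightarrow> ('d ^ 'n ^ 'n) \<Rightarrow> bool" where
  "shifted h x \<longleftrightarrow> (\<forall>i j. vge (lam i j - h) (ent x i j))"

lemma shifted_0 [simp]: "shifted 0 x \<longleftrightarrow> x \<in> \<O>"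
  by (simp add: shifted_def in_\<O>)

lemma shifted_mult: "shifted h x \<Longrightarrow> shifted h' y \<Longrightarrow> shifted (h + h') (x ** y)"
  unfolding shifted_def ent_mult
proof (intro allI vge_sum)
  fix i j k assume "\<forall>i j. vge (lam i j - h) (ent x i j)" "\<forall>i j. vge (lam i j - h') (ent y i j)"
  then have "vge ((lam i k - h) + (lam k j - h')) (ent x i k * ent y k j)"
    by (intro vge_mult[OF _ _ refl]) auto
  then show "vge (lam i j - (h + h')) (ent x i k * ent y k j)"
    by (rule vge_mono) (use lam_triangle[of i j k] in linarith)
qed

lemma \<O>_mult: "x \<in> \<O> \<Longrightarrow> y \<in> \<O> \<Longrightarrow> x ** y \<in> \<O>"
  using shifted_mult[of 0 x 0 y] by simp

lemma \<O>_1 [simp]: "mat 1 \<in> \<O>"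
  by (simp add: in_\<O> ent_1)

lemma \<O>_0 [simp]: "0 \<in> \<O>"
  by (simp add: in_\<O>)

lemma E_in_\<O>: "vge (lam i j) s \<Longrightarrow> E i j s \<in> \<O>"
  by (simp add: in_\<O> ent_E)

lemma E_1_in_\<O> [simp]: "E i i 1 \<in> \<O>"
  by (rule E_in_\<O>) simp

abbreviation R :: "('d ^ 'n ^ 'n) ring" where "R \<equiv> matrix_ring\<lparr>carrier := \<O>\<rparr>"

lemma R_simps: "carrier R = \<O>" "monoid.mult R = (**)" "monoid.one R = mat 1" "ring.zero R = 0" "add R = (+)"
  by (simp_all add: matrix_ring_def)

lemma ring_R: "ring R"
proof (rule ringI)
  show "abelian_group R"
  proof (rule abelian_groupI)
    show "\<exists>y\<in>carrier R. y \<oplus>\<^bsub>R\<^esub> x = \<zero>\<^bsub>R\<^esub>" if "x \<in> carrier R" for x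
      using \<O>_diff[of 0 x] that by (intro bexI[of _ "0 - x"]) (simp_all add: R_simps)
  qed (auto simp: R_simps \<O>_add ac_simps)
  show "Group.monoid R"
    by (rule monoidI) (auto simp: R_simps \<O>_mult matrix_mul_assoc)
qed (auto simp: R_simps mm_add_left matrix_add_ldistrib)

lemma right_ideal_iff:
  "right_ideal I R \<longleftrightarrow> I \<subseteq> \<O> \<and> 0 \<in> I \<and> (\<forall>x\<in>I. \<forall>y\<in>I. x + y \<in> I \<and> - x \<in> I) \<and> (\<forall>x\<in>I. \<forall>a\<in>\<O>. x ** a \<in> I)"
proof -
  interpret R: ring R by (rule ring_R)
  have neg: "\<ominus>\<^bsub>R\<^esub> x = - x" if "x \<in> \<O>" for x
    by (rule R.minus_equality) (use that \<O>_diff[of 0 x] in \<open>simp_all add: R_simps\<close>)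
  have "additive_subgroup I R \<longleftrightarrow> I \<subseteq> \<O> \<and> 0 \<in> I \<and> (\<forall>x\<in>I. \<forall>y\<in>I. x + y \<in> I \<and> - x \<in> I)"
  proof
    assume "additive_subgroup I R"
    then interpret I: additive_subgroup I R .
    show "I \<subseteq> \<O> \<and> 0 \<in> I \<and> (\<forall>x\<in>I. \<forall>y\<in>I. x + y \<in> I \<and> - x \<in> I)"
      using I.a_subset I.zero_closed I.a_closed I.a_inv_closed neg by (auto simp: R_simps subset_iff)
  next
    assume *: "I \<subseteq> \<O> \<and> 0 \<in> I \<and> (\<forall>x\<in>I. \<forall>y\<in>I. x + y \<in> I \<and> - x \<in> I)"
    have "subgroup I (add_monoid R)"
    proof (rule R.add.subgroupI)
      show "\<ominus>\<^bsub>R\<^esub> x \<in> I" if "x \<in> I" for x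
        using * that neg[of x] by auto
    qed (use * in \<open>auto simp: R_simps\<close>)
    then show "additive_subgroup I R" by (rule additive_subgroup.intro)
  qed
  then show ?thesis unfolding right_ideal_def by (simp add: R_simps)
qed

lemma right_module_ideal:
  assumes "right_ideal I R"
  shows "right_module R (right_ideal_module R I)"
proof (rule right_module.intro[OF ring_R])
  have I: "I \<subseteq> \<O>" "0 \<in> I" "\<And>x y. x \<in> I \<Longrightarrow> y \<in> I \<Longrightarrow> x + y \<in> I" "\<And>x. x \<in> I \<Longrightarrow> - x \<in> I"
    "\<And>x a. x \<in> I \<Longrightarrow> a \<in> \<O> \<Longrightarrow> x ** a \<in> I" using assms unfolding right_ideal_iff by blast+
  show "abelian_group (right_ideal_module R I)"
  proof (rule abelian_groupI)
    show "\<exists>y\<in>carrier (right_ideal_module R I). y \<oplus>\<^bsub>right_ideal_module R I\<^esub> x = \<zero>\<^bsub>right_ideal_module R I\<^esub>"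
      if "x \<in> carrier (right_ideal_module R I)" for x
      by (rule bexI[of _ "- x"]) (use I(4) that in \<open>simp_all add: right_ideal_module_def R_simps\<close>)
  qed (use I in \<open>auto simp: right_ideal_module_def R_simps ac_simps\<close>)
  show "right_module_axioms R (right_ideal_module R I)"
    by (rule right_module_axioms.intro)
      (use I in \<open>auto simp: right_ideal_module_def R_simps matrix_add_ldistrib mm_add_left matrix_mul_assoc\<close>)
qed

lemma finsum_ideal:
  assumes "right_ideal I R" "finite A" "u \<in> A \<rightarrow> I"
  shows "finsum (right_ideal_module R I) u A = sum u A"
proof -
  interpret right_module R "right_ideal_module R I" by (rule right_module_ideal[OF assms(1)])
  have c: "carrier (right_ideal_module R I) = I" by (simp add: right_ideal_module_def)
  from assms(2,3) show ?thesis
  proof (induction A rule: finite_induct)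
    case (insert a A)
    then have "finsum (right_ideal_module R I) u (insert a A) =
        u a \<oplus>\<^bsub>right_ideal_module R I\<^esub> finsum (right_ideal_module R I) u A"
      by (intro M.finsum_insert) (auto simp: c)
    then show ?case using insert by (simp add: right_ideal_module_def R_simps)
  next
    case empty
    show ?case unfolding M.finsum_empty by (simp add: right_ideal_module_def R_simps)
  qed
qed

subsection \<open>Hereditary tiled orders\<close>

definition lam_sum :: "'n \<Rightarrow> int" where "lam_sum i = (\<Sum>k\<in>UNIV. lam i k)"

text \<open>If \<open>lam i j + lam j i \<le> 1\<close> for all \<open>i\<close> and \<open>j\<close>, then
  \<open>lam i j = \<lceil>(lam_sum i - lam_sum j) / n\<rceil>\<close>, so that the order consists of the matrices
  whose entries have nonnegative weight.\<close>

definition weight :: "'n \<Rightarrow> 'n \<Rightarrow> 'd \<Rightarrow> int" where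
  "weight i j s = int CARD('n) * val s - lam_sum i + lam_sum j"

lemma weight_mult: "s \<noteq> 0 \<Longrightarrow> u \<noteq> 0 \<Longrightarrow> weight i k (s * u) = weight i j s + weight j k u"
  by (simp add: weight_def val_mult algebra_simps)

lemma weight_inverse: "s \<noteq> 0 \<Longrightarrow> weight j i (inverse s) = - weight i j s"
  by (simp add: weight_def val_inverse)

text \<open>Each difference lam i k - lam j k lies between lam i j - 1 and lam i j, and it exceeds
  the lower bound at k = j. This strictness makes the rounding in \<open>vge_iff_weight\<close>
  exact.\<close>

lemma lam_sum_diff:
  assumes "lam i j + lam j i \<le> 1"
  shows "lam_sum i - lam_sum j \<le> int CARD('n) * lam i j"
    and "int CARD('n) * (lam i j - 1) < lam_sum i - lam_sum j"
proof -
  have eq: "lam_sum i - lam_sum j = (\<Sum>k\<in>UNIV. lam i k - lam j k)"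
    by (simp add: lam_sum_def sum_subtractf)
  have "(\<Sum>k\<in>UNIV. lam i k - lam j k) \<le> (\<Sum>k\<in>(UNIV :: 'n set). lam i j)"
    by (rule sum_mono) (use lam_triangle[of i _ j] in \<open>simp add: diff_le_eq\<close>)
  then show "lam_sum i - lam_sum j \<le> int CARD('n) * lam i j" by (simp add: eq)
  have "(\<Sum>k\<in>(UNIV :: 'n set). lam i j - 1) < (\<Sum>k\<in>UNIV. lam i k - lam j k)"
  proof (rule sum_strict_mono_ex1)
    show "\<forall>k\<in>UNIV. lam i j - 1 \<le> lam i k - lam j k"
    proof
      fix k show "lam i j - 1 \<le> lam i k - lam j k" using lam_triangle[of j k i] assms by linarith
    qed
    show "\<exists>k\<in>UNIV. lam i j - 1 < lam i k - lam j k" by (rule bexI[of _ j]) simp_all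
  qed simp
  then show "int CARD('n) * (lam i j - 1) < lam_sum i - lam_sum j" by (simp add: eq)
qed

lemma vge_iff_weight:
  assumes "lam i j + lam j i \<le> 1" "s \<noteq> 0"
  shows "vge (lam i j) s \<longleftrightarrow> 0 \<le> weight i j s"
proof
  assume "vge (lam i j) s"
  then have "int CARD('n) * lam i j \<le> int CARD('n) * val s"
    using assms(2) by (intro mult_left_mono) (auto simp: vge_def)
  then show "0 \<le> weight i j s" unfolding weight_def using lam_sum_diff(1)[OF assms(1)] by linarith
next
  assume w: "0 \<le> weight i j s"
  show "vge (lam i j) s"
  proof (rule ccontr)
    assume "\<not> vge (lam i j) s"
    then have "int CARD('n) * val s \<le> int CARD('n) * (lam i j - 1)"
      by (intro mult_left_mono) (auto simp: vge_def)
    then show False using lam_sum_diff(2)[OF assms(1)] w unfolding weight_def by linarith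
  qed
qed

text \<open>Induction on the number of rows outside \<open>W\<close>, where the elements may be
  nonzero. An entry of least weight among all these elements, at (i, j), divides every entry of row
  i. So a multiple \<open>g\<close> of a matrix unit maps the elements into the order,
  \<open>y' ** (g ** x)\<close> reproduces row i of x, and the difference vanishes in one more
  row.\<close>

lemma dual_basis:
  fixes W :: "'n set"
  assumes H: "\<And>i j. lam i j + lam j i \<le> 1" and I: "right_ideal I R"
  shows "\<exists>L y f. (\<forall>k<L. y k \<in> I \<and> (\<forall>x\<in>I. (\<forall>i\<in>W. \<forall>j. ent x i j = 0) \<longrightarrow> f k ** x \<in> \<O>)) \<and>
     (\<forall>x\<in>I. (\<forall>i\<in>W. \<forall>j. ent x i j = 0) \<longrightarrow> x = (\<Sum>k<(L::nat). y k ** (f k ** x)))"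
proof (induction "card (- W)" arbitrary: W rule: less_induct)
  case less
  have Ic: "I \<subseteq> \<O>" "\<And>x y. x \<in> I \<Longrightarrow> y \<in> I \<Longrightarrow> x + y \<in> I" "\<And>x. x \<in> I \<Longrightarrow> - x \<in> I"
    "\<And>x a. x \<in> I \<Longrightarrow> a \<in> \<O> \<Longrightarrow> x ** a \<in> I" using I unfolding right_ideal_iff by blast+
  define IW where "IW = {x\<in>I. \<forall>i\<in>W. \<forall>j. ent x i j = 0}"
  show ?case
  proof (cases "\<exists>x i j. x \<in> IW \<and> ent x i j \<noteq> 0")
    case False
    have "x = 0" if "x \<in> IW" for x by (rule ent_eqI) (use False that in auto)
    then show ?thesis
      by (intro exI[of _ 0] exI[of _ "\<lambda>_. 0"]) (auto simp: IW_def)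
  next
    case True
    define P where "P = (\<lambda>(x, i, j). x \<in> IW \<and> ent x i j \<noteq> 0)"
    have "\<exists>p. P p" using True by (auto simp: P_def)
    then obtain p where p: "P p" and pmin: "\<And>q. P q \<Longrightarrow>
        (case p of (x, i, j) \<Rightarrow> nat (weight i j (ent x i j))) \<le>
        (case q of (x, i, j) \<Rightarrow> nat (weight i j (ent x i j)))"
      using ex_has_least_nat[of P _ "\<lambda>(x, i, j). nat (weight i j (ent x i j))"] by blast
    obtain y i j where pq: "p = (y, i, j)" by (cases p)
    have y: "y \<in> IW" "ent y i j \<noteq> 0" using p by (auto simp: P_def pq)
    have nn: "0 \<le> weight a b (ent x a b)" if "x \<in> IW" "ent x a b \<noteq> 0" for x a b
    proof -
      have "x \<in> \<O>" using that(1) Ic(1) by (auto simp: IW_def)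
      then have "vge (lam a b) (ent x a b)" by (simp add: in_\<O>)
      then show ?thesis using vge_iff_weight[OF H that(2)] by simp
    qed
    have min: "weight i j (ent y i j) \<le> weight a b (ent x a b)" if "x \<in> IW" "ent x a b \<noteq> 0" for x a b
      using pmin[of "(x, a, b)"] that nn[OF that] by (simp add: P_def pq)
    have iW: "i \<notin> W" using y by (auto simp: IW_def)
    define s where "s = ent y i j"
    \<comment> \<open>Keeping only column j of y ensures that \<open>y' ** (g ** x)\<close> depends
      on row j of \<open>g ** x\<close> alone.\<close>
    define y' where "y' = y ** E j j 1"
    define g where "g = E j i (inverse s)"
    have s: "s \<noteq> 0" using y by (simp add: s_def)
    have y': "y' \<in> IW" using y(1) Ic(4)[of y "E j j 1"] by (auto simp: IW_def y'_def ent_mult_E)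
    have gx: "g ** x \<in> \<O>" if x: "x \<in> IW" for x
      unfolding in_\<O>
    proof (intro allI)
      fix a b
      have "vge (lam j b) (inverse s * ent x i b)" if nz: "ent x i b \<noteq> 0"
      proof -
        have "weight j b (inverse s * ent x i b) = weight i b (ent x i b) - weight i j s"
          using weight_mult[of "inverse s" "ent x i b" j b i] s nz weight_inverse[OF s] by simp
        then have "0 \<le> weight j b (inverse s * ent x i b)" using min[OF x nz] by (simp add: s_def)
        then show ?thesis using vge_iff_weight[OF H] s nz by simp
      qed
      then show "vge (lam a b) (ent (g ** x) a b)" by (cases "ent x i b = 0") (auto simp: g_def ent_E_mult)
    qed
    have row: "ent (y' ** (g ** x)) i b = ent x i b" for x b
    proof -
      have "ent (y' ** (g ** x)) i b = ent y i j * ent (E j j 1 ** (g ** x)) j b"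
        unfolding y'_def matrix_mul_assoc[symmetric] ent_mult[of y]
        by (subst sum.remove[of UNIV j]) (auto simp: ent_E_mult intro!: sum.neutral)
      also have "\<dots> = s * (inverse s * ent x i b)"
        unfolding ent_E_mult g_def by (simp add: s_def)
      also have "\<dots> = ent x i b" using s by (simp flip: mult.assoc)
      finally show ?thesis .
    qed
    have red: "x - y' ** (g ** x) \<in> I" "\<forall>a\<in>insert i W. \<forall>b. ent (x - y' ** (g ** x)) a b = 0"
      if x: "x \<in> IW" for x
    proof -
      have m: "y' ** (g ** x) \<in> I" using Ic(4) y' gx[OF x] by (auto simp: IW_def)
      have "x + - (y' ** (g ** x)) \<in> I"
        by (rule Ic(2)) (use Ic(3)[OF m] x in \<open>simp_all add: IW_def\<close>)
      then show "x - y' ** (g ** x) \<in> I" by simp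
      have "ent (y' ** (g ** x)) a b = 0" if "a \<in> W" for a b
        unfolding ent_mult[of y'] by (rule sum.neutral) (use y' that in \<open>auto simp: IW_def\<close>)
      then show "\<forall>a\<in>insert i W. \<forall>b. ent (x - y' ** (g ** x)) a b = 0"
        using row x by (auto simp: IW_def)
    qed
    have "card (- insert i W) < card (- W)"
      by (rule psubset_card_mono) (use iW in auto)
    from less.hyps[OF this] obtain L yy f where
      f: "\<forall>k<L. yy k \<in> I \<and> (\<forall>x\<in>I. (\<forall>i\<in>insert i W. \<forall>j. ent x i j = 0) \<longrightarrow> f k ** x \<in> \<O>)" and
      ex: "\<forall>x\<in>I. (\<forall>i\<in>insert i W. \<forall>j. ent x i j = 0) \<longrightarrow> x = (\<Sum>k<(L::nat). yy k ** (f k ** x))"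
      by blast
    \<comment> \<open>The functionals of the smaller problem are applied to the remainder
      \<open>x - y' ** (g ** x)\<close>, and \<open>g\<close> is appended as the last one.\<close>
    define ff where "ff k = (if k < L then f k ** (mat 1 - y' ** g) else g)" for k
    define y2 where "y2 k = (if k < L then yy k else y')" for k
    have ffx: "ff k ** x = f k ** (x - y' ** (g ** x))" if "k < L" for k x
      using that by (simp add: ff_def mm_diff_left mm_diff_right matrix_mul_assoc)
    show ?thesis
    proof (rule exI[of _ "Suc L"], rule exI[of _ y2], rule exI[of _ ff], intro conjI allI impI ballI)
      fix k assume k: "k < Suc L"
      then show "y2 k \<in> I" using f y' by (auto simp: y2_def IW_def)
      fix x assume "x \<in> I" "\<forall>i\<in>W. \<forall>j. ent x i j = 0"
      then have x: "x \<in> IW" by (simp add: IW_def)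
      show "ff k ** x \<in> \<O>"
      proof (cases "k < L")
        case True
        then show ?thesis unfolding ffx[OF True] using f red[OF x] by blast
      next
        case False
        then show ?thesis using gx[OF x] by (simp add: ff_def)
      qed
    next
      fix x assume "x \<in> I" "\<forall>i\<in>W. \<forall>j. ent x i j = 0"
      then have x: "x \<in> IW" by (simp add: IW_def)
      have "x - y' ** (g ** x) = (\<Sum>k<L. yy k ** (f k ** (x - y' ** (g ** x))))"
        using ex red[OF x] by blast
      also have "\<dots> = (\<Sum>k<L. y2 k ** (ff k ** x))"
        by (rule sum.cong) (simp_all add: ffx y2_def)
      finally have "x = (\<Sum>k<L. y2 k ** (ff k ** x)) + y' ** (g ** x)" by (simp add: diff_eq_eq)
      then show "x = (\<Sum>k<Suc L. y2 k ** (ff k ** x))" by (simp add: y2_def ff_def)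
    qed
  qed
qed

lemma hereditary_if:
  assumes H: "\<And>i j. lam i j + lam j i \<le> 1"
  shows "right_hereditary R"
  unfolding right_hereditary_def
proof (intro allI impI)
  fix I assume I: "right_ideal I R"
  have Ic: "I \<subseteq> \<O>" "\<And>x a. x \<in> I \<Longrightarrow> a \<in> \<O> \<Longrightarrow> x ** a \<in> I"
    using I unfolding right_ideal_iff by blast+
  have "\<exists>L y f. (\<forall>k<L. y k \<in> I \<and> (\<forall>x\<in>I. f k ** x \<in> \<O>)) \<and>
      (\<forall>x\<in>I. x = (\<Sum>k<(L::nat). y k ** (f k ** x)))"
    using dual_basis[OF H I, of "{}"] by simp
  then obtain L y f where f0: "\<forall>k<L. y k \<in> I \<and> (\<forall>x\<in>I. f k ** x \<in> \<O>)"
    and f1: "\<forall>x\<in>I. x = (\<Sum>k<(L::nat). y k ** (f k ** x))" by blast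
  have f: "y k \<in> I" "x \<in> I \<Longrightarrow> f k ** x \<in> \<O>" if "k < L" for k x using f0 that by blast+
  have P: "carrier (right_ideal_module R I) = I" "add (right_ideal_module R I) = (+)"
    "smult (right_ideal_module R I) = (\<lambda>a x. x ** a)"
    by (simp_all add: right_ideal_module_def R_simps)
  show "right_projective R (right_ideal_module R I)"
  proof (rule right_projective_dual_basis[where L = L and y = y and \<phi> = "\<lambda>k x. f k ** x"])
    show "right_module R (right_ideal_module R I)" by (rule right_module_ideal[OF I])
    fix x assume x: "x \<in> carrier (right_ideal_module R I)"
    have "(\<Oplus>\<^bsub>right_ideal_module R I\<^esub>k\<in>{..<L}. y k ** (f k ** x)) = (\<Sum>k<L. y k ** (f k ** x))"
      by (rule finsum_ideal[OF I]) (use x f Ic(2) in \<open>auto simp: P(1)\<close>)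
    then show "x = (\<Oplus>\<^bsub>right_ideal_module R I\<^esub>k\<in>{..<L}. f k ** x \<odot>\<^bsub>right_ideal_module R I\<^esub> y k)"
      using f1[rule_format, of x] x unfolding P by simp
  qed (use f in \<open>auto simp: P R_simps matrix_add_ldistrib matrix_mul_assoc\<close>)
qed

text \<open>If \<open>lam i j + lam j i \<ge> 2\<close>, the right ideal generated by \<open>\<pi> E\<^sub>i\<^sub>i\<close> and
  \<open>\<pi>^(lam i j) E\<^sub>i\<^sub>j\<close> is not projective.\<close>

lemma not_hereditary_if:
  assumes ij: "2 \<le> lam i j + lam j i"
  shows "\<not> right_hereditary R"
proof
  assume her: "right_hereditary R"
  \<comment> \<open>The least valuations of the entries in row i of the ideal.\<close>
  define \<mu> where "\<mu> k = min (1 + lam i k) (lam i j + lam j k)" for k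
  have \<mu>_tri: "\<mu> l \<le> \<mu> k + lam k l" for k l
    using lam_triangle[of i l k] lam_triangle[of j l k] by (simp add: \<mu>_def min_def)
  have \<mu>_lam: "lam i k \<le> \<mu> k" for k using lam_triangle[of i k j] by (simp add: \<mu>_def)
  have \<mu>_i: "\<mu> i = 1" using ij by (simp add: \<mu>_def)
  have \<mu>_j: "\<mu> j = lam i j" by (simp add: \<mu>_def)
  \<comment> \<open>In terms of lattices: row i of the ideal times its dual lies in the maximal
    ideal, so that no dual basis can produce 1.\<close>
  have strict: "\<exists>l. 1 \<le> \<mu> k + lam k l - \<mu> l" for k
  proof (rule ccontr)
    assume "\<not> ?thesis"
    then have "\<not> 1 \<le> \<mu> k + lam k i - \<mu> i" "\<not> 1 \<le> \<mu> k + lam k j - \<mu> j" by blast+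
    then have a: "\<mu> k + lam k i \<le> 1" "\<mu> k + lam k j \<le> lam i j" by (simp_all add: \<mu>_i \<mu>_j)
    show False
    proof (cases "\<mu> k = 1 + lam i k")
      case True
      then show False using a(2) lam_triangle[of i j k] by linarith
    next
      case False
      then have "\<mu> k = lam i j + lam j k" by (simp add: \<mu>_def min_def split: if_splits)
      then show False using a(1) lam_triangle[of j i k] ij by linarith
    qed
  qed
  define I where "I = {x\<in>\<O>. \<forall>a b. (a \<noteq> i \<longrightarrow> ent x a b = 0) \<and> vge (\<mu> b) (ent x i b)}"
  have I: "right_ideal I R"
    unfolding right_ideal_iff
  proof (intro conjI ballI)
    show "I \<subseteq> \<O>" "0 \<in> I" by (auto simp: I_def)
    show "x + y \<in> I" "- x \<in> I" if "x \<in> I" "y \<in> I" for x y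
      using that \<O>_add \<O>_diff[of 0 x] ent_diff[of 0 x] by (auto simp: I_def vge_add)
    show "x ** r \<in> I" if x: "x \<in> I" and r: "r \<in> \<O>" for x r
      unfolding I_def
    proof (intro CollectI conjI allI impI)
      show "x ** r \<in> \<O>" using \<O>_mult x r by (auto simp: I_def)
      show "ent (x ** r) a b = 0" if "a \<noteq> i" for a b
        unfolding ent_mult by (rule sum.neutral) (use x that in \<open>auto simp: I_def\<close>)
      show "vge (\<mu> b) (ent (x ** r) i b)" for b
        unfolding ent_mult
      proof (rule vge_sum)
        fix k
        have "vge (\<mu> k + lam k b) (ent x i k * ent r k b)"
          by (rule vge_mult[OF _ _ refl]) (use x r in \<open>auto simp: I_def in_\<O>\<close>)
        then show "vge (\<mu> b) (ent x i k * ent r k b)" by (rule vge_mono) (rule \<mu>_tri)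
      qed
    qed
  qed
  have P: "carrier (right_ideal_module R I) = I" "smult (right_ideal_module R I) = (\<lambda>a x. x ** a)"
    by (simp_all add: right_ideal_module_def R_simps)
  have proj: "right_projective R (right_ideal_module R I)"
    using her I unfolding right_hereditary_def by blast
  define zI where "zI = mk (\<lambda>a b. if a = b then z else 0)"
  have ent_zI: "ent (x ** zI) a b = z * ent x a b" for x a b
  proof -
    have "ent (x ** zI) a b = (\<Sum>k\<in>UNIV. if k = b then ent x a b * z else 0)"
      unfolding ent_mult by (rule sum.cong) (auto simp: zI_def)
    then show ?thesis by (simp add: z_central)
  qed
  have zI: "zI \<in> \<O>" using val_z by (auto simp: in_\<O> zI_def vge_def)
  \<comment> \<open>The matrix unit E i i is not in the ideal, but its multiple by \<open>z\<close>
    is. As \<open>z\<close> is central, \<open>x0 ** x = x ** zI\<close> for the test elements x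
    below, and linearity then ties \<phi> y x to \<phi> y x0.\<close>
  define x0 where "x0 = E i i z"
  have x0: "x0 \<in> I"
  proof -
    have "vge 1 z" using val_z by (simp add: vge_def)
    moreover have "vge 0 z" using val_z by (simp add: vge_def)
    ultimately show ?thesis by (auto simp: I_def x0_def ent_E \<mu>_i intro!: E_in_\<O>)
  qed
  have "x0 \<in> carrier (right_ideal_module R I)" using x0 unfolding P .
  from right_projective_coordinates[OF proj this]
  obtain \<phi> D where D: "finite D" "D \<subseteq> carrier (right_ideal_module R I)"
    and x0_eq: "x0 = (\<Oplus>\<^bsub>right_ideal_module R I\<^esub>y\<in>D. \<phi> y x0 \<odot>\<^bsub>right_ideal_module R I\<^esub> y)"
    and \<phi>c: "\<forall>y. \<forall>x\<in>carrier (right_ideal_module R I). \<phi> y x \<in> carrier R"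
    and \<phi>m: "\<forall>y. \<forall>a\<in>carrier R. \<forall>x\<in>carrier (right_ideal_module R I).
      \<phi> y (a \<odot>\<^bsub>right_ideal_module R I\<^esub> x) = \<phi> y x \<otimes>\<^bsub>R\<^esub> a"
    by (elim exE conjE)
  have DI: "D \<subseteq> I" using D(2) unfolding P .
  have \<phi>O: "\<phi> y x \<in> \<O>" if "x \<in> I" for x y using \<phi>c that unfolding P R_simps by blast
  have \<phi>mult: "\<phi> y (x ** a) = \<phi> y x ** a" if "x \<in> I" "a \<in> \<O>" for x y a
    using \<phi>m that unfolding P R_simps by blast
  have x0_sum: "x0 = (\<Sum>y\<in>D. y ** \<phi> y x0)"
  proof -
    have "(\<lambda>y. y ** \<phi> y x0) \<in> D \<rightarrow> I"
      using I DI \<phi>O[OF x0] unfolding right_ideal_iff by blast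
    from finsum_ideal[OF I D(1) this] x0_eq show ?thesis unfolding P by (rule trans[rotated])
  qed
  have "z = ent x0 i i" by (simp add: x0_def ent_E)
  also have "\<dots> = ent (\<Sum>y\<in>D. y ** \<phi> y x0) i i" by (rule arg_cong[OF x0_sum])
  also have "\<dots> = (\<Sum>y\<in>D. \<Sum>k\<in>UNIV. ent y i k * ent (\<phi> y x0) k i)"
    by (simp only: ent_sum ent_mult)
  finally have z_eq: "z = (\<Sum>y\<in>D. \<Sum>k\<in>UNIV. ent y i k * ent (\<phi> y x0) k i)" .
  have bound: "vge (lam k l - \<mu> l + val z) (ent (\<phi> y x0) k i)" for y k l
  proof -
    define x where "x = E i l (\<pi> powi (\<mu> l))"
    have xI: "x \<in> I" using \<mu>_lam[of l] by (auto simp: I_def x_def ent_E intro!: E_in_\<O>)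
    have xO: "x \<in> \<O>" using xI by (simp add: I_def)
    have "x ** zI = x0 ** x"
    proof (rule ent_eqI)
      fix a b
      show "ent (x ** zI) a b = ent (x0 ** x) a b"
        unfolding ent_zI x0_def ent_E_mult by (auto simp: x_def ent_E)
    qed
    then have "\<phi> y x ** zI = \<phi> y x0 ** x" using \<phi>mult[OF xI zI] \<phi>mult[OF x0 xO] by metis
    then have eq: "z * ent (\<phi> y x) k l = ent (\<phi> y x0) k i * \<pi> powi (\<mu> l)"
      using ent_zI[of "\<phi> y x" k l] by (simp add: x_def ent_mult_E)
    have "vge (lam k l) (ent (\<phi> y x) k l)" using \<phi>O[OF xI] by (simp add: in_\<O>)
    then have "vge (val z + lam k l) (z * ent (\<phi> y x) k l)"
      by (rule vge_mult[OF _ _ refl, rotated]) (simp add: vge_def)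
    then have "vge (val z + lam k l) (ent (\<phi> y x0) k i * \<pi> powi (\<mu> l))" by (simp only: eq)
    then show ?thesis by (auto simp: vge_def val_mult)
  qed
  \<comment> \<open>The coordinates of \<open>x0\<close> would represent z as a sum of terms of
    larger valuation.\<close>
  have "vge (val z + 1) (\<Sum>y\<in>D. \<Sum>k\<in>UNIV. ent y i k * ent (\<phi> y x0) k i)"
  proof (intro vge_sum)
    fix y k assume "y \<in> D"
    then have y: "vge (\<mu> k) (ent y i k)" using DI by (auto simp: I_def)
    obtain l where l: "1 \<le> \<mu> k + lam k l - \<mu> l" using strict by blast
    have "vge (\<mu> k + (lam k l - \<mu> l + val z)) (ent y i k * ent (\<phi> y x0) k i)"
      by (rule vge_mult[OF y bound refl])
    then show "vge (val z + 1) (ent y i k * ent (\<phi> y x0) k i)"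
      by (rule vge_mono) (use l in linarith)
  qed
  from this[folded z_eq] have "vge (val z + 1) z" .
  moreover have "\<not> vge (val z + 1) z" by (simp add: vge_def)
  ultimately show False by (rule notE[rotated])
qed

end

section \<open>Factorizations in hereditary tiled orders\<close>

definition inverses :: "('d::division_ring ^ 'n ^ 'n) \<Rightarrow> 'd ^ 'n ^ 'n \<Rightarrow> bool" where
  "inverses x y \<longleftrightarrow> x ** y = mat 1 \<and> y ** x = mat 1"

lemma inverses_sym: "inverses x y \<Longrightarrow> inverses y x"
  by (simp add: inverses_def)

lemma inverses_mult:
  assumes "inverses x x'" "inverses y y'" shows "inverses (x ** y) (y' ** x')"
proof -
  have "(x ** y) ** (y' ** x') = x ** (y ** y') ** x'" "(y' ** x') ** (x ** y) = y' ** (x' ** x) ** y"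
    by (simp_all only: matrix_mul_assoc)
  then show ?thesis using assms by (simp add: inverses_def)
qed

lemma inverses_1 [simp]: "inverses (mat 1) (mat 1)"
  by (simp add: inverses_def)

lemma inverses_unique:
  assumes "inverses x y" "inverses x y'" shows "y = y'"
proof -
  have "y = (y' ** x) ** y" using assms by (simp add: inverses_def)
  also have "\<dots> = y' ** (x ** y)" by (simp only: matrix_mul_assoc)
  finally show ?thesis using assms by (simp add: inverses_def)
qed

lemma inverses_cancel:
  fixes x y u :: "'d::division_ring ^ 'n ^ 'n"
  assumes "inverses x y" shows "x ** (y ** u) = u" "y ** (x ** u) = u"
  using assms by (simp_all add: inverses_def matrix_mul_assoc)

definition lprod :: "('d::division_ring ^ 'n ^ 'n) list \<Rightarrow> 'd ^ 'n ^ 'n" where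
  "lprod us = foldr (**) us (mat 1)"

lemma lprod_simps [simp]: "lprod [] = mat 1" "lprod (u # us) = u ** lprod us"
  by (simp_all add: lprod_def)

lemma lprod_append: "lprod (us @ vs) = lprod us ** lprod vs"
  by (induction us) (simp_all add: matrix_mul_assoc)

text \<open>The assumption identifies the cancellative elements of the order with its elements that
  are invertible as matrices; it is derived later from finite dimension.\<close>

locale regular_tiled_order = tiled_order val \<pi> U V lam z
  for val :: "'d::division_ring \<Rightarrow> int" and \<pi> :: 'd and U V :: "'d ^ 'n ^ 'n" and lam z +
  assumes regular: "\<lbrakk>x \<in> \<O>; \<And>y. y \<in> \<O> \<Longrightarrow> x ** y = 0 \<Longrightarrow> y = 0; \<And>y. y \<in> \<O> \<Longrightarrow> y ** x = 0 \<Longrightarrow> y = 0\<rbrakk>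
    \<Longrightarrow> \<exists>y. inverses x y"
begin

abbreviation T :: "('d ^ 'n ^ 'n) monoid" where "T \<equiv> cancellative_monoid R"

lemma T_simps: "monoid.mult T = (**)" "monoid.one T = mat 1"
  by (simp_all add: cancellative_monoid_def R_simps)

lemma mem_carrier_T: "x \<in> carrier T \<longleftrightarrow> x \<in> \<O> \<and>
    (\<forall>b\<in>\<O>. \<forall>c\<in>\<O>. (x ** b = x ** c \<longrightarrow> b = c) \<and> (b ** x = c ** x \<longrightarrow> b = c))"
  by (simp add: cancellative_monoid_def R_simps(1,2))

lemma carrier_T: "carrier T = {x \<in> \<O>. \<exists>y. inverses x y}"
proof (intro equalityI subsetI)
  fix x assume "x \<in> carrier T"
  then have x: "x \<in> \<O>" and c: "\<forall>b\<in>\<O>. \<forall>c\<in>\<O>. (x ** b = x ** c \<longrightarrow> b = c) \<and> (b ** x = c ** x \<longrightarrow> b = c)"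
    unfolding mem_carrier_T by blast+
  have "\<exists>y. inverses x y"
  proof (rule regular[OF x])
    fix y assume y: "y \<in> \<O>"
    have *: "(x ** y = x ** 0 \<longrightarrow> y = 0) \<and> (y ** x = 0 ** x \<longrightarrow> y = 0)" using c y \<O>_0 by blast
    show "x ** y = 0 \<Longrightarrow> y = 0" "y ** x = 0 \<Longrightarrow> y = 0" using * by simp_all
  qed
  then show "x \<in> {x \<in> \<O>. \<exists>y. inverses x y}" using x by blast
next
  fix x assume "x \<in> {x \<in> \<O>. \<exists>y. inverses x y}"
  then obtain y where x: "x \<in> \<O>" and y: "inverses x y" by blast
  have "b = c" if "x ** b = x ** c" for b c :: "'d ^ 'n ^ 'n"
  proof -
    have "y ** (x ** b) = y ** (x ** c)" by (simp only: that)
    then show ?thesis by (simp only: inverses_cancel(2)[OF y])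
  qed
  moreover have "b = c" if "b ** x = c ** x" for b c
  proof -
    have "(b ** x) ** y = (c ** x) ** y" by (simp only: that)
    then have "b ** (x ** y) = c ** (x ** y)" by (simp only: matrix_mul_assoc)
    then show ?thesis using y by (simp add: inverses_def)
  qed
  ultimately show "x \<in> carrier T" using x unfolding mem_carrier_T by blast
qed

lemma Units_T: "x \<in> Units T \<longleftrightarrow> x \<in> \<O> \<and> (\<exists>y\<in>\<O>. inverses x y)"
  using inverses_sym by (auto simp: Units_def carrier_T T_simps inverses_def)

lemma lprod_T: "set us \<subseteq> carrier T \<Longrightarrow> lprod us \<in> carrier T"
proof (induction us)
  case Nil
  show ?case by (simp add: carrier_T) (rule exI, rule inverses_1)
next
  case (Cons u us)
  then have "u \<in> carrier T" "lprod us \<in> carrier T" by auto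
  then show ?case using inverses_mult by (fastforce simp: carrier_T \<O>_mult)
qed

lemma mult_T: "x \<in> carrier T \<Longrightarrow> y \<in> carrier T \<Longrightarrow> x ** y \<in> carrier T"
  using lprod_T[of "[x, y]"] by simp

lemma ex_shifted: "\<exists>h::nat. shifted (int h) x"
proof -
  define g where "g p = (case p of (i, j) \<Rightarrow> nat (lam i j - val (ent x i j)))" for p
  have "vge (lam i j - int (\<Sum>p\<in>UNIV. g p)) (ent x i j)" for i j
  proof -
    have "g (i, j) \<le> (\<Sum>p\<in>UNIV. g p)" by (rule member_le_sum) auto
    then have "int (g (i, j)) \<le> int (\<Sum>p\<in>UNIV. g p)" by (simp only: of_nat_le_iff)
    moreover have "lam i j - val (ent x i j) \<le> int (g (i, j))" by (simp add: g_def)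
    ultimately have "lam i j - int (\<Sum>p\<in>UNIV. g p) \<le> val (ent x i j)" by linarith
    then show ?thesis unfolding vge_def by blast
  qed
  then show ?thesis unfolding shifted_def by blast
qed

subsection \<open>Lengths of chains of principal right ideals\<close>

text \<open>The leading exponents of a right ideal \<open>M\<close> in column \<open>j\<close>, relative to an enumeration of
  the rows; their sum plays the role of the length of \<open>\<O> / M\<close>.\<close>

definition leads :: "('d ^ 'n ^ 'n) set \<Rightarrow> 'n \<Rightarrow> 'n \<Rightarrow> nat \<Rightarrow> bool" where
  "leads M i j k \<longleftrightarrow> (\<exists>y\<in>M. (\<forall>a. to_nat a < to_nat i \<longrightarrow> ent y a j = 0) \<and>
     ent y i j \<noteq> 0 \<and> val (ent y i j) = lam i j + int k)"

definition lead :: "('d ^ 'n ^ 'n) set \<Rightarrow> 'n \<Rightarrow> 'n \<Rightarrow> nat" where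
  "lead M i j = (LEAST k. leads M i j k)"

definition colength :: "('d ^ 'n ^ 'n) set \<Rightarrow> nat" where
  "colength M = (\<Sum>(i, j)\<in>UNIV. lead M i j)"

definition pideal :: "'d ^ 'n ^ 'n \<Rightarrow> ('d ^ 'n ^ 'n) set" where
  "pideal x = {y. \<exists>r\<in>\<O>. y = x ** r}"

lemma shifted_in_pideal:
  assumes "inverses x c" "shifted h c" "shifted (- h) y" shows "y \<in> pideal x"
proof -
  have "c ** y \<in> \<O>" using shifted_mult[OF assms(2,3)] by simp
  moreover have "y = x ** (c ** y)" by (rule inverses_cancel(1)[OF assms(1), symmetric])
  ultimately show ?thesis unfolding pideal_def by blast
qed

text \<open>If h bounds the denominators of the inverse c, the right ideal generated by x contains
  \<pi>^h times the order, in particular a matrix with a single entry of valuation lam i j +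
  h.\<close>

lemma leads_pideal:
  assumes "inverses x c" "shifted (int h) c" shows "leads (pideal x) i j h"
proof -
  have "shifted (- int h) (E i j (\<pi> powi (lam i j + int h)))"
    by (simp add: shifted_def ent_E)
  from shifted_in_pideal[OF assms this] show ?thesis
    unfolding leads_def by (intro bexI[of _ "E i j (\<pi> powi (lam i j + int h))"]) (simp_all add: ent_E)
qed

lemma colength_le:
  assumes "inverses x c" "shifted (int h) c"
  shows "colength (pideal x) \<le> CARD('n) * CARD('n) * h"
proof -
  have "lead (pideal x) i j \<le> h" for i j
    unfolding lead_def by (rule Least_le) (rule leads_pideal[OF assms])
  then have "colength (pideal x) \<le> (\<Sum>p\<in>(UNIV :: ('n \<times> 'n) set). h)"
    unfolding colength_def by (intro sum_mono) auto
  then show ?thesis by simp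
qed

lemma leads_lead: "x \<in> carrier T \<Longrightarrow> leads (pideal x) i j (lead (pideal x) i j)"
proof -
  assume "x \<in> carrier T"
  then obtain c where c: "inverses x c" by (auto simp: carrier_T)
  obtain h where "shifted (int h) c" using ex_shifted by blast
  then have "leads (pideal x) i j h" using leads_pideal c by blast
  then show ?thesis unfolding lead_def by (rule LeastI)
qed

lemma pideal_subset: "x \<in> \<O> \<Longrightarrow> pideal x \<subseteq> \<O>"
  by (auto simp: pideal_def \<O>_mult)

lemma pideal_diff: "y \<in> pideal x \<Longrightarrow> y' \<in> pideal x \<Longrightarrow> y - y' \<in> pideal x"
  unfolding pideal_def using \<O>_diff mm_diff_right by (smt (verit, best) mem_Collect_eq)

lemma pideal_add: assumes "y \<in> pideal x" "y' \<in> pideal x" shows "y + y' \<in> pideal x"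
proof -
  have "y - ((y - y) - y') \<in> pideal x" using assms pideal_diff by blast
  then show ?thesis by simp
qed

lemma pideal_mult: "y \<in> pideal x \<Longrightarrow> r \<in> \<O> \<Longrightarrow> y ** r \<in> pideal x"
  unfolding pideal_def using \<O>_mult by (auto simp: matrix_mul_assoc[symmetric])

lemma pideal_self: "x \<in> pideal x"
  unfolding pideal_def by (intro CollectI bexI[of _ "mat 1"]) simp_all

lemma pideal_subset_iff: "pideal y \<subseteq> pideal x \<longleftrightarrow> y \<in> pideal x"
proof
  show "pideal y \<subseteq> pideal x \<Longrightarrow> y \<in> pideal x" using pideal_self by blast
  show "y \<in> pideal x \<Longrightarrow> pideal y \<subseteq> pideal x" using pideal_mult by (auto simp: pideal_def[of y])
qed

lemma lead_mono:
  assumes "x \<in> carrier T" "y \<in> pideal x" "y \<in> carrier T"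
  shows "lead (pideal x) i j \<le> lead (pideal y) i j"
proof -
  have "leads (pideal y) i j (lead (pideal y) i j)" by (rule leads_lead[OF assms(3)])
  then have "leads (pideal x) i j (lead (pideal y) i j)"
    using pideal_subset_iff assms(2) unfolding leads_def by blast
  then show ?thesis unfolding lead_def by (rule Least_le)
qed

text \<open>Gaussian elimination in each column: as the leading exponents agree, the leading entry
  of an element of \<open>pideal x\<close> is cancelled by an element of \<open>pideal y\<close>,
  and past the last row nothing remains.\<close>

lemma pideal_eq_of_lead_eq:
  assumes x: "x \<in> carrier T" and y: "y \<in> pideal x" "y \<in> carrier T"
    and eq: "\<And>i j. lead (pideal y) i j = lead (pideal x) i j"
  shows "x \<in> pideal y"
proof -
  have xO: "x \<in> \<O>" using x by (simp add: carrier_T)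
  \<comment> \<open>Rows with label below n are already cleared, and m counts down. The sum of all
    labels bounds each of them, so at m = 0 every row is cleared.\<close>
  have col: "u \<in> pideal y" if "u \<in> pideal x" "\<And>a b. b \<noteq> j \<Longrightarrow> ent u a b = 0"
    "\<And>a. to_nat a < n \<Longrightarrow> ent u a j = 0" "m + n = Suc (\<Sum>a\<in>UNIV. to_nat (a :: 'n))" for u j n m
    using that
  proof (induction m arbitrary: u n)
    case 0
    have "ent u a b = 0" for a b
    proof (cases "b = j")
      case True
      have "to_nat a \<le> (\<Sum>a\<in>UNIV. to_nat (a :: 'n))" by (rule member_le_sum) auto
      then have "to_nat a < n" using 0(4) by linarith
      then show ?thesis using 0(3) True by blast
    next
      case False
      then show ?thesis using 0(2) by blast
    qed
    then have "u = y ** 0" by (intro ent_eqI) simp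
    then show ?case unfolding pideal_def using \<O>_0 by blast
  next
    case (Suc m)
    have step: ?case if "\<And>a. to_nat a < Suc n \<Longrightarrow> ent u a j = 0"
      by (rule Suc.IH[of u "Suc n"]) (use Suc.prems that in auto)
    show ?case
    proof (cases "\<exists>i. to_nat i = n \<and> ent u i j \<noteq> 0")
      case False
      then show ?thesis using Suc.prems(3) by (intro step) (metis less_antisym)
    next
      case True
      then obtain i where i: "to_nat i = n" "ent u i j \<noteq> 0" by blast
      have "vge (lam i j) (ent u i j)"
        using Suc.prems(1) pideal_subset[OF xO] by (auto simp: in_\<O>)
      then have val: "lam i j \<le> val (ent u i j)" using i(2) by (simp add: vge_def)
      define k where "k = nat (val (ent u i j) - lam i j)"
      have k: "val (ent u i j) = lam i j + int k" using val by (simp add: k_def)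
      have "leads (pideal x) i j k"
        unfolding leads_def by (rule bexI[OF _ Suc.prems(1)]) (use Suc.prems(3) i k in auto)
      then have "lead (pideal x) i j \<le> k" unfolding lead_def by (rule Least_le)
      then have le: "lead (pideal y) i j \<le> k" by (simp only: eq)
      obtain v where v: "v \<in> pideal y" "\<forall>a. to_nat a < to_nat i \<longrightarrow> ent v a j = 0" "ent v i j \<noteq> 0"
        "val (ent v i j) = lam i j + int (lead (pideal y) i j)"
        using leads_lead[OF y(2), of i j] unfolding leads_def by blast
      define s where "s = inverse (ent v i j) * ent u i j"
      have "vge 0 s" using le v(3,4) i(2) k by (simp add: s_def vge_def val_mult val_inverse)
      then have sO: "E j j s \<in> \<O>" by (intro E_in_\<O>) simp
      have vs: "v ** E j j s \<in> pideal y" by (rule pideal_mult[OF v(1) sO])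
      then have vx: "v ** E j j s \<in> pideal x" using pideal_subset_iff y(1) by blast
      have sv: "ent v i j * s = ent u i j" using v(3) by (simp add: s_def flip: mult.assoc)
      have "u - v ** E j j s \<in> pideal y"
      proof (rule Suc.IH[of _ "Suc n"])
        show "u - v ** E j j s \<in> pideal x" by (rule pideal_diff[OF Suc.prems(1) vx])
        show "ent (u - v ** E j j s) a b = 0" if "b \<noteq> j" for a b
          using Suc.prems(2) that by (simp add: ent_mult_E)
        show "ent (u - v ** E j j s) a j = 0" if a: "to_nat a < Suc n" for a
        proof (cases "to_nat a = n")
          case True
          then have "a = i" using i(1) by (metis from_nat_to_nat)
          then show ?thesis using sv by (simp add: ent_mult_E)
        next
          case False
          then have "to_nat a < n" using a by simp
          then show ?thesis using Suc.prems(3) v(2) i(1) by (simp add: ent_mult_E)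
        qed
        show "m + Suc n = Suc (\<Sum>a\<in>UNIV. to_nat (a :: 'n))" using Suc.prems(4) by simp
      qed
      then have "(u - v ** E j j s) + v ** E j j s \<in> pideal y" using vs by (rule pideal_add)
      then show ?thesis by (simp only: diff_add_cancel)
    qed
  qed
  have Ej: "x ** E j j 1 \<in> pideal y" for j
  proof (rule col[of _ j 0])
    show "x ** E j j 1 \<in> pideal x" by (rule pideal_mult[OF pideal_self]) simp
  qed (simp_all add: ent_mult_E)
  have sum_in: "sum f A \<in> pideal y" if "\<And>a. a \<in> A \<Longrightarrow> f a \<in> pideal y" for f and A :: "'n set"
    using finite[of A] that
  proof (induction A rule: finite_induct)
    case empty
    show ?case using pideal_diff[OF pideal_self pideal_self] by simp
  next
    case (insert a A)
    then have "f a \<in> pideal y" "sum f A \<in> pideal y" by simp_all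
    then have "f a + sum f A \<in> pideal y" by (rule pideal_add)
    then show ?case using insert.hyps by simp
  qed
  have "(\<Sum>j\<in>UNIV. x ** E j j 1) \<in> pideal y" by (rule sum_in) (rule Ej)
  moreover have "(\<Sum>j\<in>UNIV. x ** E j j 1) = x"
    by (rule ent_eqI) (simp add: ent_sum ent_mult_E)
  ultimately show ?thesis by simp
qed

text \<open>If all leading exponents agreed, x would lie in \<open>pideal (x ** u)\<close>, and
  cancelling x would give an inverse of u in the order.\<close>

lemma colength_less:
  assumes x: "x \<in> carrier T" and u: "u \<in> carrier T" "u \<notin> Units T"
  shows "colength (pideal x) < colength (pideal (x ** u))"
proof -
  have xu: "x ** u \<in> pideal x" "x ** u \<in> carrier T"
    using u mult_T[OF x u(1)] by (auto simp: pideal_def carrier_T)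
  have mono: "lead (pideal x) i j \<le> lead (pideal (x ** u)) i j" for i j
    by (rule lead_mono[OF x xu])
  have "\<exists>i j. lead (pideal (x ** u)) i j \<noteq> lead (pideal x) i j"
  proof (rule ccontr)
    assume "\<not> ?thesis"
    then have "x \<in> pideal (x ** u)" using pideal_eq_of_lead_eq[OF x xu] by blast
    then obtain r where r: "r \<in> \<O>" "x = x ** u ** r" by (auto simp: pideal_def)
    obtain c where c: "inverses x c" using x by (auto simp: carrier_T)
    obtain d where d: "inverses u d" using u by (auto simp: carrier_T)
    have "x ** (u ** r) = x ** mat 1" using r(2) by (simp add: matrix_mul_assoc)
    then have "u ** r = mat 1" using inverses_cancel(2)[OF c, of "u ** r"] inverses_cancel(2)[OF c, of "mat 1"] by simp
    then have "r = d" using inverses_cancel(2)[OF d, of r] by simp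
    then show False using u r(1) d Units_T by (auto simp: carrier_T)
  qed
  then obtain i j where "lead (pideal (x ** u)) i j \<noteq> lead (pideal x) i j" by blast
  then have "lead (pideal x) i j < lead (pideal (x ** u)) i j" using mono[of i j] by simp
  then show ?thesis unfolding colength_def
    by (intro sum_strict_mono_ex1) (use mono in auto)
qed

lemma length_le_colength:
  assumes "x \<in> carrier T" "set us \<subseteq> carrier T - Units T"
  shows "colength (pideal x) + length us \<le> colength (pideal (x ** lprod us))"
  using assms
proof (induction us arbitrary: x)
  case (Cons u us)
  then have "colength (pideal (x ** u)) + length us \<le> colength (pideal ((x ** u) ** lprod us))"
    by (intro Cons.IH mult_T) auto
  moreover have "colength (pideal x) < colength (pideal (x ** u))"
    by (rule colength_less) (use Cons.prems in auto)
  ultimately show ?case by (simp add: matrix_mul_assoc)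
qed simp

lemma length_bound:
  assumes "set us \<subseteq> carrier T - Units T" "inverses (lprod us) c" "shifted (int h) c"
  shows "length us \<le> CARD('n) * CARD('n) * h"
proof -
  have "mat 1 \<in> carrier T" using lprod_T[of "[]"] by simp
  from length_le_colength[OF this assms(1)] colength_le[OF assms(2,3)] show ?thesis by simp
qed

lemma length_set_T:
  "length_set T a = {k. \<exists>\<epsilon>\<in>Units T. \<exists>us. length us = k \<and> set us \<subseteq> atoms T \<and> a = \<epsilon> ** lprod us}"
  by (simp add: length_set_def T_simps lprod_def)

lemma atoms_subset: "atoms T \<subseteq> carrier T - Units T"
  by (auto simp: atoms_def)

subsection \<open>Finite elasticity\<close>

text \<open>Otherwise an entry s of least weight in c, at (i, j), has weight below -n. Row i of c
  divided by s has the valuations of a row j of the order, and it gives a nonunit d of the order,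
  with an inverse d' of denominators at most \<pi>, such that a = d' ** u is still in the order.
  Since u = d ** a is an atom, a is a unit, and c = (c ** d) ** d' has denominators at most \<pi>
  after all.\<close>

lemma atom_inverse_shifted:
  assumes H: "\<And>i j. lam i j + lam j i \<le> 1" and u: "u \<in> atoms T" and c: "inverses u c"
  shows "shifted 1 c"
proof (rule ccontr)
  assume "\<not> shifted 1 c"
  then obtain i0 j0 where ij0: "\<not> vge (lam i0 j0 - 1) (ent c i0 j0)" by (auto simp: shifted_def)
  define P where "P = {(i, j). ent c i j \<noteq> 0}"
  have finP: "finite P" by simp
  have P0: "(i0, j0) \<in> P" using ij0 by (auto simp: P_def vge_def)
  define wt where "wt p = (case p of (i, j) \<Rightarrow> weight i j (ent c i j))" for p
  have "Min (wt ` P) \<in> wt ` P" using finP P0 by (intro Min_in) auto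
  then obtain i j where ij: "(i, j) \<in> P" "wt (i, j) = Min (wt ` P)" by auto
  have min: "weight i j (ent c i j) \<le> weight a b (ent c a b)" if "ent c a b \<noteq> 0" for a b
  proof -
    have "Min (wt ` P) \<le> wt (a, b)" using that finP by (intro Min_le) (auto simp: P_def)
    then show ?thesis using ij(2) by (simp add: wt_def)
  qed
  define s where "s = ent c i j"
  have s: "s \<noteq> 0" using ij(1) by (simp add: s_def P_def)
  define n where "n = int CARD('n)"
  \<comment> \<open>The valuation is at most lam i0 j0 - 2, and the rounding error in the weight is
    less than n, which leaves less than -n.\<close>
  have "weight i0 j0 (ent c i0 j0) < - n"
  proof -
    have "n * val (ent c i0 j0) \<le> n * (lam i0 j0 - 2)"
      using ij0 by (intro mult_left_mono) (auto simp: vge_def n_def)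
    moreover have "n * (lam i0 j0 - 1) < lam_sum i0 - lam_sum j0"
      unfolding n_def by (rule lam_sum_diff(2)[OF H])
    ultimately show ?thesis unfolding weight_def n_def[symmetric] by (simp add: algebra_simps)
  qed
  then have ws: "weight i j s < - n" using min[of i0 j0] P0 by (simp add: s_def P_def)
  define f where "f l = inverse s * ent c i l" for l
  have fj: "f j = 1" using s by (simp add: f_def s_def)
  have f: "vge (lam j l) (f l)" for l
  proof (cases "ent c i l = 0")
    case False
    have "weight j l (f l) = weight i l (ent c i l) - weight i j s"
      unfolding f_def using weight_mult[of "inverse s" "ent c i l" j l i] s False weight_inverse[OF s] by simp
    then have "0 \<le> weight j l (f l)" using min[OF False] by (simp add: s_def)
    then show ?thesis using vge_iff_weight[OF H] s False by (simp add: f_def)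
  qed (simp add: f_def)
  \<comment> \<open>A rank one matrix supported in row j. As f j = 1, the matrix F 1 is idempotent,
    and \<open>mat 1 + F (\<pi> - 1)\<close> acts as \<pi> on its image and as the identity on its
    kernel.\<close>
  define F where "F \<alpha> = mk (\<lambda>a l. if a = j then \<alpha> * f l else 0)" for \<alpha>
  have FF: "F \<alpha> ** F \<beta> = F (\<alpha> * \<beta>)" for \<alpha> \<beta>
  proof (rule ent_eqI)
    fix a b
    have "ent (F \<alpha> ** F \<beta>) a b = (\<Sum>k\<in>UNIV. if k = j then (if a = j then \<alpha> * f j * (\<beta> * f b) else 0) else 0)"
      unfolding ent_mult by (rule sum.cong) (auto simp: F_def)
    then show "ent (F \<alpha> ** F \<beta>) a b = ent (F (\<alpha> * \<beta>)) a b" by (simp add: F_def fj mult.assoc)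
  qed
  have Fadd: "F \<alpha> + F \<beta> = F (\<alpha> + \<beta>)" for \<alpha> \<beta>
    by (rule ent_eqI) (simp add: F_def distrib_right)
  have F0: "F 0 = 0" by (rule ent_eqI) (simp add: F_def)
  have inv: "(mat 1 + F \<alpha>) ** (mat 1 + F \<beta>) = mat 1" if "(1 + \<alpha>) * (1 + \<beta>) = 1" for \<alpha> \<beta>
  proof -
    have "(mat 1 + F \<alpha>) ** (mat 1 + F \<beta>) = mat 1 + (F \<alpha> + F \<beta> + F \<alpha> ** F \<beta>)"
      by (simp add: mm_add_left matrix_add_ldistrib)
    also have "F \<alpha> + F \<beta> + F \<alpha> ** F \<beta> = F (\<alpha> + \<beta> + \<alpha> * \<beta>)" by (simp add: FF Fadd)
    also have "\<alpha> + \<beta> + \<alpha> * \<beta> = 0" using that by (simp add: algebra_simps)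
    finally show ?thesis by (simp add: F0)
  qed
  define d where "d = mat 1 + F (\<pi> - 1)"
  define d' where "d' = mat 1 + F (inverse \<pi> - 1)"
  have dd: "inverses d d'" unfolding inverses_def d_def d'_def by (intro conjI inv) simp_all
  have "vge 0 (\<pi> - 1)" by (rule vge_diff) (simp_all add: vge_def)
  then have dO: "d \<in> \<O>"
    unfolding d_def by (intro \<O>_add \<O>_1) (auto simp: in_\<O> F_def intro!: vge_mult[OF _ f])
  have vm: "vge (-1) (inverse \<pi> - 1)" by (rule vge_diff) (simp_all add: vge_def val_inverse)
  have d's: "shifted 1 d'"
    unfolding shifted_def d'_def
  proof (intro allI)
    fix a b
    have "vge (lam a b - 1) (ent (mat 1) a b)" by (simp add: ent_1)
    moreover have "vge (lam a b - 1) (ent (F (inverse \<pi> - 1)) a b)"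
      using vge_mult[OF vm f, of b "lam j b - 1"] by (simp add: F_def)
    ultimately show "vge (lam a b - 1) (ent (mat 1 + F (inverse \<pi> - 1)) a b)"
      unfolding ent_add by (rule vge_add)
  qed
  have "ent d' j j = inverse \<pi>" by (simp add: d'_def ent_1 F_def fj)
  then have d'O: "d' \<notin> \<O>" by (auto simp: in_\<O> vge_def val_inverse intro!: exI[of _ j])
  define a where "a = d' ** u"
  have uT: "u \<in> carrier T" and uO: "u \<in> \<O>" using u by (auto simp: atoms_def carrier_T)
  \<comment> \<open>Row i of c times u is row i of the identity, so d' ** u differs from u in at
    most one entry.\<close>
  have Fu: "F (inverse \<pi> - 1) ** u = E j i ((inverse \<pi> - 1) * inverse s)"
  proof (rule ent_eqI)
    fix p q
    have "ent (F (inverse \<pi> - 1) ** u) p q =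
        (if p = j then (inverse \<pi> - 1) * (inverse s * (\<Sum>k\<in>UNIV. ent c i k * ent u k q)) else 0)"
      unfolding ent_mult by (simp add: F_def f_def sum_distrib_left mult.assoc)
    also have "(\<Sum>k\<in>UNIV. ent c i k * ent u k q) = (if i = q then 1 else 0)"
      using c by (simp add: inverses_def ent_1 flip: ent_mult)
    finally show "ent (F (inverse \<pi> - 1) ** u) p q = ent (E j i ((inverse \<pi> - 1) * inverse s)) p q"
      by (auto simp: ent_E)
  qed
  have "vge (lam j i) ((inverse \<pi> - 1) * inverse s)"
  proof (cases "inverse \<pi> - 1 = 0")
    case False
    have "weight j i ((inverse \<pi> - 1) * inverse s) = n * val (inverse \<pi> - 1) - weight i j s"
    proof -
      have "val ((inverse \<pi> - 1) * inverse s) = val (inverse \<pi> - 1) - val s"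
        using val_mult[OF False nonzero_imp_inverse_nonzero[OF s]] unfolding val_inverse[OF s] by linarith
      then show ?thesis unfolding weight_def n_def by (simp only: right_diff_distrib)
    qed
    moreover have "n * (- 1) \<le> n * val (inverse \<pi> - 1)"
      using vm False by (intro mult_left_mono) (auto simp: vge_def n_def)
    ultimately have "0 \<le> weight j i ((inverse \<pi> - 1) * inverse s)" using ws by linarith
    then show ?thesis using vge_iff_weight[OF H] s False by simp
  next
    case True
    then show ?thesis by (simp only: mult_zero_left vge_0)
  qed
  then have aO: "a \<in> \<O>"
    unfolding a_def d'_def mm_add_left Fu using uO by (auto intro: \<O>_add E_in_\<O>)
  have ac: "inverses a (c ** d)" unfolding a_def by (rule inverses_mult[OF inverses_sym[OF dd] c])
  have "u = d ** a" unfolding a_def by (rule inverses_cancel(1)[OF dd, symmetric])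
  moreover have "a \<in> carrier T" "d \<in> carrier T" using aO dO ac dd by (auto simp: carrier_T)
  moreover have "d \<notin> Units T" using d'O dd inverses_unique by (auto simp: Units_T)
  ultimately have "a \<in> Units T" using u by (auto simp: atoms_def T_simps)
  then have "c ** d \<in> \<O>" using ac inverses_unique by (auto simp: Units_T)
  then have "shifted (0 + 1) ((c ** d) ** d')" by (intro shifted_mult d's) simp
  moreover have "(c ** d) ** d' = c" using dd by (simp add: inverses_def flip: matrix_mul_assoc)
  ultimately show False using \<open>\<not> shifted 1 c\<close> by simp
qed

lemma lprod_atoms_inverse:
  assumes H: "\<And>i j. lam i j + lam j i \<le> 1" and "set us \<subseteq> atoms T"
  shows "\<exists>c. inverses (lprod us) c \<and> shifted (int (length us)) c"
  using assms(2)
proof (induction us)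
  case Nil
  show ?case by (intro exI[of _ "mat 1"]) simp
next
  case (Cons u us)
  then obtain c where c: "inverses (lprod us) c" "shifted (int (length us)) c" by auto
  obtain d where d: "inverses u d" using Cons.prems by (auto simp: atoms_def carrier_T)
  have "shifted 1 d" by (rule atom_inverse_shifted[OF H _ d]) (use Cons.prems in auto)
  then have "shifted (int (length us) + 1) (c ** d)" by (rule shifted_mult[OF c(2)])
  moreover have "inverses (lprod (u # us)) (c ** d)" using inverses_mult[OF d c(1)] by simp
  ultimately show ?case by (intro exI[of _ "c ** d"]) (simp add: add.commute)
qed

text \<open>Each of the k atoms contributes a denominator of at most \<pi> to the inverse, so the
  colength is at most n^2 k, while l nonunit factors force it to be at least l.\<close>

lemma length_ratio:
  assumes H: "\<And>i j. lam i j + lam j i \<le> 1" and kl: "k \<in> length_set T a" "l \<in> length_set T a"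
  shows "l \<le> CARD('n) * CARD('n) * k"
proof -
  obtain \<epsilon> us where us: "\<epsilon> \<in> Units T" "length us = k" "set us \<subseteq> atoms T" "a = \<epsilon> ** lprod us"
    using kl(1) by (auto simp: length_set_T)
  obtain \<eta> vs where vs: "\<eta> \<in> Units T" "length vs = l" "set vs \<subseteq> atoms T" "a = \<eta> ** lprod vs"
    using kl(2) by (auto simp: length_set_T)
  obtain c where c: "inverses (lprod us) c" "shifted (int k) c"
    using lprod_atoms_inverse[OF H us(3)] us(2) by blast
  obtain \<epsilon>' where \<epsilon>: "inverses \<epsilon> \<epsilon>'" "\<epsilon>' \<in> \<O>" using us(1) by (auto simp: Units_T)
  obtain \<eta>' where \<eta>: "inverses \<eta> \<eta>'" "\<eta> \<in> \<O>" using vs(1) by (auto simp: Units_T)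
  have "lprod vs = \<eta>' ** (\<epsilon> ** lprod us)"
    using inverses_cancel(2)[OF \<eta>(1), of "lprod vs"] us(4) vs(4) by simp
  then have "inverses (lprod vs) ((c ** \<epsilon>') ** \<eta>)"
    using inverses_mult[OF inverses_sym[OF \<eta>(1)] inverses_mult[OF \<epsilon>(1) c(1)]] by simp
  moreover have "shifted (int k + 0 + 0) ((c ** \<epsilon>') ** \<eta>)"
    by (intro shifted_mult c(2)) (simp_all add: \<epsilon> \<eta>)
  ultimately show ?thesis using length_bound[of vs _ k] vs(2,3) atoms_subset by auto
qed

lemma finite_elasticity:
  assumes H: "\<And>i j. lam i j + lam j i \<le> 1"
  shows "elasticity T < \<infinity>"
proof -
  let ?C = "of_nat (CARD('n) * CARD('n)) :: ennreal"
  have C1: "1 \<le> CARD('n) * CARD('n)" by simp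
  have "element_elasticity T a \<le> ?C" for a
  proof (cases "a \<in> Units T \<or> length_set T a = {}")
    case True
    have "(1::ennreal) \<le> ?C" using C1 by (metis of_nat_1 of_nat_mono)
    \<comment> \<open>Without factorizations the supremum is 0, and so is the quotient.\<close>
    moreover have "element_elasticity T a \<le> 1" using True by (auto simp: element_elasticity_def bot_ennreal)
    ultimately show ?thesis by (rule order_trans[rotated])
  next
    case False
    define k where "k = Inf (length_set T a)"
    have k: "k \<in> length_set T a" unfolding k_def using False by (intro Inf_nat_def1) simp
    have k0: "k \<noteq> 0"
    proof
      assume "k = 0"
      then have "a \<in> Units T" using k by (auto simp: length_set_T)
      then show False using False by simp
    qed
    have "(SUP l\<in>length_set T a. of_nat l :: ennreal) \<le> ?C * of_nat k"
    proof (rule SUP_least)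
      fix l assume "l \<in> length_set T a"
      then have "l \<le> CARD('n) * CARD('n) * k" by (rule length_ratio[OF H k])
      then show "of_nat l \<le> ?C * of_nat k" by (metis of_nat_mult of_nat_mono)
    qed
    then have "(SUP l\<in>length_set T a. of_nat l) / of_nat k \<le> (?C * of_nat k) / of_nat k"
      by (rule divide_right_mono_ennreal)
    also have "\<dots> = ?C" using k0 by (simp add: ennreal_mult_divide_eq)
    finally show ?thesis using False by (simp add: element_elasticity_def k_def)
  qed
  then have "elasticity T \<le> ?C" unfolding elasticity_def by (rule SUP_least)
  also have "\<dots> < \<infinity>" unfolding infinity_ennreal_def by (rule of_nat_less_top)
  finally show ?thesis .
qed

end

section \<open>Factorizations in non-hereditary tiled orders\<close>

context regular_tiled_order
begin

lemma inverse_nonmember: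
  assumes "inverses x y" "y \<notin> \<O>" shows "x \<notin> Units T"
  using assms inverses_unique by (auto simp: Units_T)

lemma Units_mult:
  assumes "x \<in> Units T" "y \<in> Units T" shows "x ** y \<in> Units T"
proof -
  obtain x' y' where "inverses x x'" "x' \<in> \<O>" "inverses y y'" "y' \<in> \<O>"
    using assms by (auto simp: Units_T)
  then show ?thesis using inverses_mult[of x x' y y'] assms \<O>_mult by (auto simp: Units_T)
qed

text \<open>Induction on a bound for the lengths of factorizations into nonunits: if x = b ** c,
  then prolonging a factorization of one factor by the other shows that both have a smaller
  bound.\<close>

lemma factor_into_atoms_aux:
  assumes "x \<in> carrier T" "x \<notin> Units T"
    and "\<And>us. set us \<subseteq> carrier T - Units T \<Longrightarrow> lprod us = x \<Longrightarrow> length us \<le> m"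
  shows "\<exists>us. us \<noteq> [] \<and> set us \<subseteq> atoms T \<and> lprod us = x"
  using assms
proof (induction m arbitrary: x)
  case 0
  then show ?case using 0(3)[of "[x]"] by simp
next
  case (Suc m)
  show ?case
  proof (cases "x \<in> atoms T")
    case True
    then show ?thesis by (intro exI[of _ "[x]"]) simp
  next
    case False
    then obtain b c where bc: "b \<in> carrier T - Units T" "c \<in> carrier T - Units T" "x = b ** c"
      using Suc.prems(1,2) by (auto simp: atoms_def T_simps)
    have "length us \<le> m" if "set us \<subseteq> carrier T - Units T" "lprod us = b" for us
      using Suc.prems(3)[of "us @ [c]"] that bc by (simp add: lprod_append)
    then obtain us where us: "us \<noteq> [] \<and> set us \<subseteq> atoms T \<and> lprod us = b"
      using Suc.IH[of b] bc(1) by blast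
    have "length vs \<le> m" if "set vs \<subseteq> carrier T - Units T" "lprod vs = c" for vs
      using Suc.prems(3)[of "b # vs"] that bc by simp
    then obtain vs where vs: "vs \<noteq> [] \<and> set vs \<subseteq> atoms T \<and> lprod vs = c"
      using Suc.IH[of c] bc(2) by blast
    show ?thesis by (rule exI[of _ "us @ vs"]) (use us vs bc(3) in \<open>simp add: lprod_append\<close>)
  qed
qed

lemma factor_into_atoms:
  assumes "x \<in> carrier T" "x \<notin> Units T"
  shows "\<exists>us. us \<noteq> [] \<and> set us \<subseteq> atoms T \<and> lprod us = x"
proof -
  obtain c where c: "inverses x c" using assms(1) by (auto simp: carrier_T)
  obtain h where h: "shifted (int h) c" using ex_shifted by blast
  show ?thesis
    by (rule factor_into_atoms_aux[OF assms, of "CARD('n) * CARD('n) * h"])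
      (use length_bound[OF _ _ h] c in blast)
qed

lemma lprod_into_atoms:
  assumes "set xs \<subseteq> carrier T - Units T"
  shows "\<exists>us. length xs \<le> length us \<and> set us \<subseteq> atoms T \<and> lprod us = lprod xs"
  using assms
proof (induction xs)
  case (Cons x xs)
  then obtain us where us: "length xs \<le> length us" "set us \<subseteq> atoms T" "lprod us = lprod xs" by auto
  obtain vs where vs: "vs \<noteq> []" "set vs \<subseteq> atoms T" "lprod vs = x"
    using factor_into_atoms[of x] Cons.prems by auto
  have "1 \<le> length vs" using vs(1) by (cases vs) auto
  then show ?case using us vs by (intro exI[of _ "vs @ us"]) (auto simp: lprod_append)
next
  case Nil
  show ?case by (rule exI[of _ "[]"]) simp
qed

subsection \<open>Splitting off identity rows and columns\<close>

text \<open>In coordinates, row and column k are those of the identity, as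
  \<open>fixes_unit_ent\<close> shows. Stated with idempotents, the condition visibly passes to
  products.\<close>

definition fixes_unit :: "'n \<Rightarrow> 'd ^ 'n ^ 'n \<Rightarrow> bool" where
  "fixes_unit k x \<longleftrightarrow> E k k 1 ** x = E k k 1 \<and> x ** E k k 1 = E k k 1"

lemma E_E: "E a b s ** E c d u = (if b = c then E a d (s * u) else 0)"
  by (rule ent_eqI) (auto simp: ent_E_mult ent_E)

lemma fixes_unit_mult:
  assumes "fixes_unit k x" "fixes_unit k y" shows "fixes_unit k (x ** y)"
proof -
  have "E k k 1 ** (x ** y) = (E k k 1 ** x) ** y" "(x ** y) ** E k k 1 = x ** (y ** E k k 1)"
    by (simp_all only: matrix_mul_assoc)
  then show ?thesis using assms by (simp add: fixes_unit_def)
qed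

lemma fixes_unit_ent:
  assumes "fixes_unit k x"
  shows "ent x k b = (if b = k then 1 else 0)" "ent x a k = (if a = k then 1 else 0)"
proof -
  have "ent (E k k 1 ** x) k b = ent (E k k 1) k b" "ent (x ** E k k 1) a k = ent (E k k 1) a k"
    using assms by (simp_all add: fixes_unit_def)
  then show "ent x k b = (if b = k then 1 else 0)" "ent x a k = (if a = k then 1 else 0)"
    by (simp_all add: ent_E_mult ent_mult_E ent_E)
qed

lemma fixes_unit_1: "fixes_unit k (mat 1)"
  by (simp add: fixes_unit_def)

text \<open>Row k of b times column k of c is 1, so some term of this sum, with index l, has
  valuation at most 0; this forces val (ent b k l) = - lam l k. If the pivot is a nonunit, adding
  \<pi>^(lam l k) times column l to column k makes it a unit. An index m different from k that b
  already fixes cannot be l.\<close>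

lemma ex_pivot:
  assumes b: "b \<in> \<O>" and c: "c \<in> \<O>" and a: "fixes_unit k (b ** c)"
  shows "\<exists>g g'. g \<in> \<O> \<and> g' \<in> \<O> \<and> inverses g g' \<and> ent (b ** g) k k \<noteq> 0 \<and> val (ent (b ** g) k k) = 0 \<and>
    (\<forall>m. m \<noteq> k \<longrightarrow> fixes_unit m b \<longrightarrow> fixes_unit m g \<and> fixes_unit m g')"
proof (cases "vge 1 (ent b k k)")
  case False
  have "vge (lam k k) (ent b k k)" using b unfolding in_\<O> by blast
  then have "vge 0 (ent b k k)" by simp
  then have "ent b k k \<noteq> 0 \<and> val (ent b k k) = 0" using vge_exactD[of 0] False by simp
  then show ?thesis
    by (intro exI[of _ "mat 1"]) (simp add: fixes_unit_1)
next
  case True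
  have "(\<Sum>l\<in>UNIV. ent b k l * ent c l k) = 1"
    using fixes_unit_ent(1)[OF a, of k] by (simp add: ent_mult)
  then have not1: "\<not> vge 1 (\<Sum>l\<in>UNIV. ent b k l * ent c l k)" by simp
  have "\<exists>l. \<not> vge 1 (ent b k l * ent c l k)"
  proof (rule ccontr)
    assume "\<not> ?thesis"
    then have "vge 1 (ent b k l * ent c l k)" for l by blast
    then have "vge 1 (\<Sum>l\<in>UNIV. ent b k l * ent c l k)" by (rule vge_sum)
    then show False using not1 by (rule notE[rotated])
  qed
  then obtain l where l: "\<not> vge 1 (ent b k l * ent c l k)" by blast
  have nz: "ent b k l \<noteq> 0" "ent c l k \<noteq> 0" using l by (auto simp: vge_def)
  have "vge (lam k l) (ent b k l)" "vge (lam l k) (ent c l k)" using b c unfolding in_\<O> by blast+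
  then have vb: "lam k l \<le> val (ent b k l)" and vc: "lam l k \<le> val (ent c l k)"
    using nz by (simp_all add: vge_def)
  have "val (ent b k l) + val (ent c l k) \<le> 0" using l nz by (simp add: vge_def val_mult)
  moreover have "0 \<le> lam k l + lam l k" using lam_triangle[of k k l] by simp
  ultimately have v: "val (ent b k l) = - lam l k" using vb vc by linarith
  have lk: "l \<noteq> k"
  proof
    assume "l = k"
    then show False using True v nz(1) by (simp add: vge_def)
  qed
  define e where "e = E l k (\<pi> powi (lam l k))"
  have eO: "e \<in> \<O>" unfolding e_def by (rule E_in_\<O>) simp
  have ee: "e ** e = 0" unfolding e_def using lk by (simp add: E_E)
  have inv: "inverses (mat 1 + e) (mat 1 - e)"
    by (simp add: inverses_def mm_add_left mm_diff_left mm_diff_right matrix_add_ldistrib ee)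
  have "ent (b ** (mat 1 + e)) k k = ent b k k + ent b k l * \<pi> powi (lam l k)"
    by (simp add: matrix_add_ldistrib e_def ent_mult_E)
  moreover have "\<not> vge 1 (ent b k k + ent b k l * \<pi> powi (lam l k))"
  proof
    assume "vge 1 (ent b k k + ent b k l * \<pi> powi (lam l k))"
    from vge_diff[OF this True] have "vge 1 (ent b k l * \<pi> powi (lam l k))" by simp
    then show False using nz v by (simp add: vge_def val_mult)
  qed
  moreover have "vge 0 (ent (b ** (mat 1 + e)) k k)"
  proof -
    have "vge (lam k k) (ent (b ** (mat 1 + e)) k k)"
      using \<O>_mult[OF b \<O>_add[OF \<O>_1 eO]] unfolding in_\<O> by blast
    then show ?thesis by (simp only: lam_diag)
  qed
  ultimately have unit: "ent (b ** (mat 1 + e)) k k \<noteq> 0 \<and> val (ent (b ** (mat 1 + e)) k k) = 0"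
    using vge_exactD[of 0] by simp
  have "fixes_unit m (mat 1 + e) \<and> fixes_unit m (mat 1 - e)" if m: "m \<noteq> k" "fixes_unit m b" for m
  proof -
    have "m \<noteq> l" using fixes_unit_ent(2)[OF m(2), of k] m(1) nz(1) by auto
    then show ?thesis using m(1)
      by (auto simp: fixes_unit_def mm_add_left mm_diff_left mm_diff_right matrix_add_ldistrib e_def E_E)
  qed
  then show ?thesis
    by (intro exI[of _ "mat 1 + e"] exI[of _ "mat 1 - e"] conjI allI impI)
      (use inv unit \<O>_add[OF \<O>_1 eO] \<O>_diff[OF \<O>_1 eO] in blast)+
qed

text \<open>With e = E k k 1, the column x = c ** e and the row y = e ** b satisfy y ** x = e. It
  suffices to find mutually inverse u and v in the order with u ** e = x, y ** u = e, v ** x = e and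
  e ** v = y, and a unit pivot makes this possible.\<close>

lemma split_off_one:
  assumes b: "b \<in> \<O>" and c: "c \<in> \<O>" and a: "fixes_unit k (b ** c)"
    and p: "ent b k k \<noteq> 0" "val (ent b k k) = 0"
  shows "\<exists>u v. u \<in> \<O> \<and> v \<in> \<O> \<and> inverses u v \<and> fixes_unit k (b ** u) \<and> fixes_unit k (v ** c) \<and>
    (\<forall>m. m \<noteq> k \<longrightarrow> fixes_unit m b \<longrightarrow> fixes_unit m c \<longrightarrow> fixes_unit m u \<and> fixes_unit m v)"
proof -
  define e where "e = E k k 1"
  define x where "x = c ** e"
  define y where "y = e ** b"
  \<comment> \<open>The inverse of the pivot, placed at (k, k).\<close>
  define n where "n = E k k (inverse (ent b k k))"
  have assoc: "(A ** B) ** C = A ** (B ** C)" for A B C :: "'d ^ 'n ^ 'n"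
    by (simp only: matrix_mul_assoc)
  have bc: "e ** (b ** c) = e" "(b ** c) ** e = e" using a by (simp_all add: fixes_unit_def e_def)
  have ee: "e ** e = e" by (simp add: e_def E_E)
  have bx: "b ** x = e" using bc(2) by (simp add: x_def assoc)
  have yc: "y ** c = e" using bc(1) by (simp add: y_def assoc)
  have yx: "y ** x = e" unfolding y_def assoc bx ee ..
  have ey: "e ** y = y" unfolding y_def assoc[symmetric] ee ..
  have xe: "x ** e = x" unfolding x_def assoc ee ..
  have en: "e ** n = n" and ne: "n ** e = n" by (simp_all add: e_def n_def E_E)
  have yn: "y ** n = e"
    by (rule ent_eqI) (use p in \<open>auto simp: y_def e_def n_def assoc ent_E_mult ent_mult_E ent_E\<close>)
  have nye: "n ** (y ** e) = e"
    by (rule ent_eqI) (use p in \<open>auto simp: y_def e_def n_def assoc ent_E_mult ent_mult_E ent_E\<close>)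
  have nyy: "n ** (y ** y) = y"
  proof -
    have "n ** (y ** y) = n ** (y ** (e ** y))" by (simp only: ey)
    also have "\<dots> = (n ** (y ** e)) ** y" by (simp only: assoc)
    finally show ?thesis by (simp only: nye ey)
  qed
  have ext: "A ** (B ** Z) = C ** Z" if "A ** B = C" for A B C Z :: "'d ^ 'n ^ 'n"
    using that by (simp add: assoc[symmetric])
  have ext3: "A ** (B ** (D ** Z)) = C ** Z" if "A ** (B ** D) = C" for A B C D Z :: "'d ^ 'n ^ 'n"
    using that by (metis assoc)
  \<comment> \<open>A multiplication table for e, n, x and y, also with a further factor on the
    right, by which rewriting verifies the identities for u and v.\<close>
  note tab = ee yx ey xe en ne yn nye nyy ext[OF ee] ext[OF yx] ext[OF ey] ext[OF xe] ext[OF en]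
    ext[OF ne] ext[OF yn] ext3[OF nye] ext3[OF nyy]
  note dist = mm_add_left mm_diff_left mm_diff_right matrix_add_ldistrib assoc
    matrix_mul_lid matrix_mul_rid
  \<comment> \<open>The term n ** y corrects \<open>mat 1 + x\<close> in row k: since n ** (y ** e)
    = e, column k of u is exactly x, and since y ** n = e, the product y ** u is e.\<close>
  define u where "u = mat 1 + x - n ** y"
  define v where "v = mat 1 + y - e - x ** y + e ** (x ** y)"
  have uv: "u ** v = mat 1" unfolding u_def v_def by (simp add: dist tab)
  have vu: "v ** u = mat 1" unfolding u_def v_def by (simp add: dist tab)
  have eO: "e \<in> \<O>" by (simp add: e_def)
  have nO: "n \<in> \<O>" unfolding n_def by (rule E_in_\<O>) (simp add: vge_def val_inverse p)
  have xO: "x \<in> \<O>" and yO: "y \<in> \<O>" using b c eO by (simp_all add: x_def y_def \<O>_mult)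
  have O: "u \<in> \<O>" "v \<in> \<O>"
    unfolding u_def v_def by (intro \<O>_add \<O>_diff \<O>_mult \<O>_1 eO nO xO yO)+
  have ue: "u ** e = x" unfolding u_def by (simp add: dist tab)
  have yu: "y ** u = e" unfolding u_def by (simp add: dist tab)
  have vx: "v ** x = e" unfolding v_def by (simp add: dist tab)
  have ev: "e ** v = y" unfolding v_def by (simp add: dist tab)
  have "fixes_unit k (b ** u)"
    unfolding fixes_unit_def e_def[symmetric] by (simp add: assoc ue bx) (simp add: assoc[symmetric] y_def[symmetric] yu)
  moreover have "fixes_unit k (v ** c)"
    unfolding fixes_unit_def e_def[symmetric]
    by (simp add: assoc x_def[symmetric] vx) (simp add: assoc[symmetric] ev yc)
  moreover have "fixes_unit m u \<and> fixes_unit m v"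
    if m: "m \<noteq> k" "fixes_unit m b" "fixes_unit m c" for m
  proof -
    define f where "f = E m m 1"
    have fe: "f ** e = 0" "e ** f = 0" "f ** n = 0" using m(1) by (simp_all add: f_def e_def n_def E_E)
    have "f ** c = f" "b ** f = f" using m by (simp_all add: fixes_unit_def f_def)
    then have fx: "f ** x = 0" and yf: "y ** f = 0"
      using fe by (simp_all add: x_def y_def assoc) (simp add: assoc[symmetric])
    have xf: "x ** f = 0" and fy: "f ** y = 0" using fe
      by (simp_all add: x_def y_def assoc) (simp add: assoc[symmetric])
    note tab' = fe fx yf xf fy ext[OF fe(1)] ext[OF fe(2)] ext[OF fe(3)] ext[OF fx] ext[OF yf] ext[OF xf] ext[OF fy]
    show ?thesis
      unfolding fixes_unit_def f_def[symmetric] u_def v_def by (simp add: dist tab')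
  qed
  moreover have "inverses u v" unfolding inverses_def using uv vu ..
  ultimately show ?thesis using O by (intro exI[of _ u] exI[of _ v] conjI allI impI) blast+
qed

text \<open>The indices are treated one at a time: the change of pivot and the splitting for k
  preserve every index that both factors already fix.\<close>

lemma split_off:
  assumes b: "b \<in> \<O>" and c: "c \<in> \<O>" and S: "finite S" "\<And>k. k \<in> S \<Longrightarrow> fixes_unit k (b ** c)"
  shows "\<exists>u v. u \<in> \<O> \<and> v \<in> \<O> \<and> inverses u v \<and> (\<forall>k\<in>S. fixes_unit k (b ** u) \<and> fixes_unit k (v ** c))"
  using S
proof (induction S rule: finite_induct)
  case empty
  show ?case by (intro exI[of _ "mat 1"]) simp
next
  case (insert k S)
  then obtain u v where u: "u \<in> \<O>" "v \<in> \<O>" "inverses u v"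
    "\<forall>m\<in>S. fixes_unit m (b ** u) \<and> fixes_unit m (v ** c)" by auto
  have prod: "(b ** x) ** (x' ** c) = b ** c" if "inverses x x'" for x x'
    using inverses_cancel(1)[OF that] by (simp add: matrix_mul_assoc[symmetric])
  have fk: "fixes_unit k ((b ** u) ** (v ** c))" unfolding prod[OF u(3)] using insert.prems by simp
  obtain g g' where g: "g \<in> \<O>" "g' \<in> \<O>" "inverses g g'" "ent ((b ** u) ** g) k k \<noteq> 0"
    "val (ent ((b ** u) ** g) k k) = 0"
    "\<forall>m. m \<noteq> k \<longrightarrow> fixes_unit m (b ** u) \<longrightarrow> fixes_unit m g \<and> fixes_unit m g'"
    using ex_pivot[OF \<O>_mult[OF b u(1)] \<O>_mult[OF u(2) c] fk] by blast
  have ug: "inverses (u ** g) (g' ** v)" by (rule inverses_mult[OF u(3) g(3)])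
  define b1 where "b1 = b ** (u ** g)"
  define c1 where "c1 = (g' ** v) ** c"
  have b1: "b1 = (b ** u) ** g" and c1: "c1 = g' ** (v ** c)"
    by (simp_all add: b1_def c1_def matrix_mul_assoc)
  have O1: "b1 \<in> \<O>" "c1 \<in> \<O>" unfolding b1_def c1_def by (intro \<O>_mult b c u g)+
  have fk1: "fixes_unit k (b1 ** c1)" unfolding b1_def c1_def prod[OF ug] using insert.prems by simp
  have f1: "fixes_unit m b1 \<and> fixes_unit m c1" if "m \<in> S" for m
  proof -
    have "m \<noteq> k" using that insert.hyps by blast
    then have "fixes_unit m g" "fixes_unit m g'" using g(6) u(4) that by blast+
    then show ?thesis unfolding b1 c1 using fixes_unit_mult u(4) that by blast
  qed
  have p: "ent b1 k k \<noteq> 0" "val (ent b1 k k) = 0" using g(4,5) by (simp_all add: b1)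
  obtain u2 v2 where u2: "u2 \<in> \<O>" "v2 \<in> \<O>" "inverses u2 v2" "fixes_unit k (b1 ** u2)" "fixes_unit k (v2 ** c1)"
    "\<forall>m. m \<noteq> k \<longrightarrow> fixes_unit m b1 \<longrightarrow> fixes_unit m c1 \<longrightarrow> fixes_unit m u2 \<and> fixes_unit m v2"
    using split_off_one[OF O1 fk1 p] by blast
  have f2: "fixes_unit m (b1 ** u2) \<and> fixes_unit m (v2 ** c1)" if "m \<in> insert k S" for m
  proof (cases "m = k")
    case False
    then have "m \<in> S" using that by blast
    then show ?thesis using fixes_unit_mult f1 u2(6) False by blast
  qed (use u2(4,5) in simp)
  have "inverses ((u ** g) ** u2) (v2 ** (g' ** v))" by (rule inverses_mult[OF ug u2(3)])
  moreover have "b1 ** u2 = b ** ((u ** g) ** u2)" "v2 ** c1 = (v2 ** (g' ** v)) ** c"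
    by (simp_all add: b1_def c1_def matrix_mul_assoc)
  moreover have "(u ** g) ** u2 \<in> \<O>" "v2 ** (g' ** v) \<in> \<O>"
    by (intro \<O>_mult u(1,2) g(1,2) u2(1,2))+
  ultimately show ?case using f2
    by (intro exI[of _ "(u ** g) ** u2"] exI[of _ "v2 ** (g' ** v)"]) simp
qed

end

section \<open>Atoms and factorizations in a two by two block\<close>

locale nonhereditary_tiled_order = regular_tiled_order val \<pi> U V lam z
  for val :: "'d::division_ring \<Rightarrow> int" and \<pi> :: 'd and U V :: "'d ^ 'n ^ 'n" and lam z +
  fixes i j :: 'n
  assumes ij: "2 \<le> lam i j + lam j i"
begin

lemma i_neq_j: "i \<noteq> j"
  using ij by auto

definition blk :: "'d \<Rightarrow> 'd \<Rightarrow> 'd \<Rightarrow> 'd \<Rightarrow> 'd ^ 'n ^ 'n" where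
  "blk p q r s = mk (\<lambda>a b. if a = i \<and> b = i then p else if a = i \<and> b = j then q
     else if a = j \<and> b = i then r else if a = j \<and> b = j then s else if a = b then 1 else 0)"

lemma ent_blk: "ent (blk p q r s) a b = (if a = i \<and> b = i then p else if a = i \<and> b = j then q
     else if a = j \<and> b = i then r else if a = j \<and> b = j then s else if a = b then 1 else 0)"
  by (simp add: blk_def)

lemma blk_mult: "blk p q r s ** blk p' q' r' s' =
   blk (p * p' + q * r') (p * q' + q * s') (r * p' + s * r') (r * q' + s * s')"
proof (rule ent_eqI)
  fix a b
  let ?f = "\<lambda>k. ent (blk p q r s) a k * ent (blk p' q' r' s') k b"
  have sum: "ent (blk p q r s ** blk p' q' r' s') a b = (\<Sum>k\<in>UNIV. ?f k)" by (rule ent_mult)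
  show "ent (blk p q r s ** blk p' q' r' s') a b =
    ent (blk (p * p' + q * r') (p * q' + q * s') (r * p' + s * r') (r * q' + s * s')) a b"
  proof (cases "a = i \<or> a = j")
    case True
    have "(\<Sum>k\<in>UNIV. ?f k) = (\<Sum>k\<in>{i, j}. ?f k)"
      by (rule sum.mono_neutral_right) (use True i_neq_j in \<open>auto simp: ent_blk\<close>)
    then show ?thesis unfolding sum using True i_neq_j by (auto simp: ent_blk)
  next
    case False
    have "(\<Sum>k\<in>UNIV. ?f k) = (\<Sum>k\<in>{a}. ?f k)"
      by (rule sum.mono_neutral_right) (use False in \<open>auto simp: ent_blk\<close>)
    then show ?thesis unfolding sum using False by (auto simp: ent_blk)
  qed
qed

lemma blk_entries: "ent (blk p q r s) i i = p" "ent (blk p q r s) i j = q"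
  "ent (blk p q r s) j i = r" "ent (blk p q r s) j j = s"
  by (simp_all only: ent_blk i_neq_j i_neq_j[symmetric] simp_thms if_True if_False)

lemma blk_outside:
  assumes "\<not> ((a = i \<or> a = j) \<and> (b = i \<or> b = j))"
  shows "ent (blk p q r s) a b = (if a = b then 1 else 0)"
proof -
  have "\<not> (a = i \<and> b = i)" "\<not> (a = i \<and> b = j)" "\<not> (a = j \<and> b = i)" "\<not> (a = j \<and> b = j)"
    using assms by blast+
  then show ?thesis unfolding ent_blk by (simp only: if_False)
qed

lemma block_cases:
  obtains "a = i" "b = i" | "a = i" "b = j" | "a = j" "b = i" | "a = j" "b = j"
    | "\<not> ((a = i \<or> a = j) \<and> (b = i \<or> b = j))"
  by blast

lemma blk_1: "blk 1 0 0 1 = mat 1"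
proof (rule ent_eqI)
  fix a b
  show "ent (blk 1 0 0 1) a b = ent (mat 1) a b"
    by (rule block_cases[of a b])
      (simp_all only: blk_entries blk_outside ent_1 i_neq_j i_neq_j[symmetric] if_True if_False simp_thms)
qed

lemma blk_in_\<O>: "blk p q r s \<in> \<O> \<longleftrightarrow> vge 0 p \<and> vge (lam i j) q \<and> vge (lam j i) r \<and> vge 0 s"
proof
  assume "blk p q r s \<in> \<O>"
  then have *: "\<forall>a b. vge (lam a b) (ent (blk p q r s) a b)" unfolding in_\<O> .
  have "vge (lam i i) p" "vge (lam i j) q" "vge (lam j i) r" "vge (lam j j) s"
    using *[rule_format, of i i] *[rule_format, of i j] *[rule_format, of j i] *[rule_format, of j j]
    unfolding blk_entries .
  then show "vge 0 p \<and> vge (lam i j) q \<and> vge (lam j i) r \<and> vge 0 s" unfolding lam_diag by blast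
next
  assume h: "vge 0 p \<and> vge (lam i j) q \<and> vge (lam j i) r \<and> vge 0 s"
  show "blk p q r s \<in> \<O>"
    unfolding in_\<O>
  proof (intro allI)
    fix a b
    show "vge (lam a b) (ent (blk p q r s) a b)"
    proof (rule block_cases[of a b])
      assume "\<not> ((a = i \<or> a = j) \<and> (b = i \<or> b = j))"
      from blk_outside[OF this] show ?thesis by (cases "a = b") simp_all
    qed (use h in \<open>simp_all only: blk_entries lam_diag\<close>)
  qed
qed

lemma fixes_unit_blk:
  assumes "k \<noteq> i" "k \<noteq> j" shows "fixes_unit k (blk p q r s)"
  unfolding fixes_unit_def
  by (intro conjI ent_eqI) (use assms in \<open>auto simp: ent_E_mult ent_mult_E ent_E ent_blk\<close>)

lemma eq_blk:
  assumes "\<And>k. k \<noteq> i \<Longrightarrow> k \<noteq> j \<Longrightarrow> fixes_unit k x"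
  shows "x = blk (ent x i i) (ent x i j) (ent x j i) (ent x j j)"
proof (rule ent_eqI)
  fix a b
  show "ent x a b = ent (blk (ent x i i) (ent x i j) (ent x j i) (ent x j j)) a b"
  proof (cases "a = i \<or> a = j")
    case True
    show ?thesis
    proof (cases "b = i \<or> b = j")
      case True
      then show ?thesis using \<open>a = i \<or> a = j\<close> i_neq_j by (auto simp: ent_blk)
    next
      case False
      then have "ent x a b = (if a = b then 1 else 0)"
        using fixes_unit_ent(2)[OF assms[of b], of a] by simp
      then show ?thesis using True False by (auto simp: ent_blk)
    qed
  next
    case False
    then have "ent x a b = (if b = a then 1 else 0)"
      using fixes_unit_ent(1)[OF assms[of a], of b] by simp
    then show ?thesis using False by (auto simp: ent_blk)
  qed
qed

text \<open>The product of the off-diagonal entries has positive valuation, so the Schur complement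
  \<open>D\<close> is a unit together with s, and the block is a product of a lower triangular, a
  diagonal and an upper triangular unit.\<close>

lemma unit_blk:
  assumes O: "blk p q r s \<in> \<O>" and p: "\<not> vge 1 p" and s: "\<not> vge 1 s"
  shows "blk p q r s \<in> Units T"
proof -
  have v: "vge 0 p" "vge (lam i j) q" "vge (lam j i) r" "vge 0 s" using O by (simp_all add: blk_in_\<O>)
  have p0: "p \<noteq> 0" "val p = 0" using vge_exactD[of 0 p] v p by simp_all
  have s0: "s \<noteq> 0" "val s = 0" using vge_exactD[of 0 s] v s by simp_all
  have ip: "vge 0 (inverse p)" using p0 by (simp add: vge_def val_inverse)
  have rp: "vge (lam j i) (r * inverse p)" and pq: "vge (lam i j) (inverse p * q)"
    using vge_mult[OF v(3) ip] vge_mult[OF ip v(2)] by simp_all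
  define D where "D = s - r * inverse p * q"
  have "vge (lam j i + lam i j) (r * inverse p * q)" by (rule vge_mult[OF rp v(2) refl])
  then have small: "vge 1 (r * inverse p * q)" by (rule vge_mono) (use ij in linarith)
  have "\<not> vge 1 D"
  proof
    assume "vge 1 D"
    from vge_add[OF this small] show False using s by (simp add: D_def)
  qed
  moreover have "vge 0 D" unfolding D_def by (intro vge_diff v(4) vge_mono[OF small]) simp
  ultimately have D: "D \<noteq> 0" "val D = 0" using vge_exactD[of 0 D] by simp_all
  have iD: "vge 0 (inverse D)" using D by (simp add: vge_def val_inverse)
  have U1: "blk 1 0 (r * inverse p) 1 \<in> Units T"
    unfolding Units_T
    by (intro conjI bexI[of _ "blk 1 0 (- (r * inverse p)) 1"]) (simp_all add: blk_in_\<O> rp inverses_def blk_mult blk_1)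
  have U2: "blk p 0 0 D \<in> Units T"
    unfolding Units_T
    by (intro conjI bexI[of _ "blk (inverse p) 0 0 (inverse D)"])
      (use \<open>vge 0 D\<close> in \<open>simp_all add: blk_in_\<O> v ip iD inverses_def blk_mult blk_1 p0 D\<close>)
  have U3: "blk 1 (inverse p * q) 0 1 \<in> Units T"
    unfolding Units_T
    by (intro conjI bexI[of _ "blk 1 (- (inverse p * q)) 0 1"]) (simp_all add: blk_in_\<O> pq inverses_def blk_mult blk_1)
  have pq': "p * (inverse p * q) = q" using p0 by (simp flip: mult.assoc)
  have ip': "inverse p * p = 1" using p0 by simp
  have "blk 1 0 (r * inverse p) 1 ** blk p 0 0 D ** blk 1 (inverse p * q) 0 1 = blk p q r s"
    by (simp add: blk_mult D_def mult.assoc pq' ip')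
  then show ?thesis using Units_mult[OF Units_mult[OF U1 U2] U3] by simp
qed

text \<open>Since the off-diagonal entries have least possible valuation, a factorization
  has both diagonal entries of one of the factors invertible.\<close>

lemma blk_atom:
  assumes \<alpha>: "vge 1 \<alpha>" and \<beta>: "vge 1 \<beta>" and p: "p \<noteq> 0" "val p = lam i j" and q: "q \<noteq> 0" "val q = lam j i"
    and inv: "inverses (blk \<alpha> p q \<beta>) c0"
  shows "blk \<alpha> p q \<beta> \<in> atoms T"
proof -
  have "vge 0 \<alpha>" by (rule vge_mono[OF \<alpha>]) simp
  moreover have "vge 0 \<beta>" by (rule vge_mono[OF \<beta>]) simp
  ultimately have aO: "blk \<alpha> p q \<beta> \<in> \<O>" using p(2) q(2) by (simp add: blk_in_\<O> vge_def)
  then have aT: "blk \<alpha> p q \<beta> \<in> carrier T" using inv unfolding carrier_T by blast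
  have key: "b \<in> Units T \<or> c \<in> Units T" if b: "b \<in> \<O>" and c: "c \<in> \<O>" and bc: "b ** c = blk \<alpha> p q \<beta>" for b c
  proof -
    \<comment> \<open>The product is the identity outside the block, so a unit inserted between b
      and c turns both into block matrices.\<close>
    have "\<exists>u v. u \<in> \<O> \<and> v \<in> \<O> \<and> inverses u v \<and> (\<forall>k\<in>- {i, j}. fixes_unit k (b ** u) \<and> fixes_unit k (v ** c))"
      by (rule split_off[OF b c]) (simp_all add: bc fixes_unit_blk)
    then obtain u v where u: "u \<in> \<O>" "v \<in> \<O>" "inverses u v"
      and good: "\<forall>k\<in>- {i, j}. fixes_unit k (b ** u) \<and> fixes_unit k (v ** c)" by (elim exE conjE)
    define b' where "b' = b ** u"
    define c' where "c' = v ** c"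
    have "b' = blk (ent b' i i) (ent b' i j) (ent b' j i) (ent b' j j)"
      by (rule eq_blk) (use good in \<open>simp add: b'_def\<close>)
    then obtain b1 b2 b3 b4 where b': "b' = blk b1 b2 b3 b4" by (rule that)
    have "c' = blk (ent c' i i) (ent c' i j) (ent c' j i) (ent c' j j)"
      by (rule eq_blk) (use good in \<open>simp add: c'_def\<close>)
    then obtain c1 c2 c3 c4 where c': "c' = blk c1 c2 c3 c4" by (rule that)
    have bO: "b' \<in> \<O>" and cO: "c' \<in> \<O>" using b c u \<O>_mult by (simp_all add: b'_def c'_def)
    have "b' ** c' = b ** (u ** (v ** c))" by (simp add: b'_def c'_def matrix_mul_assoc)
    then have "b' ** c' = blk \<alpha> p q \<beta>" using inverses_cancel(1)[OF u(3)] bc by simp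
    then have "blk (b1 * c1 + b2 * c3) (b1 * c2 + b2 * c4) (b3 * c1 + b4 * c3) (b3 * c2 + b4 * c4) = blk \<alpha> p q \<beta>"
      by (simp add: b' c' blk_mult)
    then have ents: "ent (blk (b1 * c1 + b2 * c3) (b1 * c2 + b2 * c4) (b3 * c1 + b4 * c3) (b3 * c2 + b4 * c4)) k l =
        ent (blk \<alpha> p q \<beta>) k l" for k l by simp
    have eqs: "b1 * c1 + b2 * c3 = \<alpha>" "b1 * c2 + b2 * c4 = p" "b3 * c1 + b4 * c3 = q" "b3 * c2 + b4 * c4 = \<beta>"
      using ents[of i i] ents[of i j] ents[of j i] ents[of j j] unfolding blk_entries .
    have vb: "vge 0 b1" "vge (lam i j) b2" "vge (lam j i) b3" "vge 0 b4"
      and vc: "vge 0 c1" "vge (lam i j) c2" "vge (lam j i) c3" "vge 0 c4"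
      using bO cO by (simp_all add: b' c' blk_in_\<O>)
    have unit: "\<not> vge 1 (x * y)" if "vge 0 x" "vge 0 y" "\<not> vge 1 x" "\<not> vge 1 y" for x y
    proof -
      have "x \<noteq> 0 \<and> val x = 0" by (intro conjI vge_exactD[of 0 x]) (simp_all add: that)
      moreover have "y \<noteq> 0 \<and> val y = 0" by (intro conjI vge_exactD[of 0 y]) (simp_all add: that)
      ultimately show ?thesis by (simp add: vge_def val_mult)
    qed
    have s1: "vge (lam i j + lam j i) (b2 * c3)" by (rule vge_mult[OF vb(2) vc(3) refl])
    have s2: "vge (lam j i + lam i j) (b3 * c2)" by (rule vge_mult[OF vb(3) vc(2) refl])
    have sm1: "vge 1 (b2 * c3)" by (rule vge_mono[OF s1]) (use ij in linarith)
    have sm2: "vge 1 (b3 * c2)" by (rule vge_mono[OF s2]) (use ij in linarith)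
    have "b1 * c1 = \<alpha> - b2 * c3" by (simp only: eqs(1)[symmetric] add_diff_cancel_right')
    then have d1: "vge 1 (b1 * c1)" using vge_diff[OF \<alpha> sm1] by (simp only:)
    have "b4 * c4 = \<beta> - b3 * c2" by (simp only: eqs(4)[symmetric] add_diff_cancel_left')
    then have d4: "vge 1 (b4 * c4)" using vge_diff[OF \<beta> sm2] by (simp only:)
    \<comment> \<open>At each diagonal position one of the two factors has a nonunit. The exact
      valuations of p and q exclude that these nonunits belong to different factors, so the other
      factor has two diagonal units.\<close>
    have D1: "vge 1 b1 \<or> vge 1 c1" using unit[OF vb(1) vc(1)] d1 by argo
    have D4: "vge 1 b4 \<or> vge 1 c4" using unit[OF vb(4) vc(4)] d4 by argo
    have O1: "\<not> (vge 1 b1 \<and> vge 1 c4)"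
    proof
      assume *: "vge 1 b1 \<and> vge 1 c4"
      have "vge (lam i j + 1) (b1 * c2)" by (rule vge_mult[OF conjunct1[OF *] vc(2)]) simp
      moreover have "vge (lam i j + 1) (b2 * c4)" by (rule vge_mult[OF vb(2) conjunct2[OF *]]) simp
      ultimately have "vge (lam i j + 1) p" unfolding eqs(2)[symmetric] by (rule vge_add)
      then show False using p by (simp add: vge_def)
    qed
    have O2: "\<not> (vge 1 c1 \<and> vge 1 b4)"
    proof
      assume *: "vge 1 c1 \<and> vge 1 b4"
      have "vge (lam j i + 1) (b3 * c1)" by (rule vge_mult[OF vb(3) conjunct1[OF *]]) simp
      moreover have "vge (lam j i + 1) (b4 * c3)" by (rule vge_mult[OF conjunct2[OF *] vc(3)]) simp
      ultimately have "vge (lam j i + 1) q" unfolding eqs(3)[symmetric] by (rule vge_add)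
      then show False using q by (simp add: vge_def)
    qed
    have uU: "u \<in> Units T" "v \<in> Units T" using u inverses_sym[OF u(3)] unfolding Units_T by blast+
    have "(\<not> vge 1 b1 \<and> \<not> vge 1 b4) \<or> (\<not> vge 1 c1 \<and> \<not> vge 1 c4)" using D1 D4 O1 O2 by argo
    then have UU: "b' \<in> Units T \<or> c' \<in> Units T"
    proof (elim disjE conjE)
      assume "\<not> vge 1 b1" "\<not> vge 1 b4"
      from unit_blk[OF bO[unfolded b'] this] show ?thesis unfolding b' by (rule disjI1)
    next
      assume "\<not> vge 1 c1" "\<not> vge 1 c4"
      from unit_blk[OF cO[unfolded c'] this] show ?thesis unfolding c' by (rule disjI2)
    qed
    have bv: "b' ** v = b"
    proof -
      have "b' ** v = b ** (u ** v)" by (simp only: b'_def matrix_mul_assoc)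
      then show ?thesis using u(3) by (simp add: inverses_def)
    qed
    have uc: "u ** c' = c" unfolding c'_def by (rule inverses_cancel(1)[OF u(3)])
    from UU show ?thesis
    proof
      assume "b' \<in> Units T"
      from Units_mult[OF this uU(2)] show ?thesis unfolding bv by (rule disjI1)
    next
      assume "c' \<in> Units T"
      from Units_mult[OF uU(1) this] show ?thesis unfolding uc by (rule disjI2)
    qed
  qed
  have "blk \<alpha> p q \<beta> \<notin> Units T"
  proof
    assume "blk \<alpha> p q \<beta> \<in> Units T"
    then obtain c where c: "inverses (blk \<alpha> p q \<beta>) c" "c \<in> \<O>" by (auto simp: Units_T)
    \<comment> \<open>For an inverse in the order, row i times column i is 1, but both terms of this
      sum have positive valuation.\<close>
    have "(\<Sum>k\<in>UNIV. ent (blk \<alpha> p q \<beta>) i k * ent c k i) = 1"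
      using c(1) by (simp add: inverses_def ent_1 flip: ent_mult)
    moreover have "(\<Sum>k\<in>UNIV. ent (blk \<alpha> p q \<beta>) i k * ent c k i) = (\<Sum>k\<in>{i, j}. ent (blk \<alpha> p q \<beta>) i k * ent c k i)"
      by (rule sum.mono_neutral_right) (simp_all add: blk_outside)
    ultimately have one: "\<alpha> * ent c i i + p * ent c j i = 1" using i_neq_j by (simp add: blk_entries)
    have "vge (lam i i) (ent c i i)" and vc2: "vge (lam j i) (ent c j i)" using c(2) unfolding in_\<O> by blast+
    then have vc: "vge 0 (ent c i i)" "vge (lam j i) (ent c j i)" by simp_all
    have "vge 1 (\<alpha> * ent c i i)" by (rule vge_mult[OF \<alpha> vc(1)]) simp
    moreover have "vge (lam i j + lam j i) (p * ent c j i)"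
      by (rule vge_mult[OF _ vc(2) refl]) (simp add: vge_def p)
    then have "vge 1 (p * ent c j i)" by (rule vge_mono) (use ij in linarith)
    ultimately have "vge 1 (\<alpha> * ent c i i + p * ent c j i)" by (rule vge_add)
    then show False unfolding one by simp
  qed
  moreover have "b \<in> Units T \<or> c \<in> Units T"
    if "b \<in> carrier T" "c \<in> carrier T" "blk \<alpha> p q \<beta> = b ** c" for b c
    using key[of b c] that by (simp add: carrier_T)
  ultimately show ?thesis using aT unfolding atoms_def T_simps by blast
qed

text \<open>The blocks a and a' are adjugates of each other: their entries commute, and \<beta> is
  chosen so that the determinant \<pi> \<beta> - \<pi>^m equals \<pi>^N. Their product x is
  therefore \<pi>^N on the block, and it is also the N-th power of the nonunit y.\<close>

lemma infinite_elasticity: "\<not> elasticity T < \<infinity>"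
proof
  assume fin: "elasticity T < \<infinity>"
  \<comment> \<open>The factor 2 accounts for the least length of x, which is at most 2.\<close>
  then have "elasticity T * 2 < \<infinity>" by (simp add: ennreal_mult_less_top)
  then obtain N0 where N0: "elasticity T * 2 < of_nat N0"
    using ennreal_Ex_less_of_nat unfolding infinity_ennreal_def by blast
  \<comment> \<open>N is at least 2, so that \<pi>^(N - 1), and with it \<beta>, is a
    nonunit.\<close>
  define N where "N = N0 + 2"
  define P where "P k = \<pi> powi k" for k :: int
  have PP: "P k * P l = P (k + l)" for k l by (simp add: P_def power_int_add)
  have P0: "P 0 = 1" and P1: "P 1 = \<pi>" by (simp_all add: P_def)
  define m where "m = lam i j + lam j i"
  define \<beta> where "\<beta> = P (m - 1) + P (int N - 1)"
  define a where "a = blk \<pi> (P (lam i j)) (P (lam j i)) \<beta>"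
  define a' where "a' = blk \<beta> (- P (lam i j)) (- P (lam j i)) \<pi>"
  define x where "x = blk (P (int N)) 0 0 (P (int N))"
  define c where "c = blk (P (- int N)) 0 0 (P (- int N))"
  have PC: "P k * P l = P l * P k" for k l unfolding PP by (simp only: add.commute)
  have \<beta>C: "P k * \<beta> = \<beta> * P k" for k
    unfolding \<beta>_def distrib_left distrib_right by (simp only: PC[of k])
  have \<beta>1: "P 1 * \<beta> = P m + P (int N)" by (simp add: \<beta>_def distrib_left PP)
  then have \<beta>2: "\<beta> * P 1 = P m + P (int N)" by (simp only: \<beta>C)
  have pq: "P (lam i j) * P (lam j i) = P m" unfolding m_def by (rule PP)
  then have qp: "P (lam j i) * P (lam i j) = P m" by (simp only: PC[of "lam j i"])
  have aa1: "a ** a' = x"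
  proof -
    have "P 1 * \<beta> + P (lam i j) * - P (lam j i) = P (int N)" by (simp add: \<beta>1 pq)
    moreover have "P 1 * - P (lam i j) + P (lam i j) * P 1 = 0" by (simp add: PC[of 1 "lam i j"])
    moreover have "P (lam j i) * \<beta> + \<beta> * - P (lam j i) = 0" by (simp add: \<beta>C)
    moreover have "P (lam j i) * - P (lam i j) + \<beta> * P 1 = P (int N)" by (simp add: \<beta>2 qp)
    ultimately show ?thesis unfolding a_def a'_def x_def blk_mult P1[symmetric] by (simp only:)
  qed
  have aa2: "a' ** a = x"
  proof -
    have "\<beta> * P 1 + - P (lam i j) * P (lam j i) = P (int N)" by (simp add: \<beta>2 pq)
    moreover have "\<beta> * P (lam i j) + - P (lam i j) * \<beta> = 0" by (simp add: \<beta>C)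
    moreover have "- P (lam j i) * P 1 + P 1 * P (lam j i) = 0" by (simp add: PC[of 1 "lam j i"])
    moreover have "- P (lam j i) * P (lam i j) + P 1 * \<beta> = P (int N)" by (simp add: \<beta>1 qp)
    ultimately show ?thesis unfolding a_def a'_def x_def blk_mult P1[symmetric] by (simp only:)
  qed
  note aa = aa1 aa2
  have xc: "inverses x c" unfolding inverses_def x_def c_def blk_mult by (simp add: PP P0 blk_1)
  have comm: "c ** a' = a' ** c"
    unfolding c_def a'_def blk_mult P1[symmetric]
    by (simp only: mult_zero_left mult_zero_right add_0_left add_0_right mult_minus_left mult_minus_right
        minus_zero \<beta>C PC[of "- int N"])
  have ia: "inverses a (a' ** c)"
  proof -
    have "a ** (a' ** c) = x ** c" by (simp add: matrix_mul_assoc aa)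
    moreover have "(a' ** c) ** a = c ** x" by (simp add: comm[symmetric] aa flip: matrix_mul_assoc)
    ultimately show ?thesis using xc by (simp add: inverses_def)
  qed
  have ca: "c ** a = a ** c"
    unfolding c_def a_def blk_mult P1[symmetric]
    by (simp only: mult_zero_left mult_zero_right add_0_left add_0_right \<beta>C PC[of "- int N"])
  have ia': "inverses a' (a ** c)"
  proof -
    have "a' ** (a ** c) = x ** c" by (simp add: matrix_mul_assoc aa)
    moreover have "(a ** c) ** a' = c ** x" by (simp add: ca[symmetric] aa flip: matrix_mul_assoc)
    ultimately show ?thesis using xc by (simp add: inverses_def)
  qed
  have v: "vge 1 \<pi>" "vge 1 \<beta>" "\<And>k. P k \<noteq> 0" "\<And>k. val (P k) = k"
  proof -
    show "vge 1 \<pi>" by (simp add: vge_def)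
    show "P k \<noteq> 0" "val (P k) = k" for k by (simp_all add: P_def)
    have "vge 1 (P (m - 1))" "vge 1 (P (int N - 1))" using ij by (simp_all add: P_def m_def N_def)
    then show "vge 1 \<beta>" unfolding \<beta>_def by (rule vge_add)
  qed
  have atoms: "a \<in> atoms T" "a' \<in> atoms T"
  proof -
    show "a \<in> atoms T" unfolding a_def
      by (rule blk_atom[OF v(1,2) _ _ _ _ ia[unfolded a_def]]) (simp_all add: v(3,4))
    show "a' \<in> atoms T" unfolding a'_def
      by (rule blk_atom[OF v(2,1) _ _ _ _ ia'[unfolded a'_def]]) (simp_all add: v(3,4))
  qed
  have U1: "mat 1 \<in> Units T" unfolding Units_T using inverses_1 \<O>_1 by blast
  define y where "y = blk \<pi> 0 0 \<pi>"
  have iy: "inverses y (blk (inverse \<pi>) 0 0 (inverse \<pi>))"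
    by (simp add: y_def inverses_def blk_mult blk_1)
  have yT: "y \<in> carrier T - Units T"
  proof -
    have "y \<in> \<O>" by (simp add: y_def blk_in_\<O> vge_def)
    then have "y \<in> carrier T" using iy unfolding carrier_T by blast
    moreover have "blk (inverse \<pi>) 0 0 (inverse \<pi>) \<notin> \<O>" by (simp add: blk_in_\<O> vge_def val_inverse)
    ultimately show ?thesis using inverse_nonmember[OF iy] by blast
  qed
  have ly: "lprod (replicate n y) = blk (P (int n)) 0 0 (P (int n))" for n
  proof (induction n)
    case 0
    show ?case by (simp add: P0 blk_1)
  next
    case (Suc n)
    then show ?case by (simp add: y_def blk_mult PP flip: P1)
  qed
  have "set (replicate N y) \<subseteq> carrier T - Units T" using yT by auto
  then obtain us where us: "length (replicate N y) \<le> length us" "set us \<subseteq> atoms T" "lprod us = lprod (replicate N y)"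
    using lprod_into_atoms by blast
  have xl: "x = lprod us" unfolding us(3) ly x_def ..
  have k: "length us \<in> length_set T x"
    unfolding length_set_T
    by (intro CollectI bexI[OF _ U1] exI[of _ us] conjI refl us(2)) (simp add: xl)
  have two: "2 \<in> length_set T x"
    unfolding length_set_T using atoms U1 aa by (intro CollectI bexI[of _ "mat 1"] exI[of _ "[a, a']"]) simp_all
  have xT: "x \<in> carrier T" unfolding aa(1)[symmetric]
    by (rule mult_T) (use atoms atoms_subset in blast)+
  have xU: "x \<notin> Units T"
  proof (rule inverse_nonmember[OF xc])
    show "c \<notin> \<O>" by (simp add: c_def blk_in_\<O> vge_def v(3,4) N_def)
  qed
  define I where "I = Inf (length_set T x)"
  have "I \<in> length_set T x" unfolding I_def using two by (intro Inf_nat_def1) auto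
  have I0: "I \<noteq> 0"
  proof
    assume "I = 0"
    then have "0 \<in> length_set T x" using \<open>I \<in> length_set T x\<close> by (simp only:)
    then have "\<exists>e\<in>Units T. \<exists>us. length us = 0 \<and> set us \<subseteq> atoms T \<and> x = e ** lprod us"
      unfolding length_set_T by (rule CollectD)
    then have "x \<in> Units T" by (elim bexE exE conjE) simp
    with xU show False ..
  qed
  have I2: "I \<le> 2" unfolding I_def using two by (intro cInf_lower) auto
  let ?S = "SUP k\<in>length_set T x. of_nat k :: ennreal"
  have "?S / of_nat I \<le> elasticity T"
    unfolding elasticity_def using xT xU by (intro SUP_upper2[of x]) (simp_all add: element_elasticity_def I_def)
  then have "?S / of_nat I * of_nat I \<le> elasticity T * of_nat I" by (rule mult_right_mono) simp
  moreover have "?S / of_nat I * of_nat I = ?S"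
  proof -
    have "(of_nat I :: ennreal) / of_nat I = 1"
      by (rule ennreal_divide_self) (use I0 in \<open>simp_all add: of_nat_less_top\<close>)
    then show ?thesis unfolding ennreal_divide_times by simp
  qed
  moreover have "elasticity T * of_nat I \<le> elasticity T * 2"
  proof (rule mult_left_mono)
    show "(of_nat I :: ennreal) \<le> 2" using of_nat_mono[OF I2, where ?'a = ennreal] by simp
  qed simp
  moreover have "of_nat N0 \<le> ?S"
  proof (rule order_trans)
    show "(of_nat N0 :: ennreal) \<le> of_nat (length us)" using us(1) by (intro of_nat_mono) (simp add: N_def)
    show "of_nat (length us) \<le> ?S" by (rule SUP_upper[OF k])
  qed
  ultimately have "of_nat N0 \<le> elasticity T * 2" by order
  then show False using N0 by (simp only: leD)
qed

end

lemma (in regular_tiled_order) elasticity_iff_hereditary: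
  "elasticity T < \<infinity> \<longleftrightarrow> right_hereditary R"
proof (cases "\<forall>i j. lam i j + lam j i \<le> 1")
  case True
  then show ?thesis using finite_elasticity hereditary_if by blast
next
  case False
  then obtain i j where "\<not> lam i j + lam j i \<le> 1" by blast
  then have ij: "2 \<le> lam i j + lam j i" by linarith
  interpret nonhereditary_tiled_order val \<pi> U V lam z i j by unfold_locales (rule ij)
  show ?thesis using infinite_elasticity not_hereditary_if[OF ij] by blast
qed

section \<open>Coordinates of an abstract tiled order\<close>

lemma scalar_mult_ent: "(mat c ** (Y :: 'd::division_ring ^ 'n ^ 'n)) $ a $ b = c * Y $ a $ b"
proof -
  have "(mat c ** Y) $ a $ b = (\<Sum>k\<in>UNIV. if k = a then c * Y $ a $ b else 0)"
    unfolding mm_nth by (rule sum.cong) (auto simp: mat_def)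
  then show ?thesis by simp
qed

lemma mult_scalar_ent: "((Y :: 'd::division_ring ^ 'n ^ 'n) ** mat c) $ a $ b = Y $ a $ b * c"
proof -
  have "(Y ** mat c) $ a $ b = (\<Sum>k\<in>UNIV. if k = b then Y $ a $ b * c else 0)"
    unfolding mm_nth by (rule sum.cong) (auto simp: mat_def)
  then show ?thesis by simp
qed

lemma matrix_eqI: "(\<And>a b. Y $ a $ b = Z $ a $ b) \<Longrightarrow> Y = Z"
  by (simp add: vec_eq_iff)

section \<open>Regular matrices are invertible\<close>

context local_division_algebra
begin

lemma scalar_central: "mat (\<iota> c) ** (Y :: 'd ^ 'n ^ 'n) = Y ** mat (\<iota> c)"
  by (simp add: vec_eq_iff scalar_mult_ent mult_scalar_ent \<iota>_central[of "Y $ _ $ _"])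

lemma scalar_mult_left_commute: "x ** (mat (\<iota> c) ** (Y :: 'd ^ 'n ^ 'n)) = mat (\<iota> c) ** ((x :: 'd ^ 'n ^ 'n) ** Y)"
proof -
  have "x ** (mat (\<iota> c) ** Y) = x ** mat (\<iota> c) ** Y" by (rule matrix_mul_assoc)
  also have "x ** mat (\<iota> c) = mat (\<iota> c) ** x" by (rule scalar_central[symmetric])
  also have "mat (\<iota> c) ** x ** Y = mat (\<iota> c) ** (x ** Y)" by (rule matrix_mul_assoc[symmetric])
  finally show ?thesis .
qed

lemma matrix_vector_space: "vector_space (\<lambda>c (Y :: 'd ^ 'n ^ 'n). mat (\<iota> c) ** Y)"
proof
  fix a b :: 'f and x y :: "'d ^ 'n ^ 'n"
  show "mat (\<iota> a) ** (x + y) = mat (\<iota> a) ** x + mat (\<iota> a) ** y" by (rule matrix_add_ldistrib)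
  show "mat (\<iota> (a + b)) ** x = mat (\<iota> a) ** x + mat (\<iota> b) ** x"
    by (rule matrix_eqI) (simp only: scalar_mult_ent vector_add_component \<iota>_add distrib_right)
  show "mat (\<iota> a) ** (mat (\<iota> b) ** x) = mat (\<iota> (a * b)) ** x"
    by (rule matrix_eqI) (simp only: scalar_mult_ent \<iota>_mult mult.assoc)
  show "mat (\<iota> 1) ** x = x" by simp
qed

lemma matrix_finite_dimensional:
  "\<exists>Bas. finite_dimensional_vector_space (\<lambda>c (Y :: 'd ^ 'n ^ 'n). mat (\<iota> c) ** Y) Bas"
proof -
  interpret M: vector_space "\<lambda>c (Y :: 'd ^ 'n ^ 'n). mat (\<iota> c) ** Y" by (rule matrix_vector_space)
  define un :: "'n \<Rightarrow> 'n \<Rightarrow> 'd \<Rightarrow> 'd ^ 'n ^ 'n" where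
    "un i j d = (\<chi> a b. if a = i \<and> b = j then d else 0)" for i j d
  define G where "G = (\<lambda>(i, j, b). un i j b) ` (UNIV \<times> UNIV \<times> B)"
  have finG: "finite G" unfolding G_def using V.finite_Basis by (intro finite_imageI finite_cartesian_product) auto
  have "Y \<in> M.span G" for Y
  proof -
    have "Y = (\<Sum>i\<in>UNIV. \<Sum>j\<in>UNIV. \<Sum>b\<in>B. mat (\<iota> (coord b (Y $ i $ j))) ** un i j b)"
    proof (simp only: vec_eq_iff, intro allI)
      fix p q
      have "(\<Sum>i\<in>UNIV. \<Sum>j\<in>UNIV. \<Sum>b\<in>B. mat (\<iota> (coord b (Y $ i $ j))) ** un i j b) $ p $ q =
          (\<Sum>i\<in>UNIV. \<Sum>j\<in>UNIV. \<Sum>b\<in>B. \<iota> (coord b (Y $ i $ j)) * un i j b $ p $ q)"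
        by (simp only: sum_component scalar_mult_ent)
      also have "\<dots> = (\<Sum>i\<in>UNIV. \<Sum>j\<in>UNIV. if i = p then (if j = q then Y $ p $ q else 0) else 0)"
      proof (intro sum.cong refl)
        fix i j
        show "(\<Sum>b\<in>B. \<iota> (coord b (Y $ i $ j)) * un i j b $ p $ q) =
            (if i = p then (if j = q then Y $ p $ q else 0) else 0)"
        proof (cases "i = p \<and> j = q")
          case True
          then have un: "un i j b $ p $ q = b" for b by (simp add: un_def)
          show ?thesis unfolding un sum_coord using True by simp
        next
          case False
          then have "un i j b $ p $ q = 0" for b by (auto simp: un_def)
          moreover have "(if i = p then (if j = q then Y $ p $ q else 0) else 0) = 0" using False by argo
          ultimately show ?thesis by (simp only: mult_zero_right sum.neutral_const)
        qed
      qed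
      also have "\<dots> = (\<Sum>i\<in>UNIV. if i = p then Y $ p $ q else 0)"
        by (intro sum.cong refl) simp
      also have "\<dots> = Y $ p $ q" by simp
      finally show "Y $ p $ q = (\<Sum>i\<in>UNIV. \<Sum>j\<in>UNIV. \<Sum>b\<in>B. mat (\<iota> (coord b (Y $ i $ j))) ** un i j b) $ p $ q"
        by (rule sym)
    qed
    moreover have "(\<Sum>i\<in>UNIV. \<Sum>j\<in>UNIV. \<Sum>b\<in>B. mat (\<iota> (coord b (Y $ i $ j))) ** un i j b) \<in> M.span G"
    proof (intro M.span_sum M.span_scale M.span_base)
      fix i j b assume "b \<in> B"
      then show "un i j b \<in> G" unfolding G_def by (intro image_eqI[of _ _ "(i, j, b)"]) simp_all
    qed
    ultimately show ?thesis by (rule ssubst)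
  qed
  then have span: "M.span G = UNIV" by blast
  obtain Bas where Bas: "Bas \<subseteq> G" "M.independent Bas" "G \<subseteq> M.span Bas"
    by (rule M.maximal_independent_subset)
  have "M.span G \<subseteq> M.span Bas" by (rule M.span_minimal[OF Bas(3) M.subspace_span])
  then have sp: "M.span Bas = UNIV" using span by blast
  have "finite_dimensional_vector_space (\<lambda>c (Y :: 'd ^ 'n ^ 'n). mat (\<iota> c) ** Y) Bas"
    by (intro finite_dimensional_vector_space.intro finite_dimensional_vector_space_axioms.intro
        M.vector_space_axioms Bas(2) sp finite_subset[OF Bas(1) finG])
  then show ?thesis by (rule exI)
qed

text \<open>Left and right multiplication by x are injective linear endomorphisms of a finite
  dimensional space, hence surjective, which gives inverses on both sides.\<close>

lemma regular_matrix_invertible: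
  fixes x :: "'d ^ 'n ^ 'n"
  assumes "\<And>y :: 'd ^ 'n ^ 'n. x ** y = 0 \<Longrightarrow> y = 0" "\<And>y :: 'd ^ 'n ^ 'n. y ** x = 0 \<Longrightarrow> y = 0"
  shows "\<exists>y. inverses x y"
proof -
  obtain Bas where "finite_dimensional_vector_space (\<lambda>c (Y :: 'd ^ 'n ^ 'n). mat (\<iota> c) ** Y) Bas"
    using matrix_finite_dimensional ..
  then interpret M: finite_dimensional_vector_space "\<lambda>c (Y :: 'd ^ 'n ^ 'n). mat (\<iota> c) ** Y" Bas .
  have l: "Vector_Spaces.linear (\<lambda>c Y. mat (\<iota> c) ** Y) (\<lambda>c Y. mat (\<iota> c) ** Y) (\<lambda>y :: 'd ^ 'n ^ 'n. x ** y)"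
    unfolding Vector_Spaces.linear_iff
  proof (intro conjI allI M.vector_space_axioms)
    show "x ** (b1 + b2) = x ** b1 + x ** b2" for b1 b2 :: "'d ^ 'n ^ 'n" by (rule matrix_add_ldistrib)
    show "x ** (mat (\<iota> r) ** b) = mat (\<iota> r) ** (x ** b)" for r and b :: "'d ^ 'n ^ 'n"
      by (rule scalar_mult_left_commute)
  qed
  have r: "Vector_Spaces.linear (\<lambda>c Y. mat (\<iota> c) ** Y) (\<lambda>c Y. mat (\<iota> c) ** Y) (\<lambda>y :: 'd ^ 'n ^ 'n. y ** x)"
    unfolding Vector_Spaces.linear_iff
  proof (intro conjI allI M.vector_space_axioms)
    show "(b1 + b2) ** x = b1 ** x + b2 ** x" for b1 b2 :: "'d ^ 'n ^ 'n" by (rule mm_add_left)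
    show "(mat (\<iota> r) ** b) ** x = mat (\<iota> r) ** (b ** x)" for r and b :: "'d ^ 'n ^ 'n"
      by (simp only: matrix_mul_assoc)
  qed
  have il: "inj (\<lambda>y :: 'd ^ 'n ^ 'n. x ** y)"
  proof (rule injI)
    fix y y' :: "'d ^ 'n ^ 'n" assume "x ** y = x ** y'"
    then have "x ** (y - y') = 0" by (simp add: mm_diff_right)
    then have "y - y' = 0" by (rule assms(1))
    then show "y = y'" by simp
  qed
  have ir: "inj (\<lambda>y :: 'd ^ 'n ^ 'n. y ** x)"
  proof (rule injI)
    fix y y' :: "'d ^ 'n ^ 'n" assume "y ** x = y' ** x"
    then have "(y - y') ** x = 0" by (simp add: mm_diff_left)
    then have "y - y' = 0" by (rule assms(2))
    then show "y = y'" by simp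
  qed
  obtain y :: "'d ^ 'n ^ 'n" where y: "mat 1 = x ** y" using M.linear_inj_imp_surj[OF l il] by (rule surjE)
  obtain y' :: "'d ^ 'n ^ 'n" where y': "mat 1 = y' ** x" using M.linear_inj_imp_surj[OF r ir] by (rule surjE)
  have "y' = y' ** (x ** y)" by (simp add: y[symmetric])
  also have "\<dots> = y" by (simp add: matrix_mul_assoc y'[symmetric])
  finally have "y ** x = mat 1" using y' by (simp only:)
  then show ?thesis unfolding inverses_def using y[symmetric] by blast
qed

end

lemma ring_matrix_simps: "carrier matrix_ring = UNIV" "add matrix_ring = (+)" "ring.zero matrix_ring = 0"
  "monoid.mult matrix_ring = (**)" "monoid.one matrix_ring = mat 1"
  by (simp_all add: matrix_ring_def)

section \<open>The exponent matrix of a given tiled order\<close>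

locale tiled_order_coordinates = local_division_algebra w t \<iota> B + discrete_valuation val \<pi> +
  matrix_coordinates U V
  for w :: "'f::field \<Rightarrow> real" and t and \<iota> :: "'f \<Rightarrow> 'd::division_ring" and B
    and val :: "'d \<Rightarrow> int" and \<pi> and U V :: "'d ^ 'n ^ 'n" +
  fixes Ord :: "('d ^ 'n ^ 'n) set"
  assumes val_t: "0 < val (\<iota> t)" and val_\<iota>: "c \<noteq> 0 \<Longrightarrow> w c \<le> 1 \<Longrightarrow> 0 \<le> val (\<iota> c)"
    and order: "is_order (valuation_ring w) (scalar_matrix \<iota>) matrix_ring Ord"
    and diagonal: "d \<in> diagonal_matrices {x. x = 0 \<or> 0 \<le> val x} \<Longrightarrow> U ** d ** V \<in> Ord"
begin

lemma Ord_1: "mat 1 \<in> Ord"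
  and Ord_diff: "x \<in> Ord \<Longrightarrow> y \<in> Ord \<Longrightarrow> x - y \<in> Ord"
  and Ord_mult: "x \<in> Ord \<Longrightarrow> y \<in> Ord \<Longrightarrow> x ** y \<in> Ord"
  using order unfolding is_order_def subring_iff[OF ring_matrix_ring ring_matrix_simps(1-3)] ring_matrix_simps
  by blast+

lemma Ord_0: "0 \<in> Ord"
  using Ord_diff[OF Ord_1 Ord_1] by simp

lemma Ord_sum: "(\<And>a. a \<in> A \<Longrightarrow> f a \<in> Ord) \<Longrightarrow> sum f A \<in> Ord"
proof (induction A rule: infinite_finite_induct)
  case (insert a A)
  have fa: "f a \<in> Ord" by (rule insert.prems) simp
  have "sum f A \<in> Ord" by (rule insert.IH, rule insert.prems) simp
  then have "0 - sum f A \<in> Ord" by (rule Ord_diff[OF Ord_0])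
  then have "f a - (0 - sum f A) \<in> Ord" by (rule Ord_diff[OF fa])
  then show ?case using insert.hyps by simp
qed (simp_all add: Ord_0)

lemma E_diag_in_Ord: "vge 0 s \<Longrightarrow> E i i s \<in> Ord"
proof -
  assume s: "vge 0 s"
  have "E i i s = U ** (\<chi> a b. if a = i \<and> b = i then s else 0) ** V" by (simp only: E_def mk_def)
  moreover have "(\<chi> a b. if a = i \<and> b = i then s else 0) \<in> diagonal_matrices {x. x = 0 \<or> 0 \<le> val x}"
    using s by (auto simp: diagonal_matrices_def vge_def)
  ultimately show ?thesis using diagonal by simp
qed

lemma ent_scalar: "ent (mat (\<iota> c) ** x) i j = \<iota> c * ent x i j"
proof -
  have "V ** (mat (\<iota> c) ** x) ** U = mat (\<iota> c) ** (V ** x ** U)"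
    by (simp only: matrix_mul_assoc scalar_central[of c V])
  then show ?thesis by (simp only: ent_def scalar_mult_ent)
qed

lemma E_mult_E: "E a b s ** E b c u = E a c (s * u)"
  by (rule ent_eqI) (simp add: ent_E_mult ent_E)

text \<open>The diagonal idempotents belong to the order, and multiplying by them on both sides
  extracts a single entry.\<close>

lemma component_in_Ord: "x \<in> Ord \<Longrightarrow> E i j (ent x i j) \<in> Ord"
proof -
  assume x: "x \<in> Ord"
  have "E i i 1 ** x ** E j j 1 \<in> Ord" by (intro Ord_mult x E_diag_in_Ord) simp_all
  moreover have "E i i 1 ** x ** E j j 1 = E i j (ent x i j)"
    by (rule ent_eqI) (auto simp: ent_mult_E ent_E_mult ent_E)
  ultimately show ?thesis by simp
qed

lemma Ord_iff: "x \<in> Ord \<longleftrightarrow> (\<forall>i j. E i j (ent x i j) \<in> Ord)"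
proof
  assume *: "\<forall>i j. E i j (ent x i j) \<in> Ord"
  have "x = (\<Sum>i\<in>UNIV. \<Sum>j\<in>UNIV. E i j (ent x i j))"
  proof (rule ent_eqI)
    fix p q
    have "ent (\<Sum>i\<in>UNIV. \<Sum>j\<in>UNIV. E i j (ent x i j)) p q =
        (\<Sum>i\<in>UNIV. \<Sum>j\<in>UNIV. if i = p then (if j = q then ent x p q else 0) else 0)"
      unfolding ent_sum by (intro sum.cong refl) (auto simp: ent_E)
    also have "\<dots> = (\<Sum>i\<in>UNIV. if i = p then ent x p q else 0)" by (intro sum.cong refl) simp
    finally show "ent x p q = ent (\<Sum>i\<in>UNIV. \<Sum>j\<in>UNIV. E i j (ent x i j)) p q" by simp
  qed
  moreover have "(\<Sum>i\<in>UNIV. \<Sum>j\<in>UNIV. E i j (ent x i j)) \<in> Ord" by (intro Ord_sum) (use * in blast)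
  ultimately show "x \<in> Ord" by (rule ssubst)
qed (blast intro: component_in_Ord)

text \<open>Finitely many generators have bounded denominators, and coefficients from the valuation
  ring do not increase them.\<close>

lemma ent_bounded: "\<exists>K. \<forall>x\<in>Ord. \<forall>i j. vge K (ent x i j)"
proof -
  obtain G where G: "finite G" "Ord = linear_span (valuation_ring w) (scalar_matrix \<iota>) matrix_ring G"
    using order unfolding is_order_def by blast
  have span: "Ord = {(\<Sum>s\<in>G. mat (\<iota> (c s)) ** s) | c. \<forall>s\<in>G. w (c s) \<le> 1}"
    unfolding G(2)
    by (subst linear_span_finite[OF ring_matrix_ring ring_matrix_simps(1-3) G(1)])
      (simp_all add: valuation_ring_def scalar_matrix_def ring_matrix_simps)
  define g where "g p = \<bar>val (ent (fst p) (fst (snd p)) (snd (snd p)))\<bar>" for p :: "('d ^ 'n ^ 'n) \<times> 'n \<times> 'n"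
  define K where "K = - (\<Sum>p\<in>G \<times> UNIV. g p)"
  have K: "vge K (ent s i j)" if "s \<in> G" for s i j
  proof -
    have "g (s, i, j) \<le> (\<Sum>p\<in>G \<times> UNIV. g p)"
      by (rule member_le_sum[of "(s, i, j)" "G \<times> UNIV" g]) (use that G(1) in \<open>simp_all add: g_def\<close>)
    then have "K \<le> - g (s, i, j)" by (simp only: K_def neg_le_iff_le)
    then have "K \<le> - \<bar>val (ent s i j)\<bar>" by (simp add: g_def)
    then have "K \<le> val (ent s i j)" by linarith
    then show ?thesis by (simp add: vge_def)
  qed
  have "vge K (ent x i j)" if x: "x \<in> Ord" for x i j
  proof -
    obtain c where c: "x = (\<Sum>s\<in>G. mat (\<iota> (c s)) ** s)" "\<forall>s\<in>G. w (c s) \<le> 1"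
      using x unfolding span by blast
    show ?thesis unfolding c(1) ent_sum ent_scalar
    proof (rule vge_sum)
      fix s assume s: "s \<in> G"
      have "vge 0 (\<iota> (c s))" using val_\<iota>[of "c s"] c(2) s by (auto simp: vge_def)
      from vge_mult[OF this K[OF s]] show "vge K (\<iota> (c s) * ent s i j)" by simp
    qed
  qed
  then show ?thesis by blast
qed

text \<open>Otherwise the (i, j) entry would vanish on the span of the order over the field, which
  is the whole matrix ring.\<close>

lemma ent_nonzero: "\<exists>x\<in>Ord. ent x i j \<noteq> 0"
proof (rule ccontr)
  assume "\<not> ?thesis"
  then have z: "ent x i j = 0" if "x \<in> Ord" for x using that by blast
  have "E i j 1 \<in> linear_span UNIV (scalar_matrix \<iota>) matrix_ring Ord"
    using order unfolding is_order_def ring_matrix_simps by blast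
  then obtain G c where G: "finite G" "G \<subseteq> Ord"
    "E i j 1 = (\<Oplus>\<^bsub>matrix_ring\<^esub>s\<in>G. scalar_matrix \<iota> (c s) \<otimes>\<^bsub>matrix_ring\<^esub> s)"
    unfolding linear_span_def by blast
  have "E i j 1 = (\<Sum>s\<in>G. mat (\<iota> (c s)) ** s)"
    using G(3) unfolding finsum_eq_sum[OF ring_matrix_ring ring_matrix_simps(1-3) G(1)]
    by (simp add: scalar_matrix_def ring_matrix_simps)
  then have "ent (E i j 1) i j = (\<Sum>s\<in>G. \<iota> (c s) * ent s i j)" by (simp only: ent_sum ent_scalar)
  also have "\<dots> = 0" by (rule sum.neutral) (use z G(2) in auto)
  finally show False by (simp add: ent_E)
qed

text \<open>The s with \<open>E i j s\<close> in the order form a nonzero right module over the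
  maximal order with valuations bounded below, so an element of least valuation generates
  it.\<close>

lemma ex_exponent: "\<exists>k. \<forall>s. E i j s \<in> Ord \<longleftrightarrow> vge k s"
proof -
  obtain K where K: "\<forall>x\<in>Ord. \<forall>i j. vge K (ent x i j)" using ent_bounded ..
  have b: "K \<le> val s" if "E i j s \<in> Ord" "s \<noteq> 0" for s
  proof -
    have "vge K (ent (E i j s) i j)" using K that(1) by blast
    then show ?thesis using that(2) by (simp add: ent_E vge_def)
  qed
  \<comment> \<open>The bound \<open>K\<close> shifts the valuations to natural numbers, among which
    a least one exists.\<close>
  define Q where "Q k \<longleftrightarrow> (\<exists>s. E i j s \<in> Ord \<and> s \<noteq> 0 \<and> val s = K + int k)" for k
  obtain x where x: "x \<in> Ord" "ent x i j \<noteq> 0" using ent_nonzero by blast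
  have xE: "E i j (ent x i j) \<in> Ord" by (rule component_in_Ord[OF x(1)])
  have "Q (nat (val (ent x i j) - K))"
    unfolding Q_def using b[OF xE x(2)] xE x(2) by (intro exI[of _ "ent x i j"]) simp
  then have "Q (LEAST k. Q k)" by (rule LeastI)
  then obtain s0 where s0: "E i j s0 \<in> Ord" "s0 \<noteq> 0" "val s0 = K + int (LEAST k. Q k)"
    unfolding Q_def[of "LEAST k. Q k"] by blast
  have "E i j s \<in> Ord \<longleftrightarrow> vge (val s0) s" for s
  proof
    assume s: "E i j s \<in> Ord"
    show "vge (val s0) s"
    proof (cases "s = 0")
      case False
      have "Q (nat (val s - K))" unfolding Q_def using b[OF s False] s False by (intro exI[of _ s]) simp
      then have "(LEAST k. Q k) \<le> nat (val s - K)" by (rule Least_le)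
      then have "val s0 \<le> val s" using s0(3) b[OF s False] by linarith
      then show ?thesis by (simp add: vge_def)
    qed simp
  next
    assume s: "vge (val s0) s"
    have "vge 0 (inverse s0 * s)" using s s0(2) by (auto simp: vge_def val_mult val_inverse)
    then have "E i j s0 ** E j j (inverse s0 * s) \<in> Ord" by (intro Ord_mult s0(1) E_diag_in_Ord)
    moreover have "s0 * (inverse s0 * s) = s" using s0(2) by (simp flip: mult.assoc)
    ultimately show "E i j s \<in> Ord" by (simp add: E_mult_E)
  qed
  then show ?thesis by blast
qed

lemma elasticity_iff_hereditary:
  "elasticity (cancellative_monoid (matrix_ring\<lparr>carrier := Ord\<rparr>)) < \<infinity> \<longleftrightarrow>
   right_hereditary (matrix_ring\<lparr>carrier := Ord\<rparr>)"
proof -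
  have "\<forall>i. \<exists>f. \<forall>j. \<forall>s. E i j s \<in> Ord \<longleftrightarrow> vge (f j) s" using ex_exponent by (intro allI choice)
  then have "\<exists>lam. \<forall>i. \<forall>j. \<forall>s. E i j s \<in> Ord \<longleftrightarrow> vge (lam i j) s" by (rule choice)
  then obtain lam where lam: "\<And>i j s. E i j s \<in> Ord \<longleftrightarrow> vge (lam i j) s" by blast
  have tri: "lam i k \<le> lam i j + lam j k" for i j k
  proof -
    have "E i j (\<pi> powi (lam i j)) ** E j k (\<pi> powi (lam j k)) \<in> Ord" by (intro Ord_mult) (simp_all add: lam)
    then have "vge (lam i k) (\<pi> powi (lam i j) * \<pi> powi (lam j k))" by (simp add: E_mult_E lam)
    then show ?thesis by (simp add: vge_def val_mult)
  qed
  have diag: "lam i i = 0" for i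
  proof -
    have "E i i 1 \<in> Ord" by (rule E_diag_in_Ord) simp
    then show ?thesis using tri[of i i i] by (simp add: lam)
  qed
  interpret TO: tiled_order val \<pi> U V lam "\<iota> t"
    by unfold_locales (use tri diag val_t in \<open>auto simp: \<iota>_central\<close>)
  have Ord: "TO.\<O> = Ord"
  proof (rule Set.set_eqI)
    fix x
    show "x \<in> TO.\<O> \<longleftrightarrow> x \<in> Ord" by (simp only: TO.in_\<O> Ord_iff[of x] lam)
  qed
  interpret TO: regular_tiled_order val \<pi> U V lam "\<iota> t"
  proof
    fix x :: "'d ^ 'n ^ 'n"
    assume r: "\<And>y. y \<in> TO.\<O> \<Longrightarrow> x ** y = 0 \<Longrightarrow> y = 0" and l: "\<And>y. y \<in> TO.\<O> \<Longrightarrow> y ** x = 0 \<Longrightarrow> y = 0"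
    \<comment> \<open>A power of t carries any matrix into the order, so regularity against elements
      of the order extends to the full matrix ring.\<close>
    have scale: "\<exists>m. mat (\<iota> (t ^ m)) ** y \<in> TO.\<O>" for y
    proof -
      define g where "g p = nat (lam (fst p) (snd p) - val (ent y (fst p) (snd p)))" for p
      define m where "m = (\<Sum>p\<in>UNIV. g p)"
      have "vge (lam i j) (\<iota> (t ^ m) * ent y i j)" for i j
      proof (cases "ent y i j = 0")
        case False
        have "g (i, j) \<le> m"
          unfolding m_def by (rule member_le_sum[of "(i, j)" UNIV g]) simp_all
        then have 1: "lam i j - val (ent y i j) \<le> int m" by (simp add: g_def)
        have nz: "\<iota> t \<noteq> 0" by simp
        have "int m * 1 \<le> int m * val (\<iota> t)" using val_t by (intro mult_left_mono) auto
        then have "lam i j \<le> val (\<iota> (t ^ m)) + val (ent y i j)"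
          using 1 unfolding \<iota>_power val_power[OF nz] by linarith
        moreover have "\<iota> (t ^ m) \<noteq> 0" by simp
        ultimately show ?thesis using False val_mult[of "\<iota> (t ^ m)" "ent y i j"] by (simp add: vge_def)
      qed simp
      then show ?thesis unfolding TO.in_\<O> ent_scalar by blast
    qed
    have zero: "y = 0" if "mat (\<iota> (t ^ m)) ** y = 0" for y :: "'d ^ 'n ^ 'n" and m
    proof -
      have "\<iota> (t ^ m) * y $ a $ b = 0" for a b
        using scalar_mult_ent[of "\<iota> (t ^ m)" y a b] that by simp
      then show ?thesis by (simp add: vec_eq_iff)
    qed
    show "\<exists>y. inverses x y"
    proof (rule regular_matrix_invertible)
      fix y :: "'d ^ 'n ^ 'n" assume xy: "x ** y = 0"
      obtain m where m: "mat (\<iota> (t ^ m)) ** y \<in> TO.\<O>" using scale ..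
      have "x ** (mat (\<iota> (t ^ m)) ** y) = mat (\<iota> (t ^ m)) ** (x ** y)"
        by (rule scalar_mult_left_commute)
      then have "x ** (mat (\<iota> (t ^ m)) ** y) = 0" by (simp add: xy)
      then show "y = 0" using r[OF m] zero by blast
    next
      fix y :: "'d ^ 'n ^ 'n" assume yx: "y ** x = 0"
      obtain m where m: "mat (\<iota> (t ^ m)) ** y \<in> TO.\<O>" using scale ..
      have "(mat (\<iota> (t ^ m)) ** y) ** x = mat (\<iota> (t ^ m)) ** (y ** x)" by (simp only: matrix_mul_assoc)
      then have "(mat (\<iota> (t ^ m)) ** y) ** x = 0" by (simp add: yx)
      then show "y = 0" using l[OF m] zero by blast
    qed
  qed
  show ?thesis using TO.elasticity_iff_hereditary unfolding Ord .
qed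

end

theorem corollary4p7:
  fixes v :: "'k::field_char_0 \<Rightarrow> real"
    and j :: "'k \<Rightarrow> 'f::field"
    and w :: "'f \<Rightarrow> real"
    and \<iota> :: "'f \<Rightarrow> 'd::division_ring"
    and \<O> :: "('d ^ 'n ^ 'n) set"
  assumes "number_field TYPE('k)"
    and "nonarch_absolute_value v"
    and "is_completion v j w"
    and "central_division_algebra \<iota>"
    and "is_tiled_order w \<iota> \<O>"
  shows "elasticity (cancellative_monoid (matrix_ring\<lparr>carrier := \<O>\<rparr>)) < \<infinity> \<longleftrightarrow>
         right_hereditary (matrix_ring\<lparr>carrier := \<O>\<rparr>)"
proof -
  obtain t where t: "local_field w t" using completion_local_field[OF assms(1-3)] ..
  have hom: "\<iota> \<in> ring_hom type_ring type_ring" and cen: "range \<iota> = {z. \<forall>x. z * x = x * z}"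
    and "\<exists>B. finite_dimensional_vector_space (\<lambda>c x. \<iota> c * x) B"
    using assms(4) unfolding central_division_algebra_def by blast+
  then obtain B where B: "finite_dimensional_vector_space (\<lambda>c x. \<iota> c * x) B" by blast
  interpret local_field w t by (rule t)
  interpret fd: finite_dimensional_vector_space "\<lambda>c x. \<iota> c * x" B by (rule B)
  interpret local_division_algebra w t \<iota> B
  proof
    show "\<iota> (a + b) = \<iota> a + \<iota> b" "\<iota> (a * b) = \<iota> a * \<iota> b" "\<iota> 1 = 1" for a b
      using hom by (simp_all add: ring_hom_def type_ring_simps)
    show "x * \<iota> c = \<iota> c * x" for x c
    proof -
      have "\<iota> c \<in> {z. \<forall>x. z * x = x * z}" unfolding cen[symmetric] by (rule rangeI)
      then have "\<iota> c * x = x * \<iota> c" by blast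
      then show ?thesis by (rule sym)
    qed
  qed
  from ex_valuation obtain val \<pi> where val: "discrete_valuation val \<pi>"
    "the_maximal_order w \<iota> = {x. x = 0 \<or> 0 \<le> val x}" "0 < val (\<iota> t)"
    "\<forall>c. c \<noteq> 0 \<longrightarrow> w c \<le> 1 \<longrightarrow> 0 \<le> val (\<iota> c)" by (elim exE conjE)
  from assms(5)[unfolded is_tiled_order_def] obtain U V :: "'d ^ 'n ^ 'n" where
    ord: "is_order (valuation_ring w) (scalar_matrix \<iota>) matrix_ring \<O>" and UV: "U ** V = mat 1" "V ** U = mat 1"
    and diag: "(\<lambda>Y. U ** Y ** V) ` diagonal_matrices (the_maximal_order w \<iota>) \<subseteq> \<O>" by (elim exE conjE)
  have "tiled_order_coordinates w t \<iota> B val \<pi> U V \<O>"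
  proof (intro tiled_order_coordinates.intro tiled_order_coordinates_axioms.intro matrix_coordinates.intro
      local_division_algebra_axioms val(1))
    show "U ** V = mat 1" "V ** U = mat 1" by (rule UV)+
    show "0 < val (\<iota> t)" by (rule val(3))
    show "0 \<le> val (\<iota> c)" if "c \<noteq> 0" "w c \<le> 1" for c using val(4) that by blast
    show "is_order (valuation_ring w) (scalar_matrix \<iota>) matrix_ring \<O>" by (rule ord)
    show "U ** d ** V \<in> \<O>" if "d \<in> diagonal_matrices {x. x = 0 \<or> 0 \<le> val x}" for d
      using diag that unfolding val(2) by blast
  qed
  then show ?thesis by (rule tiled_order_coordinates.elasticity_iff_hereditary)
qed

end
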